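(* Let $\theta>0$ and let $(\mathbb P_n)_{n\in\mathbb N}$ be any sequence of asymptotically Ewens measures with parameter $\theta$. For a partition $\alpha=(\alpha_1,\ldots,\alpha_n)$ of $n$ and $0\le t\le1$, let $O_{n,t}=\operatorname{lcm}\{i\le n^t:\alpha_i>0\}$ be the least common multiple of the parts of size at most $n^t$ (equal to $1$ if there are none). Then, with the partition of $n$ distributed according to $\mathbb P_n$, the process $$\left(\frac{\log O_{n,t}-\theta t^2(\log n)^2/2}{\sqrt{\theta(\log n)^3/3}}\right)_{0\le t\le1}$$ converges in distribution in the Skorohod space $\mathcal D[0,1]$ of right-continuous functions with left limits on $[0,1]$, as $n\to\infty$, to $(W_{t^3})_{0\le t\le1}$, where $W$ is the standard Brownian motion. The same result holds if $O_{n,t}$ is instead the product of the parts of size at most $n^t$, i.e. $O_{n,t}=\prod_{i\le n^t}i^{\alpha_i}$.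
   Context: Partitions. $\mathcal P_n$ is the set of partitions of $n$, written $\alpha=(\alpha_1,\ldots,\alpha_n)$, where $\alpha_i\ge0$ is the number of parts of size $i$, so $\alpha_1+2\alpha_2+\cdots+n\alpha_n=n$. A vector $(\alpha_1,\ldots,\alpha_m)$ of nonnegative integers is regarded as a partition of $k=\sum_{i\le m} i\alpha_i$ (discarding or appending zeros as needed; $k=0$ gives the empty partition). Ewens measure. For $\theta>0$, $\mathbb P^\theta_n(\alpha)=\frac{n!}{\theta(\theta+1)\cdots(\theta+n-1)}\prod_{i=1}^n\frac{\theta^{\alpha_i}}{i^{\alpha_i}\alpha_i!}$ for $\alpha\in\mathcal P_n$. Perturbed measures. Given a nonnegative function $\eta$ on the set of all partitions of all integers $k\ge0$, let $\mathbb P^{\theta,\eta}_n(\alpha)=\frac{\eta(\alpha)}{Z^{\theta,\eta}_n}\prod_{i=1}^n\frac{\theta^{\alpha_i}}{i^{\alpha_i}\alpha_i!}$ for $\alpha\in\mathcal P_n$, where $Z_n^{\theta,\eta}$ is the normalising constant (assumed positive for every $n\in\mathbb N$). Thus $\eta$ restricted to $\mathcal P_n$ is a positive constant multiple of the Radon-Nikodym derivative of $\mathbb P^{\theta,\eta}_n$ with respect to $\mathbb P^\theta_n$. Feller coupling. For a binary sequence $\xi=(\xi_1,\xi_2,\ldots)\in\{0,1\}^{\mathbb N}$ with $\xi_1=1$ and $n\in\mathbb N$, define the partition $(\alpha_1(n),\ldots,\alpha_n(n))\in\mathcal P_n$ by $$\alpha_i(n)=\sum_{j=1}^{n-i}\xi_j(1-\xi_{j+1})\cdots(1-\xi_{j+i-1})\xi_{i+j}+\xi_{n-i+1}(1-\xi_{n-i+2})\cdots(1-\xi_n),$$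 i.e. the number of maximal runs of exactly $i-1$ zeros between consecutive $1$s in the string $(\xi_1,\ldots,\xi_n,1)$. Let $\mathbb P^\theta_F$ be the probability measure on $\{0,1\}^{\mathbb N}$ under which the $\xi_i$ are independent Bernoulli with success probability $\theta/(\theta+i-1)$ (so $\xi_1=1$ almost surely); the law of $(\alpha_1(n),\dots,\alpha_n(n))$ under $\mathbb P_F^\theta$ is $\mathbb P^\theta_n$. Expectation under $\mathbb P^\theta_F$ is $\mathbb E^\theta_F$. Asymptotically Ewens. Given a nonnegative function $\eta$ on the set of all partitions of all integers $k\ge0$, for $m\le n$ define the random variables (under $\mathbb P^\theta_F$) $\eta_{n,m}=\eta(\alpha_1(n),\ldots,\alpha_m(n))$. A sequence of measures $\mathbb P_n$ on $\mathcal P_n$, $n\in\mathbb N$, is asymptotically Ewens with parameter $\theta$ if it can be written as $\mathbb P_n=\mathbb P_n^{\theta,\eta}$ for some nonnegative function $\eta$ on the set of all partitions of all integers $k\ge0$, with $Z_n^{\theta,\eta}>0$ for every $n\in\mathbb N$, such that (1) the limits $\lim_{n\to\infty}\eta_{n,n}$ and $\lim_{m\to\infty}\lim_{n\to\infty}\eta_{n,m}$ exist and agree in $L^1(\mathbb P^\theta_F)$; and (2) the common limit $\eta_\infty$ satisfies $0<\mathbb E^\theta_F[\eta_\infty]<\infty$. *)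

theory Defs
  imports "HOL-Probability.Probability"
begin

text \<open>A partition of \<open>k\<close> is a function \<open>\<alpha>\<close> sending each \<open>i\<close> to the number of parts of size \<open>i\<close>.
  Requiring \<open>\<alpha> i = 0\<close> outside \<open>{1..k}\<close> is the convention that zeros are discarded or appended;
  in particular the partition determines \<open>k\<close>, and the empty partition is the zero function.\<close>

definition partitions :: "nat \<Rightarrow> (nat \<Rightarrow> nat) set" where
  "partitions k = {\<alpha>. (\<forall>i. i \<notin> {1..k} \<longrightarrow> \<alpha> i = 0) \<and> (\<Sum>i=1..k. i * \<alpha> i) = k}"

lemma finite_partitions: "finite (partitions k)"
proof (rule finite_subset)
  show "partitions k \<subseteq> {\<alpha>. \<forall>i. (i \<in> {1..k} \<longrightarrow> \<alpha> i \<in> {0..k}) \<and> (i \<notin> {1..k} \<longrightarrow> \<alpha> i = 0)}"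
  proof clarify
    fix \<alpha> i
    assume \<alpha>: "\<alpha> \<in> partitions k"
    have "\<alpha> i \<le> k" if i: "i \<in> {1..k}"
    proof -
      have "\<alpha> i \<le> i * \<alpha> i" using i by simp
      also have "\<dots> \<le> (\<Sum>i=1..k. i * \<alpha> i)" using i by (intro member_le_sum) auto
      finally show ?thesis using \<alpha> by (simp add: partitions_def)
    qed
    then show "(i \<in> {1..k} \<longrightarrow> \<alpha> i \<in> {0..k}) \<and> (i \<notin> {1..k} \<longrightarrow> \<alpha> i = 0)"
      using \<alpha> by (auto simp: partitions_def)
  qed
qed (rule finite_set_of_finite_funs, auto)

definition ewens_weight :: "real \<Rightarrow> nat \<Rightarrow> (nat \<Rightarrow> nat) \<Rightarrow> real" where
  "ewens_weight \<theta> n \<alpha> = (\<Prod>i=1..n. \<theta> ^ \<alpha> i / (real i ^ \<alpha> i * fact (\<alpha> i)))"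

definition ewens_Z :: "real \<Rightarrow> ((nat \<Rightarrow> nat) \<Rightarrow> real) \<Rightarrow> nat \<Rightarrow> real" where
  "ewens_Z \<theta> \<eta> n = (\<Sum>\<alpha>\<in>partitions n. \<eta> \<alpha> * ewens_weight \<theta> n \<alpha>)"

definition perturbed_ewens :: "real \<Rightarrow> ((nat \<Rightarrow> nat) \<Rightarrow> real) \<Rightarrow> nat \<Rightarrow> (nat \<Rightarrow> nat) measure" where
  "perturbed_ewens \<theta> \<eta> n =
     point_measure (partitions n) (\<lambda>\<alpha>. ennreal (\<eta> \<alpha> / ewens_Z \<theta> \<eta> n * ewens_weight \<theta> n \<alpha>))"

lemma prob_space_perturbed_ewens:
  assumes "\<theta> > 0" "\<And>\<alpha>. \<alpha> \<in> partitions n \<Longrightarrow> 0 \<le> \<eta> \<alpha>" "ewens_Z \<theta> \<eta> n > 0"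
  shows "prob_space (perturbed_ewens \<theta> \<eta> n)"
proof (rule prob_spaceI)
  let ?p = "\<lambda>\<alpha>. \<eta> \<alpha> / ewens_Z \<theta> \<eta> n * ewens_weight \<theta> n \<alpha>"
  have w: "ewens_weight \<theta> n \<alpha> \<ge> 0" for \<alpha>
    using assms(1) unfolding ewens_weight_def by (intro prod_nonneg) auto
  have "emeasure (perturbed_ewens \<theta> \<eta> n) (partitions n) = (\<Sum>\<alpha>\<in>partitions n. ennreal (?p \<alpha>))"
    unfolding perturbed_ewens_def by (rule emeasure_point_measure_finite[OF finite_partitions]) auto
  also have "\<dots> = ennreal (\<Sum>\<alpha>\<in>partitions n. ?p \<alpha>)"
    using assms w by (intro sum_ennreal) (auto intro!: mult_nonneg_nonneg divide_nonneg_pos)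
  also have "(\<Sum>\<alpha>\<in>partitions n. ?p \<alpha>) = (\<Sum>\<alpha>\<in>partitions n. \<eta> \<alpha> * ewens_weight \<theta> n \<alpha>) / ewens_Z \<theta> \<eta> n"
    by (simp add: sum_divide_distrib)
  also have "\<dots> = 1" using assms(3) by (simp add: ewens_Z_def)
  finally show "emeasure (perturbed_ewens \<theta> \<eta> n) (space (perturbed_ewens \<theta> \<eta> n)) = 1"
    by (simp add: perturbed_ewens_def space_point_measure)
qed

definition feller_measure :: "real \<Rightarrow> (nat \<Rightarrow> bool) measure" where
  "feller_measure \<theta> = (\<Pi>\<^sub>M i\<in>{1..}. measure_pmf (bernoulli_pmf (\<theta> / (\<theta> + real i - 1))))"

definition feller_count :: "(nat \<Rightarrow> bool) \<Rightarrow> nat \<Rightarrow> nat \<Rightarrow> nat" where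
  "feller_count \<xi> n i =
     (\<Sum>j=1..n - i. of_bool (\<xi> j) * (\<Prod>k=j + 1..<i + j. 1 - of_bool (\<xi> k)) * of_bool (\<xi> (i + j)))
     + of_bool (\<xi> (n - i + 1)) * (\<Prod>k=n - i + 2..n. 1 - of_bool (\<xi> k))"

text \<open>The truncated vector \<open>(\<alpha>\<^sub>1(n), \<dots>, \<alpha>\<^sub>m(n))\<close>, read as a partition; meaningful for \<open>m \<le> n\<close>.\<close>

definition feller_partition :: "nat \<Rightarrow> nat \<Rightarrow> (nat \<Rightarrow> bool) \<Rightarrow> nat \<Rightarrow> nat" where
  "feller_partition n m \<xi> = (\<lambda>i. if i \<in> {1..m} then feller_count \<xi> n i else 0)"

definition tendsto_L1 :: "'a measure \<Rightarrow> (nat \<Rightarrow> 'a \<Rightarrow> real) \<Rightarrow> ('a \<Rightarrow> real) \<Rightarrow> bool" where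
  "tendsto_L1 M X Y \<longleftrightarrow>
     (\<forall>\<^sub>F n in sequentially. integrable M (X n)) \<and> integrable M Y \<and>
     (\<lambda>n. \<integral>\<omega>. \<bar>X n \<omega> - Y \<omega>\<bar> \<partial>M) \<longlonglongrightarrow> 0"

text \<open>Measures are indexed by \<open>n \<ge> 1\<close>; \<open>P 0\<close> is unconstrained. All limits are taken in
  \<open>L\<^sup>1\<close>: \<open>g m\<close> is the inner limit of \<open>\<eta>\<^bsub>n,m\<^esub>\<close> as \<open>n \<rightarrow> \<infinity>\<close>. Finiteness of the expectation of the
  common limit is part of \<open>tendsto_L1\<close>.\<close>

definition asymptotically_ewens :: "real \<Rightarrow> (nat \<Rightarrow> (nat \<Rightarrow> nat) measure) \<Rightarrow> bool" where
  "asymptotically_ewens \<theta> P \<longleftrightarrow>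
     (\<exists>\<eta> :: (nat \<Rightarrow> nat) \<Rightarrow> real.
        (\<forall>k. \<forall>\<alpha>\<in>partitions k. 0 \<le> \<eta> \<alpha>) \<and>
        (\<forall>n\<ge>1. 0 < ewens_Z \<theta> \<eta> n \<and> P n = perturbed_ewens \<theta> \<eta> n) \<and>
        (\<exists>\<eta>_inf g.
           tendsto_L1 (feller_measure \<theta>) (\<lambda>n \<xi>. \<eta> (feller_partition n n \<xi>)) \<eta>_inf \<and>
           (\<forall>m\<ge>1. tendsto_L1 (feller_measure \<theta>) (\<lambda>n \<xi>. \<eta> (feller_partition n m \<xi>)) (g m)) \<and>
           tendsto_L1 (feller_measure \<theta>) g \<eta>_inf \<and>
           0 < (\<integral>\<xi>. \<eta>_inf \<xi> \<partial>feller_measure \<theta>)))"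

definition skorohod_space :: "(real \<Rightarrow> real) set" where
  "skorohod_space = {x \<in> extensional {0..1}.
     (\<forall>t\<in>{0..<1}. (x \<longlongrightarrow> x t) (at_right t)) \<and>
     (\<forall>t\<in>{0<..1}. \<exists>l. (x \<longlongrightarrow> l) (at_left t))}"

text \<open>Increasing homeomorphisms of \<open>[0,1]\<close>; continuity is automatic for a monotone surjection.\<close>

definition time_change :: "(real \<Rightarrow> real) \<Rightarrow> bool" where
  "time_change l \<longleftrightarrow> strict_mono_on {0..1} l \<and> l ` {0..1} = {0..1}"

definition skorohod_close :: "real \<Rightarrow> (real \<Rightarrow> real) \<Rightarrow> (real \<Rightarrow> real) \<Rightarrow> bool" where
  "skorohod_close e x y \<longleftrightarrow>
     (\<exists>l. time_change l \<and> (\<forall>t\<in>{0..1}. \<bar>l t - t\<bar> \<le> e \<and> \<bar>x t - y (l t)\<bar> \<le> e))"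

text \<open>Skorohod's \<open>J\<^sub>1\<close> metric. The value 0 off the carrier is only there because
  \<open>Metric_space\<close> asks for nonnegativity and symmetry on the whole type.\<close>

definition skorohod_dist :: "(real \<Rightarrow> real) \<Rightarrow> (real \<Rightarrow> real) \<Rightarrow> real" where
  "skorohod_dist x y =
     (if x \<in> skorohod_space \<and> y \<in> skorohod_space then Inf {e. 0 < e \<and> skorohod_close e x y} else 0)"

definition skorohod_topology :: "(real \<Rightarrow> real) topology" where
  "skorohod_topology = Metric_space.mtopology skorohod_space skorohod_dist"

lemma skorohod_close_commute:
  assumes "skorohod_close e x y"
  shows "skorohod_close e y x"
proof -
  obtain l where l: "time_change l"
    "\<And>t. t \<in> {0..1} \<Longrightarrow> \<bar>l t - t\<bar> \<le> e" "\<And>t. t \<in> {0..1} \<Longrightarrow> \<bar>x t - y (l t)\<bar> \<le> e"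
    using assms unfolding skorohod_close_def by blast
  have mono: "strict_mono_on {0..1} l" and im: "l ` {0..1} = {0..1}"
    using l(1) by (auto simp: time_change_def)
  have inj: "inj_on l {0..1}" by (rule strict_mono_on_imp_inj_on[OF mono])
  define k where "k = inv_into {0..1} l"
  have k: "k s \<in> {0..1}" "l (k s) = s" if "s \<in> {0..1}" for s
    using that im unfolding k_def by (metis inv_into_into) (metis f_inv_into_f im that)
  have kl: "k (l t) = t" if "t \<in> {0..1}" for t
    using inj that by (simp add: k_def)
  have "strict_mono_on {0..1} k"
  proof (rule strict_mono_onI)
    fix r s :: real
    assume rs: "r \<in> {0..1}" "s \<in> {0..1}" "r < s"
    show "k r < k s"
    proof (rule ccontr)
      assume "\<not> k r < k s"
      then have "l (k s) \<le> l (k r)"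
        using mono k(1)[OF rs(1)] k(1)[OF rs(2)]
        by (metis leI less_eq_real_def strict_mono_onD)
      then show False using k(2) rs by simp
    qed
  qed
  moreover have "k ` {0..1} = {0..1}"
  proof
    show "k ` {0..1} \<subseteq> {0..1}" using k(1) by blast
    show "{0..1} \<subseteq> k ` {0..1}" using kl im by (metis image_eqI subsetI)
  qed
  moreover have "\<bar>k t - t\<bar> \<le> e \<and> \<bar>y t - x (k t)\<bar> \<le> e" if "t \<in> {0..1}" for t
    using l(2,3)[OF k(1)[OF that]] k(2)[OF that] by (simp add: abs_minus_commute)
  ultimately show ?thesis unfolding skorohod_close_def time_change_def by blast
qed

lemma skorohod_close_trans:
  assumes "skorohod_close a x y" "skorohod_close b y z"
  shows "skorohod_close (a + b) x z"
proof -
  obtain l where l: "time_change l"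
    "\<And>t. t \<in> {0..1} \<Longrightarrow> \<bar>l t - t\<bar> \<le> a" "\<And>t. t \<in> {0..1} \<Longrightarrow> \<bar>x t - y (l t)\<bar> \<le> a"
    using assms(1) unfolding skorohod_close_def by blast
  obtain k where k: "time_change k"
    "\<And>t. t \<in> {0..1} \<Longrightarrow> \<bar>k t - t\<bar> \<le> b" "\<And>t. t \<in> {0..1} \<Longrightarrow> \<bar>y t - z (k t)\<bar> \<le> b"
    using assms(2) unfolding skorohod_close_def by blast
  have lI: "l t \<in> {0..1}" if "t \<in> {0..1}" for t using l(1) that by (auto simp: time_change_def)
  have "strict_mono_on {0..1} (k \<circ> l)"
    using l(1) k(1) lI unfolding time_change_def by (auto simp: strict_mono_on_def)
  moreover have "(k \<circ> l) ` {0..1} = {0..1}"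
    using l(1) k(1) unfolding time_change_def by (simp only: image_comp[symmetric])
  moreover have "\<bar>(k \<circ> l) t - t\<bar> \<le> a + b \<and> \<bar>x t - z ((k \<circ> l) t)\<bar> \<le> a + b"
    if "t \<in> {0..1}" for t
    using l(2,3)[OF that] k(2,3)[OF lI[OF that]] by auto
  ultimately show ?thesis unfolding skorohod_close_def time_change_def by blast
qed

lemma skorohod_space_bounded:
  assumes x: "x \<in> skorohod_space"
  obtains B where "B > 0" "\<And>t. t \<in> {0..1} \<Longrightarrow> \<bar>x t\<bar> \<le> B"
proof -
  define Q where "Q a b \<longleftrightarrow> (\<exists>B. \<forall>s. a \<le> s \<and> s \<le> b \<and> 0 \<le> s \<and> s \<le> 1 \<longrightarrow> \<bar>x s\<bar> \<le> B)" for a b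
  have "Q 0 1"
  proof (rule Bolzano)
    show "(0::real) \<le> 1" by simp
  next
    fix a b c
    assume "Q a b" "Q b c"
    then obtain B B' where B: "\<And>s. a \<le> s \<Longrightarrow> s \<le> b \<Longrightarrow> 0 \<le> s \<Longrightarrow> s \<le> 1 \<Longrightarrow> \<bar>x s\<bar> \<le> B"
      "\<And>s. b \<le> s \<Longrightarrow> s \<le> c \<Longrightarrow> 0 \<le> s \<Longrightarrow> s \<le> 1 \<Longrightarrow> \<bar>x s\<bar> \<le> B'"
      unfolding Q_def by blast
    have "\<bar>x s\<bar> \<le> max B B'" if "a \<le> s" "s \<le> c" "0 \<le> s" "s \<le> 1" for s
      using B[of s] that by (cases "s \<le> b") auto
    then show "Q a c" unfolding Q_def by blast
  next
    fix t :: real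
    assume local: "0 \<le> t" "t \<le> 1"
    have right: "\<exists>d>0. \<exists>B. \<forall>s. t < s \<and> s < t + d \<and> s \<le> 1 \<longrightarrow> \<bar>x s\<bar> \<le> B"
    proof (cases "t < 1")
      case True
      then have "(x \<longlongrightarrow> x t) (at_right t)" using x local by (auto simp: skorohod_space_def)
      then have "\<forall>\<^sub>F s in at_right t. dist (x s) (x t) < 1" by (rule tendstoD) simp
      then obtain b where b: "b > t" "\<And>s. t < s \<Longrightarrow> s < b \<Longrightarrow> dist (x s) (x t) < 1"
        by (auto simp: eventually_at_right_field)
      have "\<bar>x s\<bar> \<le> \<bar>x t\<bar> + 1" if "t < s" "s < b" for s
        using b(2)[OF that] by (auto simp: dist_real_def)
      then show ?thesis using b(1) by (intro exI[of _ "b - t"]) auto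
    next
      case False
      then show ?thesis by (intro exI[of _ 1]) auto
    qed
    have left: "\<exists>d>0. \<exists>B. \<forall>s. t - d < s \<and> s < t \<and> 0 \<le> s \<longrightarrow> \<bar>x s\<bar> \<le> B"
    proof (cases "t > 0")
      case True
      then have "t \<in> {0<..1}" using local by simp
      then obtain l where "(x \<longlongrightarrow> l) (at_left t)" using x unfolding skorohod_space_def by blast
      then have "\<forall>\<^sub>F s in at_left t. dist (x s) l < 1" by (rule tendstoD) simp
      then obtain b where b: "b < t" "\<And>s. b < s \<Longrightarrow> s < t \<Longrightarrow> dist (x s) l < 1"
        by (auto simp: eventually_at_left_field)
      have "\<bar>x s\<bar> \<le> \<bar>l\<bar> + 1" if "b < s" "s < t" for s
        using b(2)[OF that] by (auto simp: dist_real_def)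
      then show ?thesis using b(1) by (intro exI[of _ "t - b"]) auto
    next
      case False
      then show ?thesis by (intro exI[of _ 1]) auto
    qed
    obtain d B where d: "d > 0" "\<And>s. t < s \<Longrightarrow> s < t + d \<Longrightarrow> s \<le> 1 \<Longrightarrow> \<bar>x s\<bar> \<le> B"
      using right by blast
    obtain d' B' where d': "d' > 0" "\<And>s. t - d' < s \<Longrightarrow> s < t \<Longrightarrow> 0 \<le> s \<Longrightarrow> \<bar>x s\<bar> \<le> B'"
      using left by blast
    have "Q a b" if ab: "a \<le> t" "t \<le> b" "b - a < min d d'" for a b
      unfolding Q_def
    proof (intro exI allI impI)
      fix s
      assume s: "a \<le> s \<and> s \<le> b \<and> 0 \<le> s \<and> s \<le> 1"
      consider "s < t" | "s = t" | "s > t" by linarith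
      then show "\<bar>x s\<bar> \<le> max \<bar>x t\<bar> (max B B')"
      proof cases
        case 1
        then have "\<bar>x s\<bar> \<le> B'" using s ab by (intro d'(2)) auto
        then show ?thesis by simp
      next
        case 3
        then have "\<bar>x s\<bar> \<le> B" using s ab by (intro d(2)) auto
        then show ?thesis by simp
      qed simp
    qed
    then show "\<exists>d>0. \<forall>a b. a \<le> t \<and> t \<le> b \<and> b - a < d \<longrightarrow> Q a b"
      using d(1) d'(1) by (intro exI[of _ "min d d'"]) auto
  qed
  then obtain B where "\<And>t. 0 \<le> t \<Longrightarrow> t \<le> 1 \<Longrightarrow> \<bar>x t\<bar> \<le> B" unfolding Q_def by auto
  then have "\<bar>x t\<bar> \<le> max B 1" if "t \<in> {0..1}" for t using that by (simp add: max.coboundedI1)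
  then show ?thesis using that[of "max B 1"] by simp
qed

lemma skorohod_close_exists:
  assumes x: "x \<in> skorohod_space" and y: "y \<in> skorohod_space"
  shows "\<exists>e>0. skorohod_close e x y"
proof -
  obtain A where A: "A > 0" "\<And>t. t \<in> {0..1} \<Longrightarrow> \<bar>x t\<bar> \<le> A"
    using skorohod_space_bounded[OF x] by blast
  obtain B where B: "B > 0" "\<And>t. t \<in> {0..1} \<Longrightarrow> \<bar>y t\<bar> \<le> B"
    using skorohod_space_bounded[OF y] by blast
  have "\<bar>x t - y (id t)\<bar> \<le> A + B" if "t \<in> {0..1}" for t
    using A(2)[OF that] B(2)[OF that] by auto
  moreover have "time_change id" by (simp add: time_change_def strict_mono_on_def)
  ultimately have "skorohod_close (A + B) x y"
    unfolding skorohod_close_def using A(1) B(1) by (intro exI[of _ id]) auto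
  then show ?thesis using A(1) B(1) by (intro exI[of _ "A + B"]) auto
qed

lemma skorohod_dist_less:
  assumes "x \<in> skorohod_space" "y \<in> skorohod_space" "skorohod_dist x y < e"
  obtains e' where "0 < e'" "e' < e" "skorohod_close e' x y"
proof -
  have "{e. 0 < e \<and> skorohod_close e x y} \<noteq> {}" using skorohod_close_exists assms by blast
  then have "\<exists>e'\<in>{e. 0 < e \<and> skorohod_close e x y}. e' < e"
    using assms by (intro cInf_lessD) (auto simp: skorohod_dist_def)
  then show ?thesis using that by blast
qed

lemma skorohod_dist_le:
  assumes "x \<in> skorohod_space" "y \<in> skorohod_space" "0 < e" "skorohod_close e x y"
  shows "skorohod_dist x y \<le> e"
proof -
  have "bdd_below {e. 0 < e \<and> skorohod_close e x y}" by (rule bdd_belowI[of _ 0]) auto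
  then show ?thesis using assms by (auto simp: skorohod_dist_def intro!: cInf_lower)
qed

lemma skorohod_close_all_eq:
  assumes x: "x \<in> skorohod_space" and y: "y \<in> skorohod_space"
    and close: "\<And>e. e > 0 \<Longrightarrow> \<exists>e'<e. skorohod_close e' x y"
  shows "x = y"
proof (rule extensionalityI)
  show "x \<in> extensional {0..1}" "y \<in> extensional {0..1}"
    using x y by (auto simp: skorohod_space_def)
  fix t :: real
  assume t: "t \<in> {0..1}"
  have "\<bar>x t - y t\<bar> \<le> 3 * e" if e: "e > 0" for e
  proof (cases "t < 1")
    case False
    then have t1: "t = 1" using t by simp
    obtain e' l where l: "e' < e" "time_change l" "\<bar>x 1 - y (l 1)\<bar> \<le> e'"
      using close[OF e] unfolding skorohod_close_def by force
    have "l 1 = 1"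
    proof -
      obtain s where s: "s \<in> {0..1}" "l s = 1"
        using l(2) unfolding time_change_def by (metis atLeastAtMost_iff imageE order_refl zero_le_one)
      have "l 1 \<le> 1" using l(2) unfolding time_change_def by fastforce
      moreover have "l s \<le> l 1"
        using l(2) s(1) unfolding time_change_def
        by (metis atLeastAtMost_iff order_refl less_eq_real_def strict_mono_onD zero_le_one)
      ultimately show ?thesis using s by simp
    qed
    then show ?thesis using l t1 e by auto
  next
    case True
    then have "(x \<longlongrightarrow> x t) (at_right t)" "(y \<longlongrightarrow> y t) (at_right t)"
      using x y t by (auto simp: skorohod_space_def)
    then have "\<forall>\<^sub>F s in at_right t. dist (x s) (x t) < e \<and> dist (y s) (y t) < e"
      using e by (intro eventually_conj tendstoD)
    then obtain b where b: "b > t"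
      "\<And>s. t < s \<Longrightarrow> s < b \<Longrightarrow> \<bar>x s - x t\<bar> < e \<and> \<bar>y s - y t\<bar> < e"
      by (auto simp: eventually_at_right_field dist_real_def)
    define d where "d = (min b 1 - t) / 2"
    have d: "d > 0" "t + 2 * d \<le> b" "t + 2 * d \<le> 1" using b(1) True by (auto simp: d_def field_simps min_def)
    obtain e' where e': "e' < min d e" "skorohod_close e' x y"
      using close[of "min d e"] d(1) e by auto
    have "t + d \<in> {0..1}" using d t by auto
    then obtain l where l: "\<bar>l (t + d) - (t + d)\<bar> \<le> e'" "\<bar>x (t + d) - y (l (t + d))\<bar> \<le> e'"
      using e'(2) unfolding skorohod_close_def by blast
    have "t < l (t + d)" "l (t + d) < b" using l(1) e'(1) d by auto
    then have "\<bar>y (l (t + d)) - y t\<bar> < e" using b(2) by blast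
    moreover have "\<bar>x (t + d) - x t\<bar> < e" using b(2)[of "t + d"] d by auto
    ultimately show ?thesis using l(2) e'(1) by auto
  qed
  from this[of "\<bar>x t - y t\<bar> / 4"] show "x t = y t" by (cases "x t = y t") auto
qed

interpretation skorohod: Metric_space skorohod_space skorohod_dist
  rewrites "Metric_space.mtopology skorohod_space skorohod_dist = skorohod_topology"
proof -
  show "Metric_space skorohod_space skorohod_dist"
  proof
    fix x y :: "real \<Rightarrow> real"
    show "0 \<le> skorohod_dist x y"
    proof (cases "x \<in> skorohod_space \<and> y \<in> skorohod_space")
      case True
      then have "{e. 0 < e \<and> skorohod_close e x y} \<noteq> {}" using skorohod_close_exists by blast
      then show ?thesis using True by (auto simp: skorohod_dist_def intro!: cInf_greatest)
    qed (auto simp: skorohod_dist_def)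
    show "skorohod_dist x y = skorohod_dist y x"
    proof -
      have "skorohod_close e x y = skorohod_close e y x" for e
        using skorohod_close_commute by blast
      then show ?thesis by (auto simp: skorohod_dist_def)
    qed
  next
    fix x y
    assume xy: "x \<in> skorohod_space" "y \<in> skorohod_space"
    show "skorohod_dist x y = 0 \<longleftrightarrow> x = y"
    proof
      assume 0: "skorohod_dist x y = 0"
      show "x = y"
      proof (rule skorohod_close_all_eq[OF xy])
        fix e :: real assume "e > 0"
        then show "\<exists>e'<e. skorohod_close e' x y"
          using skorohod_dist_less[OF xy, of e] 0 by metis
      qed
    next
      assume "x = y"
      then have "skorohod_close e x y" if "e > 0" for e
        unfolding skorohod_close_def time_change_def using that
        by (intro exI[of _ id]) (auto simp: strict_mono_on_def)
      then have "{e. 0 < e \<and> skorohod_close e x y} = {0<..}" by auto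
      then show "skorohod_dist x y = 0" using xy by (simp add: skorohod_dist_def)
    qed
  next
    fix x y z
    assume xyz: "x \<in> skorohod_space" "y \<in> skorohod_space" "z \<in> skorohod_space"
    show "skorohod_dist x z \<le> skorohod_dist x y + skorohod_dist y z"
    proof (rule field_le_epsilon)
      fix e :: real assume e: "e > 0"
      obtain a where a: "0 < a" "a < skorohod_dist x y + e / 2" "skorohod_close a x y"
        using skorohod_dist_less[OF xyz(1,2), of "skorohod_dist x y + e / 2"] e by auto
      obtain b where b: "0 < b" "b < skorohod_dist y z + e / 2" "skorohod_close b y z"
        using skorohod_dist_less[OF xyz(2,3), of "skorohod_dist y z + e / 2"] e by auto
      have "skorohod_dist x z \<le> a + b"
        using skorohod_close_trans[OF a(3) b(3)] a b xyz by (intro skorohod_dist_le) auto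
      then show "skorohod_dist x z \<le> skorohod_dist x y + skorohod_dist y z + e"
        using a(2) b(2) by linarith
    qed
  qed
qed (simp add: skorohod_topology_def)

definition borel_of :: "'s topology \<Rightarrow> 's measure" where
  "borel_of T = sigma (topspace T) {U. openin T U}"

text \<open>The random elements \<open>X n\<close> may live on different probability spaces \<open>M n\<close>; membership in
  the space of measurable maps entails that they take values in \<open>topspace T\<close>.\<close>

definition converges_in_distribution ::
  "'s topology \<Rightarrow> (nat \<Rightarrow> 'a measure) \<Rightarrow> (nat \<Rightarrow> 'a \<Rightarrow> 's) \<Rightarrow> 'b measure \<Rightarrow> ('b \<Rightarrow> 's) \<Rightarrow> bool" where
  "converges_in_distribution T M X N Y \<longleftrightarrow>
     (\<forall>\<^sub>F n in sequentially. prob_space (M n) \<and> X n \<in> M n \<rightarrow>\<^sub>M borel_of T) \<and>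
     prob_space N \<and> Y \<in> N \<rightarrow>\<^sub>M borel_of T \<and>
     (\<forall>F :: 's \<Rightarrow> real. continuous_map T euclideanreal F \<and> bounded (F ` topspace T) \<longrightarrow>
        (\<lambda>n. \<integral>\<omega>. F (X n \<omega>) \<partial>M n) \<longlonglongrightarrow> (\<integral>\<omega>. F (Y \<omega>) \<partial>N))"

text \<open>All paths, not just almost all, are continuous, so that a Brownian motion is a random
  element of a space of functions.\<close>

definition standard_brownian_motion :: "'a measure \<Rightarrow> (real \<Rightarrow> 'a \<Rightarrow> real) \<Rightarrow> bool" where
  "standard_brownian_motion M W \<longleftrightarrow>
     prob_space M \<and>
     (\<forall>t\<ge>0. W t \<in> borel_measurable M) \<and>
     (\<forall>\<omega>\<in>space M. W 0 \<omega> = 0) \<and>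
     (\<forall>\<omega>\<in>space M. continuous_on {0..} (\<lambda>t. W t \<omega>)) \<and>
     (\<forall>s t. 0 \<le> s \<and> s < t \<longrightarrow>
        distributed M lborel (\<lambda>\<omega>. W t \<omega> - W s \<omega>) (\<lambda>u. ennreal (normal_density 0 (sqrt (t - s)) u))) \<and>
     (\<forall>k (\<tau> :: nat \<Rightarrow> real). 0 \<le> \<tau> 0 \<and> (\<forall>i<k. \<tau> i \<le> \<tau> (Suc i)) \<longrightarrow>
        prob_space.indep_vars M (\<lambda>_. borel) (\<lambda>i \<omega>. W (\<tau> (Suc i)) \<omega> - W (\<tau> i) \<omega>) {..<k})"

definition lcm_parts :: "nat \<Rightarrow> (nat \<Rightarrow> nat) \<Rightarrow> real \<Rightarrow> nat" where
  "lcm_parts n \<alpha> t = Lcm {i. 1 \<le> i \<and> real i \<le> real n powr t \<and> \<alpha> i > 0}"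

definition prod_parts :: "nat \<Rightarrow> (nat \<Rightarrow> nat) \<Rightarrow> real \<Rightarrow> nat" where
  "prod_parts n \<alpha> t = (\<Prod>i | 1 \<le> i \<and> real i \<le> real n powr t. i ^ \<alpha> i)"

definition normalized_log_process ::
  "real \<Rightarrow> (nat \<Rightarrow> (nat \<Rightarrow> nat) \<Rightarrow> real \<Rightarrow> nat) \<Rightarrow> nat \<Rightarrow> (nat \<Rightarrow> nat) \<Rightarrow> real \<Rightarrow> real" where
  "normalized_log_process \<theta> parts n \<alpha> =
     (\<lambda>t\<in>{0..1}. (ln (real (parts n \<alpha> t)) - \<theta> * t\<^sup>2 * (ln (real n))\<^sup>2 / 2) / sqrt (\<theta> * (ln (real n)) ^ 3 / 3))"

end

theory Submission
  imports Defs "HOL-Real_Asymp.Real_Asymp" "HOL-Computational_Algebra.Primes"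
begin

text \<open>In the Feller coupling the parts of the partition are the gaps between consecutive ones of
  independent Bernoulli variables \<open>\<xi>\<^sub>j\<close>. With high probability every gap ending at \<open>j\<close> has length
  at least \<open>j / (log n)\<^sup>2\<close>, so the logarithm of the product of the parts up to \<open>n\<^sup>t\<close> differs from
  \<open>\<Sum> \<xi>\<^sub>j log j\<close> (over \<open>j \<le> n\<^sup>t\<close>) by \<open>o((log n)\<^bsup>3/2\<^esup>)\<close>, uniformly in \<open>t\<close>. The latter is a sum of
  independent variables, to which a central limit theorem on a grid and a maximal inequality apply.
  Passing to the least common multiple costs at most \<open>\<Sum> log p (D - 1)\<^sup>+\<close> over the prime powers
  \<open>p\<^sup>s\<close>, where \<open>D\<close> is the number of parts divisible by \<open>p\<^sup>s\<close>; this has order \<open>(log n)\<^bsup>5/4\<^esup>\<close> at most.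
  A density \<open>\<eta>\<^bsub>n,n\<^esub>\<close> converging in \<open>L\<^sup>1\<close> is close to \<open>\<eta>\<^bsub>K,K\<^esub>\<close>, which involves only
  \<open>\<xi>\<^sub>1, \<dots>, \<xi>\<^sub>K\<close>, and these do not influence the limit; hence reweighting by \<open>\<eta>\<close> does not change it.\<close>

section \<open>Weak convergence tested on Lipschitz functions\<close>

text \<open>Everything at level \<open>n\<close> is computed under
  \<open>feller_pmf \<theta> n\<close>, a law of finite support, so expectations are finite sums;
  the infinite product measure enters only where convergence in mean of the density is used. The
  constant that relates Ewens weights to the coupling cancels in the quotient defining the perturbed
  law. Three obstacles shape the rest. Reweighting destroys independence, so the limit is proved
  jointly with a bounded weight \<open>Z\<close> that reads finitely many coordinates, and these
  coordinates are removed from the sums. Oscillation has to be controlled on \<open>k\<close> blocks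
  at once: the normalised block variances add up to a constant, so second moments would not suffice,
  while their squares add up to order \<open>1 / k\<close>; hence the fourth moments. Finally, the
  part closed by the artificial one after position \<open>n\<close> is no gap between two ones of
  the sequence; it is carried along separately and costs at most \<open>ln n\<close>, well below the
  normalisation.\<close>

lemma sets_borel_of: "sets (borel_of T) = sigma_sets (topspace T) {U. openin T U}"
  unfolding borel_of_def by (rule sets_measure_of) (auto dest: openin_subset)

lemma continuous_map_borel_of:
  fixes F :: "'a \<Rightarrow> real"
  assumes "continuous_map T euclideanreal F"
  shows "F \<in> borel_of T \<rightarrow>\<^sub>M borel"
proof (rule borel_measurableI)
  fix S :: "real set"
  assume "open S"
  then have "openin T {x \<in> topspace T. F x \<in> S}"
    using assms by (auto simp: continuous_map_def)
  moreover have "F -` S \<inter> space (borel_of T) = {x \<in> topspace T. F x \<in> S}"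
    by (auto simp: borel_of_def space_measure_of_conv)
  ultimately show "F -` S \<inter> space (borel_of T) \<in> sets (borel_of T)"
    by (auto simp: sets_borel_of)
qed

section \<open>Lipschitz envelopes in a metric space\<close>

context Metric_space
begin

lemma continuous_map_Lipschitz:
  assumes L: "\<And>x y. x \<in> M \<Longrightarrow> y \<in> M \<Longrightarrow> \<bar>F x - F y\<bar> \<le> L * d x y"
  shows "continuous_map mtopology euclideanreal (F :: 'a \<Rightarrow> real)"
proof -
  have "Lipschitz_continuous_map (metric (M, d)) euclidean_metric F"
    unfolding Lipschitz_continuous_map_def using L
    by (auto simp: dist_real_def intro!: exI[of _ L])
  from Lipschitz_continuous_imp_continuous_map[OF this] show ?thesis
    by (simp add: mtopology_of_def)
qed

text \<open>For bounded \<open>F\<close> and \<open>L \<ge> 0\<close> this is the largest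
  \<open>L\<close>-Lipschitz minorant of \<open>F\<close> (Pasch-Hausdorff envelope).\<close>

definition inf_conv :: "('a \<Rightarrow> real) \<Rightarrow> real \<Rightarrow> 'a \<Rightarrow> real" where
  "inf_conv F L x = (INF y\<in>M. F y + L * d x y)"

context
  fixes F :: "'a \<Rightarrow> real" and B :: real
  assumes B: "\<And>x. x \<in> M \<Longrightarrow> \<bar>F x\<bar> \<le> B"
begin

lemma inf_conv_lower: "L \<ge> 0 \<Longrightarrow> x \<in> M \<Longrightarrow> - B \<le> inf_conv F L x"
  unfolding inf_conv_def
  by (rule cINF_greatest) (use B in \<open>fastforce intro: add_increasing2\<close>)+

lemma inf_conv_bdd: "L \<ge> 0 \<Longrightarrow> x \<in> M \<Longrightarrow> bdd_below ((\<lambda>y. F y + L * d x y) ` M)"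
  by (rule bdd_belowI2[of _ "-B"]) (use B in \<open>fastforce intro: add_increasing2\<close>)

lemma inf_conv_le: "L \<ge> 0 \<Longrightarrow> x \<in> M \<Longrightarrow> inf_conv F L x \<le> F x"
  unfolding inf_conv_def using cINF_lower[OF inf_conv_bdd, of L x x] by simp

lemma inf_conv_bound: "L \<ge> 0 \<Longrightarrow> x \<in> M \<Longrightarrow> \<bar>inf_conv F L x\<bar> \<le> B"
  using inf_conv_lower[of L x] inf_conv_le[of L x] B[of x] by linarith

lemma inf_conv_Lipschitz:
  assumes "L \<ge> 0" "x \<in> M" "y \<in> M"
  shows "\<bar>inf_conv F L x - inf_conv F L y\<bar> \<le> L * d x y"
proof -
  have *: "inf_conv F L x \<le> inf_conv F L y + L * d x y" if xy: "x \<in> M" "y \<in> M" for x y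
  proof -
    have "inf_conv F L x - L * d x y \<le> inf_conv F L y"
      unfolding inf_conv_def[of F L y]
    proof (rule cINF_greatest)
      fix z assume z: "z \<in> M"
      have "inf_conv F L x \<le> F z + L * d x z"
        unfolding inf_conv_def by (rule cINF_lower[OF inf_conv_bdd]) (use z xy assms in auto)
      also have "\<dots> \<le> F z + L * (d x y + d y z)"
        using assms triangle[OF xy z] by (intro add_left_mono mult_left_mono) auto
      finally show "inf_conv F L x - L * d x y \<le> F z + L * d y z" by (simp add: algebra_simps)
    qed (use xy in auto)
    then show ?thesis by simp
  qed
  from *[OF assms(2,3)] *[OF assms(3,2)] show ?thesis by (simp add: commute abs_le_iff)
qed

text \<open>Outside a ball of radius \<open>r\<close> the penalty \<open>n * d x y\<close> is
  eventually at least \<open>2 * B\<close>, the most by which two values of \<open>F\<close> can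
  differ. So only points near \<open>x\<close>, where \<open>F\<close> is hardly below
  \<open>F x\<close>, can compete in the infimum.\<close>

lemma inf_conv_tendsto:
  assumes F: "continuous_map mtopology euclideanreal F" and x: "x \<in> M"
  shows "(\<lambda>n. inf_conv F (real n) x) \<longlonglongrightarrow> F x"
proof (rule LIMSEQ_I)
  fix e :: real assume e: "e > 0"
  have "openin mtopology {y \<in> M. F y \<in> {F x - e / 2<..}}"
    using F open_greaterThan[of "F x - e / 2"] unfolding continuous_map_def by (metis topspace_mtopology open_openin)
  then obtain r where r: "r > 0" "mball x r \<subseteq> {y \<in> M. F y \<in> {F x - e / 2<..}}"
    using x e unfolding openin_mtopology by auto
  obtain n0 :: nat where n0: "real n0 > 2 * B / r" using reals_Archimedean2 by blast
  show "\<exists>no. \<forall>n\<ge>no. norm (inf_conv F (real n) x - F x) < e"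
  proof (intro exI allI impI)
    fix n assume n: "n \<ge> n0"
    have "F x - e / 2 \<le> inf_conv F (real n) x"
      unfolding inf_conv_def
    proof (rule cINF_greatest)
      fix y assume y: "y \<in> M"
      show "F x - e / 2 \<le> F y + real n * d x y"
      proof (cases "d x y < r")
        case True
        then have "F y > F x - e / 2" using r(2) x y by auto
        moreover have "real n * d x y \<ge> 0" by simp
        ultimately show ?thesis by linarith
      next
        case False
        have "2 * B \<le> real n0 * r" using n0 r by (simp add: field_simps)
        also have "\<dots> \<le> real n * d x y" using n False r by (intro mult_mono) auto
        finally show ?thesis using B[OF x] B[OF y] e by linarith
      qed
    qed (use x in auto)
    with inf_conv_le[of "real n" x] x e show "norm (inf_conv F (real n) x - F x) < e" by auto
  qed
qed

end

lemma continuous_map_sequentially_dist: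
  fixes F :: "'a \<Rightarrow> real"
  assumes "continuous_map mtopology euclideanreal F" "x \<in> M" "\<And>n. X n \<in> M" "(\<lambda>n. d (X n) x) \<longlonglongrightarrow> 0"
  shows "(\<lambda>n. F (X n)) \<longlonglongrightarrow> F x"
  using continuous_map_limit[OF assms(1), of X x sequentially] assms(2-)
  by (auto simp: limitin_metric_dist_null comp_def)

text \<open>Every bounded continuous \<open>F\<close> lies above Lipschitz functions whose integrals
  under the limit law approach that of \<open>F\<close>; this gives the lower half of the
  convergence, and \<open>- F\<close> gives the upper half. Lipschitz test functions are what turns
  bounds on the distance of paths into bounds on expectations.\<close>

lemma converges_in_distribution_LipschitzI:
  assumes X: "\<forall>\<^sub>F n in sequentially. prob_space (P n) \<and> X n \<in> P n \<rightarrow>\<^sub>M borel_of mtopology"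
    and N: "prob_space N" and Y: "Y \<in> N \<rightarrow>\<^sub>M borel_of mtopology"
    and conv: "\<And>F B L. (\<And>x. x \<in> M \<Longrightarrow> \<bar>F x\<bar> \<le> B) \<Longrightarrow> L \<ge> 0 \<Longrightarrow>
        (\<And>x y. x \<in> M \<Longrightarrow> y \<in> M \<Longrightarrow> \<bar>F x - F y\<bar> \<le> L * d x y) \<Longrightarrow>
        (\<lambda>n. \<integral>\<omega>. F (X n \<omega>) \<partial>P n) \<longlonglongrightarrow> (\<integral>\<omega>. F (Y \<omega>) \<partial>N)"
  shows "converges_in_distribution mtopology P X N Y"
proof -
  interpret N: prob_space N by fact
  have space_bo: "space (borel_of mtopology) = M"
    by (simp add: borel_of_def space_measure_of_conv)
  have lower: "\<forall>\<^sub>F n in sequentially. (\<integral>\<omega>. F (X n \<omega>) \<partial>P n) > (\<integral>\<omega>. F (Y \<omega>) \<partial>N) - e"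
    if F: "continuous_map mtopology euclideanreal F" and B: "\<And>x. x \<in> M \<Longrightarrow> \<bar>F x\<bar> \<le> B"
      and e: "e > 0" for F B e
  proof -
    let ?G = "\<lambda>m. inf_conv F (real m)"
    have YM: "Y \<omega> \<in> M" if "\<omega> \<in> space N" for \<omega>
      using measurable_space[OF Y that] by (simp add: space_bo)
    have G: "continuous_map mtopology euclideanreal (?G m)" for m
      by (rule continuous_map_Lipschitz[where L = "real m"]) (rule inf_conv_Lipschitz[OF B], auto)
    have [measurable]: "(\<lambda>\<omega>. ?G m (Y \<omega>)) \<in> borel_measurable N" for m
      by (rule measurable_compose[OF Y continuous_map_borel_of[OF G]])
    have [measurable]: "(\<lambda>\<omega>. F (Y \<omega>)) \<in> borel_measurable N"
      by (rule measurable_compose[OF Y continuous_map_borel_of[OF F]])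
    have "(\<lambda>m. \<integral>\<omega>. ?G m (Y \<omega>) \<partial>N) \<longlonglongrightarrow> (\<integral>\<omega>. F (Y \<omega>) \<partial>N)"
      by (rule integral_dominated_convergence[where w = "\<lambda>_. B"])
         (auto intro!: AE_I2 inf_conv_tendsto[OF B F] inf_conv_bound[OF B] YM)
    from order_tendstoD(1)[OF this, of "(\<integral>\<omega>. F (Y \<omega>) \<partial>N) - e"] e
    obtain m where m: "(\<integral>\<omega>. ?G m (Y \<omega>) \<partial>N) > (\<integral>\<omega>. F (Y \<omega>) \<partial>N) - e"
      by (auto simp: eventually_sequentially)
    have "(\<lambda>n. \<integral>\<omega>. ?G m (X n \<omega>) \<partial>P n) \<longlonglongrightarrow> (\<integral>\<omega>. ?G m (Y \<omega>) \<partial>N)"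
      by (rule conv[of "?G m" B "real m"])
         (auto intro!: inf_conv_bound[OF B] inf_conv_Lipschitz[OF B])
    from order_tendstoD(1)[OF this m] X show ?thesis
    proof eventually_elim
      case (elim n)
      interpret P: prob_space "P n" using elim by blast
      have Xn: "X n \<in> P n \<rightarrow>\<^sub>M borel_of mtopology" using elim by blast
      have XM: "X n \<omega> \<in> M" if "\<omega> \<in> space (P n)" for \<omega>
        using measurable_space[OF Xn that] by (simp add: space_bo)
      have [measurable]: "(\<lambda>\<omega>. ?G m (X n \<omega>)) \<in> borel_measurable (P n)"
        by (rule measurable_compose[OF Xn continuous_map_borel_of[OF G]])
      have [measurable]: "(\<lambda>\<omega>. F (X n \<omega>)) \<in> borel_measurable (P n)"
        by (rule measurable_compose[OF Xn continuous_map_borel_of[OF F]])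
      have "(\<integral>\<omega>. ?G m (X n \<omega>) \<partial>P n) \<le> (\<integral>\<omega>. F (X n \<omega>) \<partial>P n)"
        by (intro integral_mono P.integrable_const_bound[where B = B])
           (auto intro!: AE_I2 inf_conv_bound[OF B] B XM inf_conv_le[OF B])
      with elim show ?case by linarith
    qed
  qed
  have "(\<lambda>n. \<integral>\<omega>. F (X n \<omega>) \<partial>P n) \<longlonglongrightarrow> (\<integral>\<omega>. F (Y \<omega>) \<partial>N)"
    if F: "continuous_map mtopology euclideanreal F" and bdd: "bounded (F ` M)" for F
  proof -
    obtain B where B: "\<And>x. x \<in> M \<Longrightarrow> \<bar>F x\<bar> \<le> B"
      using bdd by (auto simp: bounded_iff)
    have F': "continuous_map mtopology euclideanreal (\<lambda>x. - F x)"
      using continuous_map_compose[OF F, of euclideanreal uminus]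
      by (simp add: comp_def continuous_on_minus continuous_on_id)
    show ?thesis
    proof (rule order_tendstoI)
      fix a assume "a < (\<integral>\<omega>. F (Y \<omega>) \<partial>N)"
      then show "\<forall>\<^sub>F n in sequentially. a < (\<integral>\<omega>. F (X n \<omega>) \<partial>P n)"
        using lower[OF F B, of "(\<integral>\<omega>. F (Y \<omega>) \<partial>N) - a"] by simp
    next
      fix a assume "(\<integral>\<omega>. F (Y \<omega>) \<partial>N) < a"
      then show "\<forall>\<^sub>F n in sequentially. (\<integral>\<omega>. F (X n \<omega>) \<partial>P n) < a"
        using lower[OF F', of B "a - (\<integral>\<omega>. F (Y \<omega>) \<partial>N)"] B by simp
    qed
  qed
  with X N Y show ?thesis
    by (auto simp: converges_in_distribution_def)
qed

end

section \<open>Step functions and continuous paths in the Skorohod space\<close>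

text \<open>A locally constant function minus a continuous centring. Both are given on the whole
  line, so one-sided limits at 0 and 1 need no special treatment; the restriction to
  \<open>{0..1}\<close> comes last.\<close>

lemma skorohod_space_jump_process:
  fixes u c :: "real \<Rightarrow> real"
  assumes right: "\<And>t. \<forall>\<^sub>F s in at_right t. u s = u t"
    and left: "\<And>t. \<exists>l. \<forall>\<^sub>F s in at_left t. u s = l"
    and c: "\<And>t. isCont c t"
  shows "(\<lambda>t\<in>{0..1}. (u t - c t) / d) \<in> skorohod_space"
  unfolding skorohod_space_def
proof (intro CollectI conjI ballI)
  fix t :: real assume t: "t \<in> {0..<1}"
  have "(c \<longlongrightarrow> c t) (at_right t)"
    using c by (simp add: isCont_def filterlim_at_split)
  moreover have "(u \<longlongrightarrow> u t) (at_right t)"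
    by (rule tendsto_eventually[OF right])
  ultimately have "((\<lambda>t. (u t - c t) / d) \<longlongrightarrow> (u t - c t) / d) (at_right t)"
    unfolding divide_inverse by (intro tendsto_intros)
  moreover have "\<forall>\<^sub>F s in at_right t. s \<in> {t<..<1}"
    by (rule eventually_at_rightI) (use t in auto)
  then have "\<forall>\<^sub>F s in at_right t. (u s - c s) / d = (\<lambda>t\<in>{0..1}. (u t - c t) / d) s"
    by eventually_elim (use t in auto)
  ultimately have "((\<lambda>t\<in>{0..1}. (u t - c t) / d) \<longlongrightarrow> (u t - c t) / d) (at_right t)"
    by (rule Lim_transform_eventually)
  then show "((\<lambda>t\<in>{0..1}. (u t - c t) / d) \<longlongrightarrow> (\<lambda>t\<in>{0..1}. (u t - c t) / d) t) (at_right t)"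
    using t by simp
next
  fix t :: real assume t: "t \<in> {0<..1}"
  obtain l where l: "\<forall>\<^sub>F s in at_left t. u s = l" using left by blast
  have "(c \<longlongrightarrow> c t) (at_left t)"
    using c by (simp add: isCont_def filterlim_at_split)
  moreover have "(u \<longlongrightarrow> l) (at_left t)"
    by (rule tendsto_eventually[OF l])
  ultimately have "((\<lambda>t. (u t - c t) / d) \<longlongrightarrow> (l - c t) / d) (at_left t)"
    unfolding divide_inverse by (intro tendsto_intros)
  moreover have "\<forall>\<^sub>F s in at_left t. s \<in> {0<..<t}"
    by (rule eventually_at_leftI) (use t in auto)
  then have "\<forall>\<^sub>F s in at_left t. (u s - c s) / d = (\<lambda>t\<in>{0..1}. (u t - c t) / d) s"
    by eventually_elim (use t in auto)
  ultimately show "\<exists>l. ((\<lambda>t\<in>{0..1}. (u t - c t) / d) \<longlongrightarrow> l) (at_left t)"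
    by (intro exI) (rule Lim_transform_eventually)
qed auto

text \<open>Just to the right of \<open>t\<close> the threshold has not yet reached the next integer
  \<open>\<lfloor>\<phi> t\<rfloor> + 1\<close>.\<close>

lemma eventually_level_set_right:
  fixes \<phi> :: "real \<Rightarrow> real"
  assumes "strict_mono \<phi>" "isCont \<phi> t"
  shows "\<forall>\<^sub>F s in at_right t. {i::nat. 1 \<le> i \<and> real i \<le> \<phi> s} = {i. 1 \<le> i \<and> real i \<le> \<phi> t}"
proof -
  have "(\<phi> \<longlongrightarrow> \<phi> t) (at_right t)"
    using assms(2) by (simp add: isCont_def filterlim_at_split)
  moreover have "\<phi> t < of_int \<lfloor>\<phi> t\<rfloor> + 1" by linarith
  ultimately have "\<forall>\<^sub>F s in at_right t. \<phi> s < of_int \<lfloor>\<phi> t\<rfloor> + 1" by (rule order_tendstoD)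
  moreover have "\<forall>\<^sub>F s in at_right t. s > t" by (simp add: eventually_at_right_less)
  ultimately show ?thesis
  proof eventually_elim
    case (elim s)
    have "real i \<le> \<phi> t" if "real i \<le> \<phi> s" for i
    proof -
      have "int i < \<lfloor>\<phi> t\<rfloor> + 1" using that elim by linarith
      then show ?thesis by linarith
    qed
    moreover have "\<phi> t \<le> \<phi> s" using elim assms(1) by (simp add: strict_mono_def less_imp_le)
    ultimately show ?case by force
  qed
qed

text \<open>From the left the threshold stays below \<open>\<phi> t\<close>, so an integer equal to
  \<open>\<phi> t\<close> is still missing; this is where jumps come from.\<close>

lemma eventually_level_set_left:
  fixes \<phi> :: "real \<Rightarrow> real"
  assumes "strict_mono \<phi>" "isCont \<phi> t"
  shows "\<forall>\<^sub>F s in at_left t. {i::nat. 1 \<le> i \<and> real i \<le> \<phi> s} = {i. 1 \<le> i \<and> real i < \<phi> t}"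
proof -
  have "(\<phi> \<longlongrightarrow> \<phi> t) (at_left t)"
    using assms(2) by (simp add: isCont_def filterlim_at_split)
  moreover have "of_int \<lceil>\<phi> t\<rceil> - 1 < \<phi> t" by linarith
  ultimately have "\<forall>\<^sub>F s in at_left t. of_int \<lceil>\<phi> t\<rceil> - 1 < \<phi> s" by (rule order_tendstoD)
  moreover have "\<forall>\<^sub>F s in at_left t. s < t" by (auto simp: eventually_at_filter)
  ultimately show ?thesis
  proof eventually_elim
    case (elim s)
    have "real i \<le> \<phi> s" if "real i < \<phi> t" for i
    proof -
      have "int i \<le> \<lceil>\<phi> t\<rceil> - 1" using that by linarith
      then show ?thesis using elim by linarith
    qed
    moreover have "\<phi> s < \<phi> t" using elim assms(1) by (simp add: strict_mono_def)
    ultimately show ?case by force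
  qed
qed

text \<open>Products, least common multiples and grid paths depend on \<open>t\<close> only through
  the set of integers up to a threshold; the arbitrary set function \<open>g\<close> covers all
  three.\<close>

lemma skorohod_space_level_sets:
  fixes \<phi> c :: "real \<Rightarrow> real" and g :: "nat set \<Rightarrow> real"
  assumes "strict_mono \<phi>" "\<And>t. isCont \<phi> t" "\<And>t. isCont c t"
  shows "(\<lambda>t\<in>{0..1}. (g {i. 1 \<le> i \<and> real i \<le> \<phi> t} - c t) / d) \<in> skorohod_space"
proof (rule skorohod_space_jump_process)
  fix t
  show "\<forall>\<^sub>F s in at_right t. g {i. 1 \<le> i \<and> real i \<le> \<phi> s} = g {i. 1 \<le> i \<and> real i \<le> \<phi> t}"
    using eventually_level_set_right[OF assms(1,2)] by eventually_elim simp
  have "\<forall>\<^sub>F s in at_left t. g {i. 1 \<le> i \<and> real i \<le> \<phi> s} = g {i. 1 \<le> i \<and> real i < \<phi> t}"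
    using eventually_level_set_left[OF assms(1,2)] by eventually_elim simp
  then show "\<exists>l. \<forall>\<^sub>F s in at_left t. g {i. 1 \<le> i \<and> real i \<le> \<phi> s} = l" ..
qed fact

lemma skorohod_space_normalized_log_process:
  assumes n: "n \<ge> 2"
  shows "normalized_log_process \<theta> lcm_parts n \<alpha> \<in> skorohod_space"
    and "normalized_log_process \<theta> prod_parts n \<alpha> \<in> skorohod_space"
proof -
  have *: "strict_mono (\<lambda>t. real n powr t)" "isCont (\<lambda>t. real n powr t) t" for t
    using n by (auto simp: strict_mono_def intro!: continuous_intros powr_less_mono)
  have c: "isCont (\<lambda>t. \<theta> * t\<^sup>2 * (ln (real n))\<^sup>2 / 2) t" for t
    by (intro continuous_intros) auto
  note level = skorohod_space_level_sets[OF * c]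
  have "{i. 1 \<le> i \<and> real i \<le> real n powr t \<and> \<alpha> i > 0} = {i. 1 \<le> i \<and> real i \<le> real n powr t} \<inter> {i. \<alpha> i > 0}" for t
    by auto
  then show "normalized_log_process \<theta> lcm_parts n \<alpha> \<in> skorohod_space"
    using level[of "\<lambda>A. ln (real (Lcm (A \<inter> {i. \<alpha> i > 0})))"]
    by (simp add: normalized_log_process_def lcm_parts_def cong: restrict_cong)
  show "normalized_log_process \<theta> prod_parts n \<alpha> \<in> skorohod_space"
    using level[of "\<lambda>A. ln (real (\<Prod>i\<in>A. i ^ \<alpha> i))"]
    by (simp add: normalized_log_process_def prod_parts_def cong: restrict_cong)
qed

lemma skorohod_space_continuous:
  assumes "continuous_on {0..1} y"
  shows "restrict y {0..1} \<in> skorohod_space"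
  unfolding skorohod_space_def
proof (intro CollectI conjI ballI)
  have lim: "(y \<longlongrightarrow> y t) (at t within {0..1})" if "t \<in> {0..1}" for t
    using assms that by (simp add: continuous_on_def)
  fix t :: real assume t: "t \<in> {0..<1}"
  have "(y \<longlongrightarrow> y t) (at_right t)"
    using tendsto_within_subset[OF lim, of t "{t..1}"] t by (auto simp: at_within_Icc_at_right)
  moreover have "\<forall>\<^sub>F s in at_right t. s \<in> {t<..<1}"
    by (rule eventually_at_rightI) (use t in auto)
  then have "\<forall>\<^sub>F s in at_right t. y s = restrict y {0..1} s"
    by eventually_elim (use t in auto)
  ultimately have "(restrict y {0..1} \<longlongrightarrow> y t) (at_right t)"
    by (rule Lim_transform_eventually)
  then show "(restrict y {0..1} \<longlongrightarrow> restrict y {0..1} t) (at_right t)"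
    using t by simp
next
  have lim: "(y \<longlongrightarrow> y t) (at t within {0..1})" if "t \<in> {0..1}" for t
    using assms that by (simp add: continuous_on_def)
  fix t :: real assume t: "t \<in> {0<..1}"
  have "(y \<longlongrightarrow> y t) (at_left t)"
    using tendsto_within_subset[OF lim, of t "{0..t}"] t by (auto simp: at_within_Icc_at_left)
  moreover have "\<forall>\<^sub>F s in at_left t. s \<in> {0<..<t}"
    by (rule eventually_at_leftI) (use t in auto)
  then have "\<forall>\<^sub>F s in at_left t. y s = restrict y {0..1} s"
    by eventually_elim (use t in auto)
  ultimately show "\<exists>l. (restrict y {0..1} \<longlongrightarrow> l) (at_left t)"
    by (intro exI) (rule Lim_transform_eventually)
qed auto

text \<open>The identity time change bounds the Skorohod distance by the uniform one, which is the
  only comparison of paths used for the approximation. The definition admits positive radii only,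
  hence the slack \<open>d\<close>.\<close>

lemma skorohod_dist_le_sup:
  assumes "x \<in> skorohod_space" "y \<in> skorohod_space" "0 \<le> e"
    and "\<And>t. t \<in> {0..1} \<Longrightarrow> \<bar>x t - y t\<bar> \<le> e"
  shows "skorohod_dist x y \<le> e"
proof (rule field_le_epsilon)
  fix d :: real assume "d > 0"
  have "\<bar>id t - t\<bar> \<le> e + d \<and> \<bar>x t - y (id t)\<bar> \<le> e + d" if "t \<in> {0..1}" for t
    using assms(3) assms(4)[OF that] \<open>d > 0\<close> by simp
  moreover have "time_change id" by (simp add: time_change_def strict_mono_on_def)
  ultimately have "skorohod_close (e + d) x y"
    unfolding skorohod_close_def by blast
  then show "skorohod_dist x y \<le> e + d"
    using assms \<open>d > 0\<close> by (intro skorohod_dist_le) auto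
qed

section \<open>Paths that are constant between grid points\<close>

definition grid_step :: "nat \<Rightarrow> (nat \<Rightarrow> real) \<Rightarrow> real \<Rightarrow> real" where
  "grid_step k s = (\<lambda>t\<in>{0..1}. s (nat \<lfloor>t * real k\<rfloor>))"

lemma grid_index_le: "t \<in> {0..1} \<Longrightarrow> nat \<lfloor>t * real k\<rfloor> \<le> k"
proof -
  assume "t \<in> {0..1}"
  then have "t * real k \<le> 1 * real k" by (intro mult_right_mono) auto
  then show ?thesis by linarith
qed

text \<open>The grid index of \<open>t\<close> is the number of positive integers up to
  \<open>t * real k\<close>, hence a function of a level set.\<close>

lemma grid_step_in_space:
  assumes "k \<ge> 1"
  shows "grid_step k s \<in> skorohod_space"
proof -
  have *: "strict_mono (\<lambda>t. t * real k)" "isCont (\<lambda>t. t * real k) t" for t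
    using assms by (simp_all add: strict_mono_def)
  have "{i. 1 \<le> i \<and> real i \<le> t * real k} = {1..nat \<lfloor>t * real k\<rfloor>}" if "t \<ge> 0" for t
  proof -
    have *: "real i \<le> y \<longleftrightarrow> i \<le> nat \<lfloor>y\<rfloor>" if "y \<ge> 0" for i y using that by linarith
    have "t * real k \<ge> 0" using that by simp
    from *[OF this] show ?thesis by (simp only: atLeastAtMost_def atLeast_def atMost_def) blast
  qed
  then have "card {i. 1 \<le> i \<and> real i \<le> t * real k} = nat \<lfloor>t * real k\<rfloor>" if "t \<ge> 0" for t
    using that by simp
  then have "grid_step k s = (\<lambda>t\<in>{0..1}. (s (card {i. 1 \<le> i \<and> real i \<le> t * real k}) - 0) / 1)"
    unfolding grid_step_def by (intro restrict_ext) simp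
  then show ?thesis
    using skorohod_space_level_sets[OF *, of "\<lambda>_. 0" "\<lambda>A. s (card A)" 1] by simp
qed

lemma grid_step_dist:
  assumes "k \<ge> 1" "0 \<le> e" "\<And>b. b \<le> k \<Longrightarrow> \<bar>s b - s' b\<bar> \<le> e"
  shows "skorohod_dist (grid_step k s) (grid_step k s') \<le> e"
proof (rule skorohod_dist_le_sup)
  fix t :: real assume "t \<in> {0..1}"
  then show "\<bar>grid_step k s t - grid_step k s' t\<bar> \<le> e"
    using assms(3)[OF grid_index_le[of t k]] by (simp add: grid_step_def)
qed (use assms in \<open>auto intro: grid_step_in_space\<close>)

lemma grid_step_tendsto_path:
  assumes y: "continuous_on {0..1} y"
  shows "(\<lambda>k. skorohod_dist (grid_step (Suc k) (\<lambda>b. y (real b / real (Suc k)))) (restrict y {0..1})) \<longlonglongrightarrow> 0"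
proof (rule LIMSEQ_I)
  fix e :: real assume e: "e > 0"
  have "uniformly_continuous_on {0..1} y"
    using y by (intro compact_uniformly_continuous) auto
  then obtain d where d: "d > 0"
    "\<And>s t. s \<in> {0..1} \<Longrightarrow> t \<in> {0..1} \<Longrightarrow> \<bar>s - t\<bar> < d \<Longrightarrow> \<bar>y s - y t\<bar> < e / 2"
    using half_gt_zero[OF e] unfolding uniformly_continuous_on_def dist_real_def
    by (metis abs_minus_commute)
  obtain n0 :: nat where n0: "1 / d < real n0" using reals_Archimedean2 by blast
  show "\<exists>no. \<forall>n\<ge>no. norm (skorohod_dist (grid_step (Suc n) (\<lambda>b. y (real b / real (Suc n))))
          (restrict y {0..1}) - 0) < e"
  proof (intro exI allI impI)
    fix n assume n: "n \<ge> n0"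
    have "1 / d < real (Suc n)" using n0 n by linarith
    then have dn: "1 / real (Suc n) < d" using d(1) by (simp add: field_simps)
    have "skorohod_dist (grid_step (Suc n) (\<lambda>b. y (real b / real (Suc n)))) (restrict y {0..1}) \<le> e / 2"
    proof (rule skorohod_dist_le_sup)
      fix t :: real assume t: "t \<in> {0..1}"
      define s where "s = real (nat \<lfloor>t * real (Suc n)\<rfloor>) / real (Suc n)"
      have "t * real (Suc n) \<ge> 0" using t by (simp del: of_nat_Suc)
      then have "real (nat \<lfloor>t * real (Suc n)\<rfloor>) \<le> t * real (Suc n)" by linarith
      then have s1: "s \<le> t" by (simp add: s_def field_simps del: of_nat_Suc)
      have "t * real (Suc n) < real (nat \<lfloor>t * real (Suc n)\<rfloor>) + 1" by linarith
      then have "t < s + 1 / real (Suc n)" by (simp add: s_def field_simps del: of_nat_Suc)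
      with s1 dn have "\<bar>s - t\<bar> < d" by linarith
      moreover have "s \<ge> 0" unfolding s_def by (intro divide_nonneg_nonneg) auto
      then have "s \<in> {0..1}" using s1 t by auto
      ultimately have "\<bar>y s - y t\<bar> < e / 2" using d(2) t by blast
      then show "\<bar>grid_step (Suc n) (\<lambda>b. y (real b / real (Suc n))) t - restrict y {0..1} t\<bar> \<le> e / 2"
        using t by (simp add: grid_step_def s_def)
    qed (use e y in \<open>auto intro: grid_step_in_space skorohod_space_continuous\<close>)
    with e skorohod.nonneg[of "grid_step (Suc n) (\<lambda>b. y (real b / real (Suc n)))" "restrict y {0..1}"]
    show "norm (skorohod_dist (grid_step (Suc n) (\<lambda>b. y (real b / real (Suc n))))
          (restrict y {0..1}) - 0) < e" unfolding real_norm_def by linarith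
  qed
qed

lemma grid_step_measurable:
  assumes F: "continuous_map skorohod_topology euclideanreal F" and k: "k \<ge> 1"
    and s: "\<And>b. b \<le> k \<Longrightarrow> s b \<in> borel_measurable N"
  shows "(\<lambda>\<omega>. F (grid_step k (\<lambda>b. s b \<omega>))) \<in> borel_measurable N"
proof -
  have "continuous_on UNIV (\<lambda>x :: nat \<Rightarrow> real. F (grid_step k x))"
    unfolding continuous_on_sequentially
  proof (intro allI ballI impI)
    fix X :: "nat \<Rightarrow> nat \<Rightarrow> real" and a
    assume X: "(\<forall>n. X n \<in> UNIV) \<and> X \<longlonglongrightarrow> a"
    have coord: "(\<lambda>n. X n b) \<longlonglongrightarrow> a b" for b
      using continuous_on_tendsto_compose[OF continuous_on_product_coordinates, of X a] X by auto
    have "(\<lambda>n. \<Sum>b\<le>k. \<bar>X n b - a b\<bar>) \<longlonglongrightarrow> (\<Sum>b\<le>k. \<bar>a b - a b\<bar>)"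
      by (intro tendsto_intros coord)
    then have lim: "(\<lambda>n. \<Sum>b\<le>k. \<bar>X n b - a b\<bar>) \<longlonglongrightarrow> 0" by simp
    have "norm (skorohod_dist (grid_step k (X n)) (grid_step k a)) \<le> (\<Sum>b\<le>k. \<bar>X n b - a b\<bar>)" for n
      using grid_step_dist[OF k, of "\<Sum>b\<le>k. \<bar>X n b - a b\<bar>" "X n" a]
        member_le_sum[of _ "{..k}" "\<lambda>b. \<bar>X n b - a b\<bar>"] by (simp add: sum_nonneg)
    then have "\<forall>\<^sub>F n in sequentially. norm (skorohod_dist (grid_step k (X n)) (grid_step k a)) \<le> (\<Sum>b\<le>k. \<bar>X n b - a b\<bar>)"
      by simp
    then have "(\<lambda>n. skorohod_dist (grid_step k (X n)) (grid_step k a)) \<longlonglongrightarrow> 0"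
      using lim by (rule Lim_null_comparison)
    then show "((\<lambda>x. F (grid_step k x)) \<circ> X) \<longlonglongrightarrow> F (grid_step k a)"
      unfolding comp_def
      by (intro skorohod.continuous_map_sequentially_dist[OF F])
         (auto intro: grid_step_in_space k)
  qed
  then have "(\<lambda>x. F (grid_step k x)) \<in> borel_measurable (PiM UNIV (\<lambda>_. borel))"
    using borel_measurable_continuous_onI measurable_cong_sets[OF sets_PiM_equal_borel refl] by blast
  \<comment> \<open>Measurability is known only up to \<open>k\<close>; the other coordinates are
    set to 0, which the grid path never sees.\<close>
  moreover have "(\<lambda>\<omega>. if b \<le> k then s b \<omega> else 0) \<in> borel_measurable N" for b
    using s by (cases "b \<le> k") auto
  then have "(\<lambda>\<omega> b. if b \<le> k then s b \<omega> else 0) \<in> N \<rightarrow>\<^sub>M PiM UNIV (\<lambda>_. borel)"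
    by (intro measurable_PiM_single') auto
  ultimately have "(\<lambda>\<omega>. F (grid_step k (\<lambda>b. if b \<le> k then s b \<omega> else 0))) \<in> borel_measurable N"
    by (rule measurable_compose[rotated])
  moreover have "grid_step k (\<lambda>b. if b \<le> k then s b \<omega> else 0) = grid_step k (\<lambda>b. s b \<omega>)" for \<omega>
    using grid_index_le[of _ k] by (auto simp: grid_step_def)
  ultimately show ?thesis by simp
qed

lemma continuous_path_grid_limit:
  assumes F: "continuous_map skorohod_topology euclideanreal F" and y: "continuous_on {0..1} y"
  shows "(\<lambda>k. F (grid_step (Suc k) (\<lambda>b. y (real b / real (Suc k))))) \<longlonglongrightarrow> F (restrict y {0..1})"
  by (rule skorohod.continuous_map_sequentially_dist[OF F skorohod_space_continuous[OF y] _ grid_step_tendsto_path[OF y]])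
     (auto intro: grid_step_in_space)

text \<open>Every open set is \<open>{F > 0}\<close> for some Lipschitz \<open>F\<close>, and by
  continuity of the path \<open>F\<close> along it is a pointwise limit of \<open>F\<close> along
  grid paths, which is measurable.\<close>

lemma continuous_path_measurable:
  assumes V: "\<And>t. t \<in> {0..1} \<Longrightarrow> V t \<in> borel_measurable N"
    and cont: "\<And>\<omega>. \<omega> \<in> space N \<Longrightarrow> continuous_on {0..1} (\<lambda>t. V t \<omega>)"
  shows "(\<lambda>\<omega>. \<lambda>t\<in>{0..1}. V t \<omega>) \<in> N \<rightarrow>\<^sub>M borel_of skorohod_topology"
proof -
  let ?Y = "\<lambda>\<omega>. \<lambda>t\<in>{0..1}. V t \<omega>"
  have top: "topspace skorohod_topology = skorohod_space"
    using skorohod.topspace_mtopology by simp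
  have Y: "?Y \<omega> \<in> skorohod_space" if "\<omega> \<in> space N" for \<omega>
    using skorohod_space_continuous[OF cont[OF that]] .
  have FY: "(\<lambda>\<omega>. F (?Y \<omega>)) \<in> borel_measurable N"
    if F: "continuous_map skorohod_topology euclideanreal F" for F
  proof (rule borel_measurable_LIMSEQ_real)
    fix \<omega> assume "\<omega> \<in> space N"
    from continuous_path_grid_limit[OF F cont[OF this]]
    show "(\<lambda>k. F (grid_step (Suc k) (\<lambda>b. V (real b / real (Suc k)) \<omega>))) \<longlonglongrightarrow> F (?Y \<omega>)" .
  next
    fix k
    show "(\<lambda>\<omega>. F (grid_step (Suc k) (\<lambda>b. V (real b / real (Suc k)) \<omega>))) \<in> borel_measurable N"
      by (intro grid_step_measurable[OF F] V) (auto simp: divide_simps)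
  qed
  show ?thesis unfolding borel_of_def
  proof (rule measurable_measure_of)
    show "{U. openin skorohod_topology U} \<subseteq> Pow (topspace skorohod_topology)"
      by (auto intro: openin_subset[THEN subsetD] simp flip: top)
    show "?Y \<in> space N \<rightarrow> topspace skorohod_topology" using Y by (auto simp: top)
    fix U assume "U \<in> {U. openin skorohod_topology U}"
    then have U: "openin skorohod_topology U" by simp
    define I where "I = (indicator U :: (real \<Rightarrow> real) \<Rightarrow> real)"
    \<comment> \<open>This envelope of the indicator is the distance to the complement of
      \<open>U\<close>, truncated at 1, so that \<open>U\<close> equal to the whole space is no
      exception.\<close>
    define F where "F = skorohod.inf_conv I 1"
    have I: "\<bar>I x\<bar> \<le> 1" for x by (simp add: I_def indicator_def)
    have F: "continuous_map skorohod_topology euclideanreal F"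
      using skorohod.continuous_map_Lipschitz[of F 1] skorohod.inf_conv_Lipschitz[of I 1 1] I
      by (simp add: F_def)
    have "x \<in> U \<longleftrightarrow> F x > 0" if x: "x \<in> skorohod_space" for x
    proof
      assume "x \<in> U"
      then obtain r where r: "r > 0" "skorohod.mball x r \<subseteq> U"
        using U skorohod.openin_mtopology by auto
      have "min 1 r \<le> F x"
        unfolding F_def skorohod.inf_conv_def
      proof (rule cINF_greatest)
        fix y assume y: "y \<in> skorohod_space"
        have "y \<in> U" if "skorohod_dist x y < r" using r x y that by auto
        then have "I y = 1 \<or> I y \<ge> 0 \<and> skorohod_dist x y \<ge> r"
          by (auto simp: I_def indicator_def)
        moreover have "0 \<le> skorohod_dist x y" by simp
        ultimately show "min 1 r \<le> I y + 1 * skorohod_dist x y" by linarith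
      qed (use x in auto)
      then show "F x > 0" using r by linarith
    next
      assume "F x > 0"
      moreover have "F x \<le> I x" unfolding F_def using I x by (intro skorohod.inf_conv_le[of _ 1]) auto
      ultimately show "x \<in> U" by (cases "x \<in> U") (auto simp: I_def)
    qed
    then have "?Y -` U \<inter> space N = {\<omega> \<in> space N. F (?Y \<omega>) > 0}" using Y by auto
    also have "\<dots> \<in> sets N" using FY[OF F] by measurable
    finally show "?Y -` U \<inter> space N \<in> sets N" .
  qed
qed

section \<open>A central limit theorem for bounded arrays\<close>

text \<open>Since \<open>exp y \<ge> 1 + y\<close>, the upper bound only needs
  \<open>1 - y + y^2\<close> to dominate \<open>1 / (1 + y)\<close>, and the product
  \<open>(1 - y + y^2) * (1 + y)\<close> equals \<open>1 + y^3\<close>.\<close>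

lemma exp_minus_linear_bound:
  fixes y :: real
  assumes "y \<ge> 0"
  shows "\<bar>exp (- y) - (1 - y)\<bar> \<le> y\<^sup>2"
proof -
  have "(1 - y + y\<^sup>2) * (1 + y) = 1 + y ^ 3" by (simp add: algebra_simps power2_eq_square power3_eq_cube)
  then have 1: "1 \<le> (1 - y + y\<^sup>2) * (1 + y)" using assms by simp
  have pos: "1 - y + y\<^sup>2 > 0" using zero_le_power2[of "y - 1 / 2"] by (simp add: power2_eq_square algebra_simps)
  have "1 \<le> (1 - y + y\<^sup>2) * exp y"
    using 1 pos exp_ge_add_one_self[of y] by (meson mult_left_mono order_trans less_imp_le)
  then have "exp (- y) \<le> 1 - y + y\<^sup>2" by (simp add: exp_minus field_simps)
  moreover have "exp (- y) \<ge> 1 - y" using exp_ge_add_one_self[of "- y"] by simp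
  ultimately show ?thesis by simp
qed

text \<open>A uniform bound on the summands replaces Lindeberg's condition: each factor of the
  characteristic function differs from its Gaussian counterpart by a null sequence (depending on
  \<open>t\<close>) times the variance of the summand. All factors have modulus at most 1, so these
  errors add up to a null sequence times the convergent total variance.\<close>

lemma bounded_array_CLT:
  fixes M :: "nat \<Rightarrow> 'a measure" and X :: "nat \<Rightarrow> 'i \<Rightarrow> 'a \<Rightarrow> real"
  assumes M: "\<And>n. prob_space (M n)" and fin: "\<And>n. finite (A n)"
    and indep: "\<And>n. prob_space.indep_vars (M n) (\<lambda>_. borel) (X n) (A n)"
    and mean: "\<And>n j. j \<in> A n \<Longrightarrow> (\<integral>\<omega>. X n j \<omega> \<partial>M n) = 0"
    and bdd: "\<And>n j \<omega>. j \<in> A n \<Longrightarrow> \<omega> \<in> space (M n) \<Longrightarrow> \<bar>X n j \<omega>\<bar> \<le> c n"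
    and c: "c \<longlonglongrightarrow> 0" "\<And>n. c n \<ge> 0"
    and var: "(\<lambda>n. \<Sum>j\<in>A n. \<integral>\<omega>. (X n j \<omega>)\<^sup>2 \<partial>M n) \<longlonglongrightarrow> v"
    and v: "v \<ge> 0"
  shows "weak_conv_m (\<lambda>n. distr (M n) borel (\<lambda>\<omega>. \<Sum>j\<in>A n. X n j \<omega>))
           (distr std_normal_distribution borel (\<lambda>x. sqrt v * x))"
proof -
  define V where "V n = (\<Sum>j\<in>A n. \<integral>\<omega>. (X n j \<omega>)\<^sup>2 \<partial>M n)" for n
  have rv: "X n j \<in> borel_measurable (M n)" if "j \<in> A n" for n j
    using indep[of n] that unfolding prob_space.indep_vars_def2[OF M] by simp
  have Srv: "(\<lambda>\<omega>. \<Sum>j\<in>A n. X n j \<omega>) \<in> borel_measurable (M n)" for n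
    by (intro borel_measurable_sum rv)
  have rd: "real_distribution std_normal_distribution" by (rule real_dist_normal_dist)
  have bound: "cmod (char (distr (M n) borel (\<lambda>\<omega>. \<Sum>j\<in>A n. X n j \<omega>)) t - exp (- (t\<^sup>2 * V n / 2)))
      \<le> (\<bar>t\<bar> ^ 3 / 6 * c n + t ^ 4 / 4 * (c n)\<^sup>2) * V n" for n t
  proof -
    interpret prob_space "M n" by (rule M)
    define \<sigma> where "\<sigma> j = expectation (\<lambda>\<omega>. (X n j \<omega>)\<^sup>2)" for j
    define \<phi> where "\<phi> j = char (distr (M n) borel (X n j)) t" for j
    have int: "integrable (M n) (\<lambda>\<omega>. X n j \<omega> ^ k)" if "j \<in> A n" for j k
    proof (rule integrable_const_bound[where B = "c n ^ k"])
      show "AE \<omega> in M n. norm (X n j \<omega> ^ k) \<le> c n ^ k"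
        by (rule AE_I2) (use bdd[OF that] in \<open>auto simp: power_abs intro!: power_mono\<close>)
    qed (use rv[OF that] in measurable)
    have \<sigma>: "0 \<le> \<sigma> j" "\<sigma> j \<le> (c n)\<^sup>2" if "j \<in> A n" for j
    proof -
      show "0 \<le> \<sigma> j" by (simp add: \<sigma>_def)
      have "\<sigma> j \<le> expectation (\<lambda>_. (c n)\<^sup>2)" unfolding \<sigma>_def
        by (intro integral_mono int that) (use bdd[OF that] in \<open>auto simp flip: abs_le_square_iff intro: order_trans[OF _ abs_ge_self]\<close>)
      then show "\<sigma> j \<le> (c n)\<^sup>2" by (simp add: prob_space)
    qed
    have each: "cmod (\<phi> j - exp (- (t\<^sup>2 * \<sigma> j / 2))) \<le> (\<bar>t\<bar> ^ 3 / 6 * c n + t ^ 4 / 4 * (c n)\<^sup>2) * \<sigma> j"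
      if j: "j \<in> A n" for j
    proof -
      \<comment> \<open>Second order Taylor expansion; the cubic remainder is then turned into
        \<open>c n\<close> times the variance.\<close>
      have "cmod (\<phi> j - (1 - t\<^sup>2 * \<sigma> j / 2)) \<le>
          (t\<^sup>2 / 6) * expectation (\<lambda>x. min (6 * (X n j x)\<^sup>2) (\<bar>t\<bar> * \<bar>X n j x\<bar> ^ 3))"
        unfolding \<phi>_def
        by (rule char_approx3') (use j rv mean int[OF j, of 1] int[OF j, of 2] in \<open>auto simp: \<sigma>_def\<close>)
      also have "\<dots> \<le> (t\<^sup>2 / 6) * expectation (\<lambda>x. \<bar>t\<bar> * c n * (X n j x)\<^sup>2)"
      proof (intro mult_left_mono integral_mono)
        show "integrable (M n) (\<lambda>x. min (6 * (X n j x)\<^sup>2) (\<bar>t\<bar> * \<bar>X n j x\<bar> ^ 3))"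
          by (rule Bochner_Integration.integrable_bound[OF integrable_mult_right[OF int[OF j, of 2], of 6]])
             (use rv[OF j] in \<open>auto intro!: AE_I2\<close>)
        show "integrable (M n) (\<lambda>x. \<bar>t\<bar> * c n * (X n j x)\<^sup>2)" by (intro integrable_mult_right int j)
        fix x assume "x \<in> space (M n)"
        then have "\<bar>X n j x\<bar> * (X n j x)\<^sup>2 \<le> c n * (X n j x)\<^sup>2" by (intro mult_right_mono bdd j) auto
        then have "\<bar>X n j x\<bar> ^ 3 \<le> c n * (X n j x)\<^sup>2" by (simp add: power3_eq_cube power2_eq_square abs_mult_self_eq mult.assoc)
        then have "\<bar>t\<bar> * \<bar>X n j x\<bar> ^ 3 \<le> \<bar>t\<bar> * (c n * (X n j x)\<^sup>2)" by (intro mult_left_mono) auto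
        then show "min (6 * (X n j x)\<^sup>2) (\<bar>t\<bar> * \<bar>X n j x\<bar> ^ 3) \<le> \<bar>t\<bar> * c n * (X n j x)\<^sup>2"
          by (simp add: mult.assoc)
      qed auto
      also have "\<dots> = \<bar>t\<bar> ^ 3 / 6 * c n * \<sigma> j"
        by (simp add: \<sigma>_def power3_eq_cube power2_eq_square[of t])
      finally have 1: "cmod (\<phi> j - (1 - t\<^sup>2 * \<sigma> j / 2)) \<le> \<bar>t\<bar> ^ 3 / 6 * c n * \<sigma> j" .
      have y: "0 \<le> t\<^sup>2 * \<sigma> j / 2" using \<sigma>(1)[OF j] by simp
      have "cmod (complex_of_real (exp (- (t\<^sup>2 * \<sigma> j / 2))) - complex_of_real (1 - t\<^sup>2 * \<sigma> j / 2)) =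
          \<bar>exp (- (t\<^sup>2 * \<sigma> j / 2)) - (1 - t\<^sup>2 * \<sigma> j / 2)\<bar>"
        by (simp only: of_real_diff[symmetric] norm_of_real)
      also have "\<dots> \<le> (t\<^sup>2 * \<sigma> j / 2)\<^sup>2" by (rule exp_minus_linear_bound[OF y])
      also have "\<dots> = t ^ 4 / 4 * (\<sigma> j * \<sigma> j)" by (simp add: power2_eq_square power4_eq_xxxx)
      \<comment> \<open>Only one of the two factors \<open>\<sigma> j\<close> is estimated; the
        other is kept so that the errors sum to the total variance.\<close>
      also have "\<dots> \<le> t ^ 4 / 4 * ((c n)\<^sup>2 * \<sigma> j)"
        by (intro mult_left_mono mult_right_mono \<sigma> j) auto
      finally have 2: "cmod (complex_of_real (exp (- (t\<^sup>2 * \<sigma> j / 2))) - complex_of_real (1 - t\<^sup>2 * \<sigma> j / 2))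
         \<le> t ^ 4 / 4 * (c n)\<^sup>2 * \<sigma> j" by simp
      have "cmod (\<phi> j - complex_of_real (exp (- (t\<^sup>2 * \<sigma> j / 2)))) \<le> cmod (\<phi> j - complex_of_real (1 - t\<^sup>2 * \<sigma> j / 2))
        + cmod (complex_of_real (exp (- (t\<^sup>2 * \<sigma> j / 2))) - complex_of_real (1 - t\<^sup>2 * \<sigma> j / 2))"
        by (rule order_trans[OF eq_refl norm_triangle_ineq4]) simp
      with 1 2 show ?thesis by (simp add: algebra_simps)
    qed
    have "char (distr (M n) borel (\<lambda>\<omega>. \<Sum>j\<in>A n. X n j \<omega>)) t = (\<Prod>j\<in>A n. \<phi> j)"
      unfolding \<phi>_def by (rule char_distr_sum[OF indep])
    moreover have "complex_of_real (exp (- (t\<^sup>2 * V n / 2))) = (\<Prod>j\<in>A n. complex_of_real (exp (- (t\<^sup>2 * \<sigma> j / 2))))"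
      by (simp add: V_def \<sigma>_def exp_sum[OF fin, symmetric] sum_negf sum_distrib_left sum_divide_distrib
               flip: of_real_prod)
    moreover have "cmod ((\<Prod>j\<in>A n. \<phi> j) - (\<Prod>j\<in>A n. complex_of_real (exp (- (t\<^sup>2 * \<sigma> j / 2)))))
        \<le> (\<Sum>j\<in>A n. cmod (\<phi> j - complex_of_real (exp (- (t\<^sup>2 * \<sigma> j / 2)))))"
    proof (rule norm_prod_diff)
      fix j assume j: "j \<in> A n"
      interpret D: real_distribution "distr (M n) borel (X n j)"
        by (rule real_distribution_distr[OF rv[OF j]])
      show "norm (\<phi> j) \<le> 1" unfolding \<phi>_def by (rule D.cmod_char_le_1)
      show "norm (complex_of_real (exp (- (t\<^sup>2 * \<sigma> j / 2)))) \<le> 1" using \<sigma>[OF j] by simp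
    qed
    moreover have "\<dots> \<le> (\<Sum>j\<in>A n. (\<bar>t\<bar> ^ 3 / 6 * c n + t ^ 4 / 4 * (c n)\<^sup>2) * \<sigma> j)"
      by (rule sum_mono) (rule each)
    moreover have "\<dots> = (\<bar>t\<bar> ^ 3 / 6 * c n + t ^ 4 / 4 * (c n)\<^sup>2) * V n"
      by (simp add: V_def \<sigma>_def sum_distrib_left)
    ultimately show ?thesis by simp
  qed
  have Vlim: "V \<longlonglongrightarrow> v" using var by (simp add: V_def[abs_def])
  show ?thesis
  proof (rule levy_continuity)
    fix n show "real_distribution (distr (M n) borel (\<lambda>\<omega>. \<Sum>j\<in>A n. X n j \<omega>))"
      by (rule prob_space.real_distribution_distr[OF M Srv])
  next
    show "real_distribution (distr std_normal_distribution borel ((*) (sqrt v)))"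
      using real_distribution.axioms(1)[OF rd] by (intro prob_space.real_distribution_distr) auto
  next
    fix t
    have "char (distr std_normal_distribution borel (\<lambda>x. sqrt v * x)) t = char std_normal_distribution (t * sqrt v)"
      by (simp add: char_def integral_distr mult.assoc)
    also have "\<dots> = exp (- (t\<^sup>2 * v / 2))"
      using v by (simp add: char_std_normal_distribution power_mult_distrib flip: exp_of_real of_real_power)
    finally have lim: "char (distr std_normal_distribution borel (\<lambda>x. sqrt v * x)) t = exp (- (t\<^sup>2 * v / 2))" .
    have "(\<lambda>n. (\<bar>t\<bar> ^ 3 / 6 * c n + t ^ 4 / 4 * (c n)\<^sup>2) * V n) \<longlonglongrightarrow> (\<bar>t\<bar> ^ 3 / 6 * 0 + t ^ 4 / 4 * 0\<^sup>2) * v"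
      by (intro tendsto_intros c Vlim)
    then have "(\<lambda>n. (\<bar>t\<bar> ^ 3 / 6 * c n + t ^ 4 / 4 * (c n)\<^sup>2) * V n) \<longlonglongrightarrow> 0" by simp
    then have "(\<lambda>n. char (distr (M n) borel (\<lambda>\<omega>. \<Sum>j\<in>A n. X n j \<omega>)) t - exp (- (t\<^sup>2 * V n / 2))) \<longlonglongrightarrow> 0"
      by (rule Lim_null_comparison[rotated]) (use bound in auto)
    moreover have "(\<lambda>n. complex_of_real (exp (- (t\<^sup>2 * V n / 2)))) \<longlonglongrightarrow> complex_of_real (exp (- (t\<^sup>2 * v / 2)))"
      by (intro tendsto_intros Vlim) auto
    ultimately show "(\<lambda>n. char (distr (M n) borel (\<lambda>\<omega>. \<Sum>j\<in>A n. X n j \<omega>)) t) \<longlonglongrightarrow>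
        char (distr std_normal_distribution borel (\<lambda>x. sqrt v * x)) t"
      unfolding lim using tendsto_add by fastforce
  qed
qed

text \<open>Convergence of the marginals is upgraded without multidimensional characteristic
  functions: each coordinate gets a Skorohod representation on its own space, and on the product of
  these spaces the vectors converge pointwise while their coordinates stay independent. Dominated
  convergence finishes the argument.\<close>

lemma joint_weak_convergence:
  fixes \<mu> :: "nat \<Rightarrow> 'i \<Rightarrow> real measure" and \<nu> :: "'i \<Rightarrow> real measure" and h :: "('i \<Rightarrow> real) \<Rightarrow> real"
  assumes I: "finite I" "I \<noteq> {}"
    and \<mu>: "\<And>n i. real_distribution (\<mu> n i)" and \<nu>: "\<And>i. real_distribution (\<nu> i)"
    and conv: "\<And>i. i \<in> I \<Longrightarrow> weak_conv_m (\<lambda>n. \<mu> n i) (\<nu> i)"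
    and h: "h \<in> borel_measurable (PiM I (\<lambda>_. borel))" "\<And>x. \<bar>h x\<bar> \<le> B"
    and cont: "\<And>X a. (\<And>i. i \<in> I \<Longrightarrow> (\<lambda>n. X n i) \<longlonglongrightarrow> a i) \<Longrightarrow> (\<lambda>n. h (X n)) \<longlonglongrightarrow> h a"
  shows "(\<lambda>n. \<integral>x. h x \<partial>PiM I (\<mu> n)) \<longlonglongrightarrow> (\<integral>x. h x \<partial>PiM I \<nu>)"
proof -
  have "\<exists>\<Omega> Ys Y. prob_space \<Omega> \<and> (\<forall>n. Ys n \<in> measurable \<Omega> borel) \<and>
      (\<forall>n. distr \<Omega> borel (Ys n) = \<mu> n i) \<and> Y \<in> measurable \<Omega> lborel \<and> distr \<Omega> borel Y = \<nu> i \<and>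
      (\<forall>x\<in>space (\<Omega> :: real measure). (\<lambda>n. Ys n x) \<longlonglongrightarrow> Y x)" if "i \<in> I" for i
    by (rule Skorohod[OF \<mu> \<nu> conv[OF that]])
  then obtain \<Omega> :: "'i \<Rightarrow> real measure" and Ys Y where sk: "\<And>i. i \<in> I \<Longrightarrow> prob_space (\<Omega> i) \<and>
      (\<forall>n. Ys i n \<in> measurable (\<Omega> i) borel) \<and>
      (\<forall>n. distr (\<Omega> i) borel (Ys i n) = \<mu> n i) \<and> Y i \<in> measurable (\<Omega> i) lborel \<and>
      distr (\<Omega> i) borel (Y i) = \<nu> i \<and> (\<forall>x\<in>space (\<Omega> i). (\<lambda>n. Ys i n x) \<longlonglongrightarrow> Y i x)"
    by metis
  \<comment> \<open>Indices outside \<open>I\<close> get a point mass, so that every index carries a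
    probability space.\<close>
  define \<Omega>' where "\<Omega>' i = (if i \<in> I then \<Omega> i else return borel 0)" for i
  have \<Omega>': "prob_space (\<Omega>' i)" for i
    using sk by (auto simp: \<Omega>'_def intro: prob_space_return)
  interpret Q: product_prob_space \<Omega>' I by (rule product_prob_spaceI[OF \<Omega>'])
  have PP: "prob_space (PiM I \<Omega>')" by (rule prob_space_PiM[OF \<Omega>'])
  note indep_iff = prob_space.indep_vars_iff_distr_eq_PiM'[OF PP I(2)]
  have distrI: "PiM I \<mu>' = distr (PiM I \<Omega>') (PiM I (\<lambda>_. borel)) (\<lambda>\<omega>. \<lambda>i\<in>I. Z i (\<omega> i))"
    if Z: "\<And>i. i \<in> I \<Longrightarrow> Z i \<in> measurable (\<Omega>' i) borel" "\<And>i. i \<in> I \<Longrightarrow> distr (\<Omega>' i) borel (Z i) = \<mu>' i"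
    for Z :: "'i \<Rightarrow> real \<Rightarrow> real" and \<mu>'
  proof -
    \<comment> \<open>Coordinates of a product measure are independent, and applying
      \<open>Z i\<close> to each preserves this; so the joint law of the images is the product of
      the marginal laws.\<close>
    have "prob_space.indep_vars (PiM I \<Omega>') \<Omega>' (\<lambda>i \<omega>. \<omega> i) I"
    proof (subst indep_iff)
      have "distr (PiM I \<Omega>') (PiM I \<Omega>') (\<lambda>x. \<lambda>i\<in>I. x i) = distr (PiM I \<Omega>') (PiM I \<Omega>') (\<lambda>x. x)"
        by (intro distr_cong) (auto simp: space_PiM)
      also have "\<dots> = PiM I \<Omega>'" by (rule distr_id2) simp
      also have "\<dots> = PiM I (\<lambda>i. distr (PiM I \<Omega>') (\<Omega>' i) (\<lambda>\<omega>. \<omega> i))"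
        by (intro PiM_cong) (auto simp: Q.PiM_component)
      finally show "distr (PiM I \<Omega>') (PiM I \<Omega>') (\<lambda>x. \<lambda>i\<in>I. x i) = \<dots>" .
    qed auto
    then have "prob_space.indep_vars (PiM I \<Omega>') (\<lambda>_. borel) (\<lambda>i \<omega>. Z i (\<omega> i)) I"
      by (rule prob_space.indep_vars_compose2[OF PP]) (use Z in auto)
    then have "distr (PiM I \<Omega>') (PiM I (\<lambda>_. borel)) (\<lambda>\<omega>. \<lambda>i\<in>I. Z i (\<omega> i)) =
        PiM I (\<lambda>i. distr (PiM I \<Omega>') borel (\<lambda>\<omega>. Z i (\<omega> i)))"
      by (subst (asm) indep_iff) (use Z in auto)
    also have "\<dots> = PiM I \<mu>'"
    proof (rule PiM_cong)
      fix i assume i: "i \<in> I"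
      have "distr (PiM I \<Omega>') borel (\<lambda>\<omega>. Z i (\<omega> i)) = distr (distr (PiM I \<Omega>') (\<Omega>' i) (\<lambda>\<omega>. \<omega> i)) borel (Z i)"
        using Z(1)[OF i] i by (subst distr_distr) (auto simp: comp_def)
      also have "\<dots> = \<mu>' i" using Q.PiM_component[OF i] Z(2)[OF i] by simp
      finally show "distr (PiM I \<Omega>') borel (\<lambda>\<omega>. Z i (\<omega> i)) = \<mu>' i" .
    qed simp
    finally show ?thesis ..
  qed
  have meas: "(\<lambda>\<omega>. \<lambda>i\<in>I. Z i (\<omega> i)) \<in> PiM I \<Omega>' \<rightarrow>\<^sub>M PiM I (\<lambda>_. borel)"
    if Z: "\<And>i. i \<in> I \<Longrightarrow> Z i \<in> measurable (\<Omega>' i) borel" for Z :: "'i \<Rightarrow> real \<Rightarrow> real"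
    using Z by (intro measurable_restrict measurable_compose[OF measurable_component_singleton]) auto
  have Zs: "Ys i n \<in> measurable (\<Omega>' i) borel" "Y i \<in> measurable (\<Omega>' i) borel" if "i \<in> I" for i n
    using sk[OF that] that by (auto simp: \<Omega>'_def)
  have int: "(\<integral>x. h x \<partial>PiM I \<mu>') = (\<integral>\<omega>. h (\<lambda>i\<in>I. Z i (\<omega> i)) \<partial>PiM I \<Omega>')"
    if Z: "\<And>i. i \<in> I \<Longrightarrow> Z i \<in> measurable (\<Omega>' i) borel" "\<And>i. i \<in> I \<Longrightarrow> distr (\<Omega>' i) borel (Z i) = \<mu>' i"
    for Z :: "'i \<Rightarrow> real \<Rightarrow> real" and \<mu>'
  proof -
    have "(\<lambda>\<omega>. \<lambda>i\<in>I. Z i (\<omega> i)) \<in> PiM I \<Omega>' \<rightarrow>\<^sub>M PiM I (\<lambda>_. borel)"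
      by (rule meas) (rule Z(1))
    from integral_distr[OF this h(1)] show ?thesis
      using distrI[of Z \<mu>'] Z by simp
  qed
  have eq1: "(\<integral>x. h x \<partial>PiM I (\<mu> n)) = (\<integral>\<omega>. h (\<lambda>i\<in>I. Ys i n (\<omega> i)) \<partial>PiM I \<Omega>')" for n
    by (rule int) (use sk Zs in \<open>auto simp: \<Omega>'_def\<close>)
  have eq2: "(\<integral>x. h x \<partial>PiM I \<nu>) = (\<integral>\<omega>. h (\<lambda>i\<in>I. Y i (\<omega> i)) \<partial>PiM I \<Omega>')"
    by (rule int) (use sk Zs in \<open>auto simp: \<Omega>'_def\<close>)
  show ?thesis unfolding eq1 eq2
  proof (rule integral_dominated_convergence[where w = "\<lambda>_. B"])
    show "(\<lambda>\<omega>. h (\<lambda>i\<in>I. Y i (\<omega> i))) \<in> borel_measurable (PiM I \<Omega>')"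
      by (rule measurable_compose[OF meas h(1)]) (use Zs in auto)
    show "(\<lambda>\<omega>. h (\<lambda>i\<in>I. Ys i n (\<omega> i))) \<in> borel_measurable (PiM I \<Omega>')" for n
      by (rule measurable_compose[OF meas h(1)]) (use Zs in auto)
    show "AE \<omega> in PiM I \<Omega>'. (\<lambda>n. h (\<lambda>i\<in>I. Ys i n (\<omega> i))) \<longlonglongrightarrow> h (\<lambda>i\<in>I. Y i (\<omega> i))"
    proof (rule AE_I2)
      fix \<omega> assume "\<omega> \<in> space (PiM I \<Omega>')"
      then have "\<omega> i \<in> space (\<Omega> i)" if "i \<in> I" for i
        using that by (auto simp: space_PiM \<Omega>'_def PiE_def Pi_def split: if_splits)
      then show "(\<lambda>n. h (\<lambda>i\<in>I. Ys i n (\<omega> i))) \<longlonglongrightarrow> h (\<lambda>i\<in>I. Y i (\<omega> i))"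
        using sk by (intro cont) auto
    qed
  qed (use h(2) in auto)
qed

section \<open>Independent coordinates under a product of Bernoulli laws\<close>

abbreviation EE :: "'a pmf \<Rightarrow> ('a \<Rightarrow> real) \<Rightarrow> real" where
  "EE \<equiv> measure_pmf.expectation"

text \<open>Stated pointwise for total functions instead of by sub-sigma-algebras; independence then
  reduces to splitting a finite product law in two.\<close>

definition depends_on :: "'i set \<Rightarrow> (('i \<Rightarrow> 'a) \<Rightarrow> 'b) \<Rightarrow> bool" where
  "depends_on A f \<longleftrightarrow> (\<forall>\<omega> \<omega>'. (\<forall>i\<in>A. \<omega> i = \<omega>' i) \<longrightarrow> f \<omega> = f \<omega>')"

lemma depends_onD: "depends_on A f \<Longrightarrow> (\<And>i. i \<in> A \<Longrightarrow> \<omega> i = \<omega>' i) \<Longrightarrow> f \<omega> = f \<omega>'"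
  by (auto simp: depends_on_def)

lemma depends_on_mono: "depends_on A f \<Longrightarrow> A \<subseteq> B \<Longrightarrow> depends_on B f"
  by (auto simp: depends_on_def)

lemma finite_set_Pi_pmf_bool:
  fixes p :: "'i \<Rightarrow> bool pmf"
  assumes "finite I"
  shows "finite (set_pmf (Pi_pmf I d p))"
proof (rule finite_subset[OF set_Pi_pmf_subset'[OF assms]])
  show "finite (PiE_dflt I d (set_pmf \<circ> p))" using assms by (intro finite_PiE_dflt) auto
qed

lemma EE_add: "finite (set_pmf p) \<Longrightarrow> EE p (\<lambda>x. f x + g x) = EE p f + EE p g"
  by (intro Bochner_Integration.integral_add integrable_measure_pmf_finite)

lemma EE_diff: "finite (set_pmf p) \<Longrightarrow> EE p (\<lambda>x. f x - g x) = EE p f - EE p g"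
  by (intro Bochner_Integration.integral_diff integrable_measure_pmf_finite)

lemma EE_sum: "finite (set_pmf p) \<Longrightarrow> EE p (\<lambda>x. \<Sum>i\<in>A. f i x) = (\<Sum>i\<in>A. EE p (f i))"
  by (intro Bochner_Integration.integral_sum integrable_measure_pmf_finite)

lemma EE_mono: "finite (set_pmf p) \<Longrightarrow> (\<And>x. x \<in> set_pmf p \<Longrightarrow> f x \<le> g x) \<Longrightarrow> EE p f \<le> EE p g"
  by (intro integral_mono_AE integrable_measure_pmf_finite) (auto simp: AE_measure_pmf_iff)

lemma EE_cong: "(\<And>x. x \<in> set_pmf p \<Longrightarrow> f x = g x) \<Longrightarrow> EE p f = EE p g"
  by (intro integral_cong_AE) (auto simp: AE_measure_pmf_iff)

lemma EE_pair_mult: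
  assumes "finite (set_pmf p)" "finite (set_pmf q)"
  shows "EE (pair_pmf p q) (\<lambda>z. f (fst z) * g (snd z)) = EE p f * EE q g"
proof -
  have "EE (pair_pmf p q) (\<lambda>z. f (fst z) * g (snd z)) =
      (\<Sum>z\<in>set_pmf p \<times> set_pmf q. f (fst z) * g (snd z) * pmf (pair_pmf p q) z)"
    using assms by (intro integral_measure_pmf_real) auto
  also have "\<dots> = (\<Sum>x\<in>set_pmf p. \<Sum>y\<in>set_pmf q. (f x * pmf p x) * (g y * pmf q y))"
    by (subst sum.cartesian_product) (auto intro!: sum.cong simp: pmf_pair)
  also have "\<dots> = (\<Sum>x\<in>set_pmf p. f x * pmf p x) * (\<Sum>y\<in>set_pmf q. g y * pmf q y)"
    by (simp add: sum_product)
  also have "\<dots> = EE p f * EE q g"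
    using assms by (simp add: integral_measure_pmf_real)
  finally show ?thesis .
qed

lemma power4_add: "(a + b) ^ 4 = a ^ 4 + b ^ 4 + 4 * (a ^ 3 * b ^ 1) + 6 * (a ^ 2 * b ^ 2) + 4 * (a ^ 1 * b ^ 3)"
  for a b :: real
  by algebra

text \<open>Tangent line of the convex function \<open>x ^ 4\<close> at \<open>a\<close>; the
  remainder is exhibited as \<open>b^2\<close> times a sum of squares. In the maximal inequality the
  linear term has mean zero.\<close>

lemma power4_add_ge: "a ^ 4 + 4 * (a ^ 3 * b) \<le> (a + b) ^ 4" for a b :: real
proof -
  have "(a + b) ^ 4 = a ^ 4 + 4 * (a ^ 3 * b) + b\<^sup>2 * (2 * a\<^sup>2 + (2 * a + b)\<^sup>2)" by algebra
  moreover have "b\<^sup>2 * (2 * a\<^sup>2 + (2 * a + b)\<^sup>2) \<ge> 0" by simp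
  ultimately show ?thesis by linarith
qed

section \<open>Moments of sums under a finite product law\<close>

context
  fixes I :: "'i set" and p :: "'i \<Rightarrow> bool pmf" and d :: bool
  assumes fin: "finite I"
begin

text \<open>The product law over \<open>I\<close> glues independent samples over \<open>A\<close>
  and \<open>I - A\<close>. Each function sees only its own half, so the default value
  \<open>d\<close> outside is invisible.\<close>

lemma Pi_pmf_split:
  assumes "A \<subseteq> I" "depends_on A f" "depends_on (I - A) g"
  shows "EE (Pi_pmf I d p) (\<lambda>\<omega>. f \<omega> * g \<omega>) = EE (Pi_pmf A d p) f * EE (Pi_pmf (I - A) d p) g"
proof -
  have finA: "finite A" "finite (I - A)" using assms fin by (auto intro: finite_subset)
  have "Pi_pmf I d p = Pi_pmf (A \<union> (I - A)) d p" using assms by (simp add: Un_absorb1)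
  also have "\<dots> = map_pmf (\<lambda>(u, v) x. if x \<in> A then u x else v x) (pair_pmf (Pi_pmf A d p) (Pi_pmf (I - A) d p))"
    by (rule Pi_pmf_union[OF finA]) auto
  finally have *: "Pi_pmf I d p = \<dots>" .
  have "EE (Pi_pmf I d p) (\<lambda>\<omega>. f \<omega> * g \<omega>) =
      EE (pair_pmf (Pi_pmf A d p) (Pi_pmf (I - A) d p)) (\<lambda>z. f (fst z) * g (snd z))"
    unfolding * integral_map_pmf
  proof (intro Bochner_Integration.integral_cong refl, goal_cases)
    case (1 z)
    obtain u v where z: "z = (u, v)" by (cases z)
    have "f (\<lambda>x. if x \<in> A then u x else v x) = f u"
      by (rule depends_onD[OF assms(2)]) simp
    moreover have "g (\<lambda>x. if x \<in> A then u x else v x) = g v"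
      by (rule depends_onD[OF assms(3)]) simp
    ultimately show ?case by (simp add: z)
  qed
  also have "\<dots> = EE (Pi_pmf A d p) f * EE (Pi_pmf (I - A) d p) g"
    by (intro EE_pair_mult finite_set_Pi_pmf_bool finA)
  finally show ?thesis .
qed

lemma Pi_pmf_marginal:
  assumes "A \<subseteq> I" "depends_on A f"
  shows "EE (Pi_pmf I d p) f = EE (Pi_pmf A d p) f"
  using Pi_pmf_split[OF assms, of "\<lambda>_. 1"] by (simp add: depends_on_def)

lemma Pi_pmf_expectation_mult:
  assumes "depends_on A f" "depends_on B g" "A \<inter> B = {}" "A \<subseteq> I" "B \<subseteq> I"
  shows "EE (Pi_pmf I d p) (\<lambda>\<omega>. f \<omega> * g \<omega>) = EE (Pi_pmf I d p) f * EE (Pi_pmf I d p) g"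
proof -
  have g: "depends_on (I - A) g" using assms by (intro depends_on_mono[OF assms(2)]) auto
  show ?thesis
    using Pi_pmf_split[OF assms(4,1) g] Pi_pmf_marginal[OF assms(4,1)] Pi_pmf_marginal[OF _ g] by auto
qed

lemma depends_on_sum: "depends_on A (\<lambda>\<omega>. \<Sum>j\<in>A. x j (\<omega> j))"
  by (auto simp: depends_on_def intro!: sum.cong)

lemma depends_on_comp: "depends_on A f \<Longrightarrow> depends_on A (\<lambda>\<omega>. h (f \<omega>))"
  unfolding depends_on_def by metis

lemma depends_on_single: "depends_on {j} (\<lambda>\<omega>. x (\<omega> j))"
  by (auto simp: depends_on_def)

lemma EE_fin: "finite (set_pmf (Pi_pmf I d p))"
  using fin by (rule finite_set_Pi_pmf_bool)

context
  fixes x :: "'i \<Rightarrow> bool \<Rightarrow> real"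
  assumes mean: "\<And>j. j \<in> I \<Longrightarrow> EE (Pi_pmf I d p) (\<lambda>\<omega>. x j (\<omega> j)) = 0"
begin

lemma centered_sum_mean:
  assumes "A \<subseteq> I"
  shows "EE (Pi_pmf I d p) (\<lambda>\<omega>. \<Sum>j\<in>A. x j (\<omega> j)) = 0"
  using mean assms by (subst EE_sum[OF EE_fin]) (auto intro!: sum.neutral)

lemma centered_sum_variance:
  assumes "A \<subseteq> I"
  shows "EE (Pi_pmf I d p) (\<lambda>\<omega>. (\<Sum>j\<in>A. x j (\<omega> j))\<^sup>2) = (\<Sum>j\<in>A. EE (Pi_pmf I d p) (\<lambda>\<omega>. (x j (\<omega> j))\<^sup>2))"
  using finite_subset[OF assms fin] assms
proof (induction A rule: finite_induct)
  case (insert i A)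
  let ?E = "EE (Pi_pmf I d p)" and ?S = "\<lambda>\<omega>. \<Sum>j\<in>A. x j (\<omega> j)"
  have "?E (\<lambda>\<omega>. (\<Sum>j\<in>insert i A. x j (\<omega> j))\<^sup>2) =
      ?E (\<lambda>\<omega>. (?S \<omega>)\<^sup>2 + (x i (\<omega> i))\<^sup>2 + 2 * (?S \<omega> * x i (\<omega> i)))"
    using insert by (intro EE_cong) (simp add: power2_sum algebra_simps)
  also have "\<dots> = ?E (\<lambda>\<omega>. (?S \<omega>)\<^sup>2) + ?E (\<lambda>\<omega>. (x i (\<omega> i))\<^sup>2) + 2 * ?E (\<lambda>\<omega>. ?S \<omega> * x i (\<omega> i))"
    by (simp add: EE_add[OF EE_fin])
  also have "?E (\<lambda>\<omega>. ?S \<omega> * x i (\<omega> i)) = ?E ?S * ?E (\<lambda>\<omega>. x i (\<omega> i))"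
    using insert by (intro Pi_pmf_expectation_mult[where A = A and B = "{i}"] depends_on_sum depends_on_single) auto
  finally show ?case using insert mean by simp
qed simp

text \<open>When a variable is added, the mixed terms containing a first power vanish by centring.
  The remaining \<open>6 * (V * v)\<close> is the mixed term of
  \<open>3 * (v + V)^2\<close>.\<close>

lemma centered_sum_fourth_moment:
  assumes "A \<subseteq> I"
  shows "EE (Pi_pmf I d p) (\<lambda>\<omega>. (\<Sum>j\<in>A. x j (\<omega> j)) ^ 4) \<le>
    3 * (\<Sum>j\<in>A. EE (Pi_pmf I d p) (\<lambda>\<omega>. (x j (\<omega> j))\<^sup>2))\<^sup>2 + (\<Sum>j\<in>A. EE (Pi_pmf I d p) (\<lambda>\<omega>. x j (\<omega> j) ^ 4))"
  using finite_subset[OF assms fin] assms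
proof (induction A rule: finite_induct)
  case (insert i A)
  let ?E = "EE (Pi_pmf I d p)" and ?S = "\<lambda>\<omega>. \<Sum>j\<in>A. x j (\<omega> j)"
  define V where "V = (\<Sum>j\<in>A. ?E (\<lambda>\<omega>. (x j (\<omega> j))\<^sup>2))"
  define v where "v = ?E (\<lambda>\<omega>. (x i (\<omega> i))\<^sup>2)"
  have mult: "?E (\<lambda>\<omega>. ?S \<omega> ^ k * x i (\<omega> i) ^ l) = ?E (\<lambda>\<omega>. ?S \<omega> ^ k) * ?E (\<lambda>\<omega>. x i (\<omega> i) ^ l)" for k l
    using insert by (intro Pi_pmf_expectation_mult[where A = A and B = "{i}"]
        depends_on_comp[OF depends_on_sum] depends_on_single) auto
  have "?E (\<lambda>\<omega>. (\<Sum>j\<in>insert i A. x j (\<omega> j)) ^ 4) =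
      ?E (\<lambda>\<omega>. ?S \<omega> ^ 4 + x i (\<omega> i) ^ 4 + 4 * (?S \<omega> ^ 3 * x i (\<omega> i) ^ 1)
        + 6 * (?S \<omega> ^ 2 * x i (\<omega> i) ^ 2) + 4 * (?S \<omega> ^ 1 * x i (\<omega> i) ^ 3))"
  proof (intro EE_cong, goal_cases)
    case (1 \<omega>)
    have "(\<Sum>j\<in>insert i A. x j (\<omega> j)) = ?S \<omega> + x i (\<omega> i)" using insert by simp
    then show ?case by (simp only: power4_add)
  qed
  also have "\<dots> = ?E (\<lambda>\<omega>. ?S \<omega> ^ 4) + ?E (\<lambda>\<omega>. x i (\<omega> i) ^ 4) + 4 * ?E (\<lambda>\<omega>. ?S \<omega> ^ 3 * x i (\<omega> i) ^ 1)
      + 6 * ?E (\<lambda>\<omega>. ?S \<omega> ^ 2 * x i (\<omega> i) ^ 2) + 4 * ?E (\<lambda>\<omega>. ?S \<omega> ^ 1 * x i (\<omega> i) ^ 3)"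
    by (simp only: EE_add[OF EE_fin] integral_mult_right_zero)
  also have "\<dots> = ?E (\<lambda>\<omega>. ?S \<omega> ^ 4) + ?E (\<lambda>\<omega>. x i (\<omega> i) ^ 4) + 6 * (V * v)"
    unfolding mult using insert.prems mean[of i] centered_sum_mean[of A] centered_sum_variance[of A]
    by (simp add: V_def v_def)
  also have "\<dots> \<le> 3 * V\<^sup>2 + (\<Sum>j\<in>A. ?E (\<lambda>\<omega>. x j (\<omega> j) ^ 4)) + ?E (\<lambda>\<omega>. x i (\<omega> i) ^ 4) + 6 * (V * v)"
    using insert by (simp add: V_def)
  also have "\<dots> \<le> 3 * (v + V)\<^sup>2 + (?E (\<lambda>\<omega>. x i (\<omega> i) ^ 4) + (\<Sum>j\<in>A. ?E (\<lambda>\<omega>. x j (\<omega> j) ^ 4)))"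
    by (simp add: power2_sum algebra_simps)
  finally show ?case using insert by (simp add: V_def v_def)
qed simp

end

end

text \<open>Kolmogorov's stopping argument with fourth powers: on the event that \<open>m\<close> is
  the first index of exceedance, the sum up to \<open>m\<close> is determined by the past, while the
  remaining sum is centred and independent of it. Hence the linear term of the convexity bound has
  expectation zero.\<close>

lemma maximal_inequality_fourth_moment:
  fixes p :: "nat \<Rightarrow> bool pmf" and x :: "nat \<Rightarrow> bool \<Rightarrow> real"
  assumes fin: "finite I" and ab: "{a<..b} \<subseteq> I" and e: "e > 0"
    and mean: "\<And>j. j \<in> I \<Longrightarrow> EE (Pi_pmf I d p) (\<lambda>\<omega>. x j (\<omega> j)) = 0"
  shows "e ^ 4 * EE (Pi_pmf I d p) (\<lambda>\<omega>. of_bool (\<exists>m\<in>{a..b}. \<bar>\<Sum>j\<in>{a<..m}. x j (\<omega> j)\<bar> \<ge> e)) \<le>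
    EE (Pi_pmf I d p) (\<lambda>\<omega>. (\<Sum>j\<in>{a<..b}. x j (\<omega> j)) ^ 4)"
proof -
  let ?E = "EE (Pi_pmf I d p)"
  define S where "S m \<omega> = (\<Sum>j\<in>{a<..m}. x j (\<omega> j))" for m and \<omega> :: "nat \<Rightarrow> bool"
  define A where "A m \<omega> \<longleftrightarrow> \<bar>S m \<omega>\<bar> \<ge> e \<and> (\<forall>m'\<in>{a..<m}. \<bar>S m' \<omega>\<bar> < e)" for m \<omega>
  have S_cong: "S m \<omega> = S m \<omega>'" if "\<And>i. i \<in> {a<..m} \<Longrightarrow> \<omega> i = \<omega>' i" for m \<omega> \<omega>'
    unfolding S_def using that by (intro sum.cong) auto
  have depA: "depends_on {a<..m} (\<lambda>\<omega>. of_bool (A m \<omega>) * S m \<omega> ^ 3)" for m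
    unfolding depends_on_def
  proof (intro allI impI)
    fix \<omega> \<omega>' :: "nat \<Rightarrow> bool" assume "\<forall>i\<in>{a<..m}. \<omega> i = \<omega>' i"
    then have "S m' \<omega> = S m' \<omega>'" if "m' \<le> m" for m' using that by (intro S_cong) auto
    then show "of_bool (A m \<omega>) * S m \<omega> ^ 3 = of_bool (A m \<omega>') * S m \<omega>' ^ 3" by (auto simp: A_def)
  qed
  \<comment> \<open>First exceedances at different indices exclude each other, so the indicator of
    any exceedance is a sum over \<open>m\<close>.\<close>
  have first: "of_bool (\<exists>m\<in>{a..b}. \<bar>S m \<omega>\<bar> \<ge> e) = (\<Sum>m\<in>{a..b}. of_bool (A m \<omega>) :: real)" for \<omega>
  proof (cases "\<exists>m\<in>{a..b}. \<bar>S m \<omega>\<bar> \<ge> e")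
    case True
    define P where "P m \<longleftrightarrow> m \<in> {a..b} \<and> \<bar>S m \<omega>\<bar> \<ge> e" for m
    obtain m where Pm: "P m" and min: "\<And>i. i < m \<Longrightarrow> \<not> P i"
      using True exists_least_iff[of P] by (auto simp: P_def)
    have m: "m \<in> {a..b} \<and> \<bar>S m \<omega>\<bar> \<ge> e" using Pm by (simp add: P_def)
    have least: "m \<le> m'" if "m' \<in> {a..b}" "\<bar>S m' \<omega>\<bar> \<ge> e" for m'
      using min[of m'] that by (auto simp: P_def not_less[symmetric])
    have iff: "A m' \<omega> \<longleftrightarrow> m' = m" if "m' \<in> {a..b}" for m'
    proof
      assume A': "A m' \<omega>"
      then have "m \<le> m'" using least that by (auto simp: A_def)
      moreover have "\<not> m < m'" using A' m unfolding A_def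
        by (metis atLeastAtMost_iff atLeastLessThan_iff not_less)
      ultimately show "m' = m" by simp
    next
      assume "m' = m"
      moreover have "\<bar>S i \<omega>\<bar> < e" if "i \<in> {a..<m}" for i
        using least[of i] that m by (cases "\<bar>S i \<omega>\<bar> \<ge> e") auto
      ultimately show "A m' \<omega>" using m by (auto simp: A_def)
    qed
    have "(\<Sum>m\<in>{a..b}. of_bool (A m \<omega>) :: real) = (\<Sum>m'\<in>{a..b}. if m' = m then 1 else 0)"
      using iff by (intro sum.cong) auto
    also have "\<dots> = 1" using m by (simp add: sum.delta)
    finally show ?thesis using True by simp
  next
    case False
    then show ?thesis by (auto simp: A_def intro!: sum.neutral[symmetric])
  qed
  have fs: "finite (set_pmf (Pi_pmf I d p))" by (rule finite_set_Pi_pmf_bool[OF fin])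
  have key: "e ^ 4 * ?E (\<lambda>\<omega>. of_bool (A m \<omega>)) \<le> ?E (\<lambda>\<omega>. of_bool (A m \<omega>) * S b \<omega> ^ 4)"
    if m: "m \<in> {a..b}" for m
  proof -
    define R where "R \<omega> = (\<Sum>j\<in>{m<..b}. x j (\<omega> j))" for \<omega> :: "nat \<Rightarrow> bool"
    have Sb: "S b \<omega> = S m \<omega> + R \<omega>" for \<omega>
    proof -
      have "{a<..b} = {a<..m} \<union> {m<..b}" using m by auto
      then show ?thesis by (simp add: S_def R_def sum.union_disjoint)
    qed
    have "?E R = 0"
      unfolding R_def using ab m by (intro centered_sum_mean[OF fin mean]) auto
    moreover have "?E (\<lambda>\<omega>. (of_bool (A m \<omega>) * S m \<omega> ^ 3) * R \<omega>) = ?E (\<lambda>\<omega>. of_bool (A m \<omega>) * S m \<omega> ^ 3) * ?E R"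
      unfolding R_def using ab m
      by (intro Pi_pmf_expectation_mult[OF fin depA, where B = "{m<..b}"] depends_on_sum) auto
    ultimately have zero: "?E (\<lambda>\<omega>. (of_bool (A m \<omega>) * S m \<omega> ^ 3) * R \<omega>) = 0" by simp
    have "e ^ 4 * ?E (\<lambda>\<omega>. of_bool (A m \<omega>)) = ?E (\<lambda>\<omega>. e ^ 4 * of_bool (A m \<omega>) + 4 * ((of_bool (A m \<omega>) * S m \<omega> ^ 3) * R \<omega>))"
      using zero by (simp add: EE_add[OF fs])
    also have "\<dots> \<le> ?E (\<lambda>\<omega>. of_bool (A m \<omega>) * S b \<omega> ^ 4)"
    proof (rule EE_mono[OF fs])
      fix \<omega>
      show "e ^ 4 * of_bool (A m \<omega>) + 4 * (of_bool (A m \<omega>) * S m \<omega> ^ 3 * R \<omega>) \<le> of_bool (A m \<omega>) * S b \<omega> ^ 4"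
      proof (cases "A m \<omega>")
        case True
        have "e ^ 4 \<le> \<bar>S m \<omega>\<bar> ^ 4" using True e by (intro power_mono) (auto simp: A_def)
        then have "e ^ 4 \<le> S m \<omega> ^ 4" by simp
        moreover have "S m \<omega> ^ 4 + 4 * (S m \<omega> ^ 3 * R \<omega>) \<le> (S m \<omega> + R \<omega>) ^ 4"
          by (rule power4_add_ge)
        ultimately show ?thesis using True by (simp add: Sb)
      qed simp
    qed
    finally show ?thesis .
  qed
  have "e ^ 4 * ?E (\<lambda>\<omega>. of_bool (\<exists>m\<in>{a..b}. \<bar>S m \<omega>\<bar> \<ge> e)) = (\<Sum>m\<in>{a..b}. e ^ 4 * ?E (\<lambda>\<omega>. of_bool (A m \<omega>)))"
    by (simp only: first EE_sum[OF fs] sum_distrib_left)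
  also have "\<dots> \<le> (\<Sum>m\<in>{a..b}. ?E (\<lambda>\<omega>. of_bool (A m \<omega>) * S b \<omega> ^ 4))"
    by (intro sum_mono key)
  also have "\<dots> = ?E (\<lambda>\<omega>. of_bool (\<exists>m\<in>{a..b}. \<bar>S m \<omega>\<bar> \<ge> e) * S b \<omega> ^ 4)"
    by (simp only: first EE_sum[OF fs] sum_distrib_right)
  also have "\<dots> \<le> ?E (\<lambda>\<omega>. S b \<omega> ^ 4)"
    by (intro EE_mono[OF fs]) auto
  finally show ?thesis by (simp add: S_def)
qed

section \<open>The Feller coupling\<close>

definition feller_prob :: "real \<Rightarrow> nat \<Rightarrow> real" where
  "feller_prob \<theta> i = \<theta> / (\<theta> + real i - 1)"

text \<open>The coupling cut down to the coordinates \<open>1..n\<close>, with \<open>False\<close>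
  elsewhere; the finite support makes every function integrable.\<close>

definition feller_pmf :: "real \<Rightarrow> nat \<Rightarrow> (nat \<Rightarrow> bool) pmf" where
  "feller_pmf \<theta> n = Pi_pmf {1..n} False (\<lambda>i. bernoulli_pmf (feller_prob \<theta> i))"

lemma measurable_PiM_finite_bool:
  assumes "finite I" "\<And>i. i \<in> I \<Longrightarrow> sets (M i) = UNIV" "f \<in> PiE I (\<lambda>_. UNIV :: bool set) \<rightarrow> space N"
  shows "f \<in> PiM I M \<rightarrow>\<^sub>M N"
proof -
  have sp: "space (PiM I M) = PiE I (\<lambda>_. UNIV :: bool set)"
    using assms(2) by (auto simp: space_PiM intro!: PiE_cong dest!: sets_eq_imp_space_eq[of _ "count_space UNIV", simplified])
  have "X \<in> sets (PiM I M)" if X: "X \<subseteq> PiE I (\<lambda>_. UNIV)" for X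
  proof -
    have "finite X" by (rule finite_subset[OF X]) (use assms(1) in \<open>auto intro: finite_PiE\<close>)
    moreover have "{x} \<in> sets (PiM I M)" if "x \<in> X" for x
    proof -
      have "{x} = PiE I (\<lambda>i. {x i})"
        using X that by (auto simp: PiE_iff fun_eq_iff extensional_def)
      also have "\<dots> \<in> sets (PiM I M)"
        using assms by (intro sets_PiM_I_finite) auto
      finally show ?thesis .
    qed
    ultimately have "(\<Union>x\<in>X. {x}) \<in> sets (PiM I M)" by (intro sets.finite_UN) auto
    then show ?thesis by simp
  qed
  then show ?thesis using assms(3) by (intro measurableI) (auto simp: sp)
qed

context
  fixes \<theta> :: real
  assumes \<theta>: "\<theta> > 0"
begin

lemma feller_prob_bounds: "i \<ge> 1 \<Longrightarrow> 0 \<le> feller_prob \<theta> i" "i \<ge> 1 \<Longrightarrow> feller_prob \<theta> i \<le> 1"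
  using \<theta> by (auto simp: feller_prob_def divide_simps)

lemma feller_prob_1 [simp]: "feller_prob \<theta> 1 = 1" "feller_prob \<theta> (Suc 0) = 1"
  using \<theta> by (auto simp: feller_prob_def)

lemma finite_feller_pmf: "finite (set_pmf (feller_pmf \<theta> n))"
  unfolding feller_pmf_def by (rule finite_set_Pi_pmf_bool) auto

lemma feller_pmf_first:
  assumes "n \<ge> 1" "\<xi> \<in> set_pmf (feller_pmf \<theta> n)"
  shows "\<xi> 1"
proof -
  have "\<xi> \<in> PiE_dflt {1..n} False (set_pmf \<circ> (\<lambda>i. bernoulli_pmf (feller_prob \<theta> i)))"
    using assms(2) unfolding feller_pmf_def by (simp add: set_Pi_pmf)
  then have "\<xi> 1 \<in> set_pmf (bernoulli_pmf (feller_prob \<theta> 1))"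
    using assms(1) by (auto simp: PiE_dflt_def)
  moreover have "set_pmf (bernoulli_pmf 1) = {True}"
    by (auto simp: set_pmf_iff pmf_bernoulli_True pmf_bernoulli_False) (metis (full_types) pmf_bernoulli_False diff_self zero_le_one order_refl)
  ultimately show ?thesis by simp
qed

text \<open>The bridge from the infinite product measure: restrict to \<open>{1..n}\<close>, then
  identify the finite product of Bernoulli measures by its values on boxes.\<close>

lemma feller_measure_expectation:
  fixes f :: "(nat \<Rightarrow> bool) \<Rightarrow> real"
  assumes dep: "depends_on {1..n} f"
  shows "integral\<^sup>L (feller_measure \<theta>) f = EE (feller_pmf \<theta> n) f"
proof -
  let ?I = "{1..n}"
  define M where "M i = measure_pmf (bernoulli_pmf (feller_prob \<theta> i))" for i
  interpret product_prob_space M "{1..}"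
    by (rule product_prob_spaceI) (simp add: M_def measure_pmf.prob_space_axioms)
  have fm: "feller_measure \<theta> = PiM {1..} M"
    by (simp add: feller_measure_def M_def[abs_def] feller_prob_def)
  have f_restrict: "f \<xi> = f (restrict \<xi> ?I)" for \<xi> by (rule depends_onD[OF dep]) simp
  have fmeas: "f \<in> borel_measurable (PiM ?I M)"
    by (rule measurable_PiM_finite_bool) (auto simp: M_def)
  have "integral\<^sup>L (feller_measure \<theta>) f = (\<integral>\<xi>. f (restrict \<xi> ?I) \<partial>PiM {1..} M)"
    using f_restrict by (simp add: fm)
  also have "\<dots> = integral\<^sup>L (distr (PiM {1..} M) (PiM ?I M) (\<lambda>x. restrict x ?I)) f"
    by (intro integral_distr[symmetric] fmeas measurable_restrict_subset) auto
  also have "distr (PiM {1..} M) (PiM ?I M) (\<lambda>x. restrict x ?I) = PiM ?I M"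
    by (rule distr_PiM_restrict_finite) auto
  \<comment> \<open>Samples of \<open>feller_pmf\<close> are \<open>False\<close> outside the index
    set whereas points of the product space are \<open>undefined\<close> there; hence the
    restriction map.\<close>
  also have "PiM ?I M = distr (measure_pmf (feller_pmf \<theta> n)) (PiM ?I M) (\<lambda>x. restrict x ?I)"
  proof (rule PiM_eqI[symmetric])
    fix X assume X: "\<And>i. i \<in> ?I \<Longrightarrow> X i \<in> sets (M i)"
    have "emeasure (distr (measure_pmf (feller_pmf \<theta> n)) (PiM ?I M) (\<lambda>x. restrict x ?I)) (PiE ?I X) =
        emeasure (feller_pmf \<theta> n) ((\<lambda>x. restrict x ?I) -` (PiE ?I X))"
      using X by (subst emeasure_distr) (auto simp: M_def space_PiM intro!: sets_PiM_I_finite)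
    also have "\<dots> = emeasure (feller_pmf \<theta> n) (PiE_dflt ?I False X)"
      by (rule emeasure_eq_AE) (auto simp: AE_measure_pmf_iff feller_pmf_def set_Pi_pmf PiE_dflt_def restrict_PiE_iff)
    also have "\<dots> = ennreal (\<Prod>i\<in>?I. measure (M i) (X i))"
      by (simp add: feller_pmf_def measure_pmf.emeasure_eq_measure measure_Pi_pmf_PiE_dflt M_def)
    also have "\<dots> = (\<Prod>i\<in>?I. emeasure (M i) (X i))"
      by (simp add: M_def measure_pmf.emeasure_eq_measure prod_ennreal)
    finally show "emeasure (distr (measure_pmf (feller_pmf \<theta> n)) (PiM ?I M) (\<lambda>x. restrict x ?I)) (PiE ?I X) =
      (\<Prod>i\<in>?I. emeasure (M i) (X i))" .
  qed auto
  also have "integral\<^sup>L (distr (measure_pmf (feller_pmf \<theta> n)) (PiM ?I M) (\<lambda>x. restrict x ?I)) f = EE (feller_pmf \<theta> n) (\<lambda>x. f (restrict x ?I))"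
    by (intro integral_distr fmeas) (auto simp: M_def space_PiM)
  also have "\<dots> = EE (feller_pmf \<theta> n) f" using f_restrict by simp
  finally show ?thesis .
qed

lemma feller_pmf_marginal:
  assumes "m \<le> n" "depends_on {1..m} f"
  shows "EE (feller_pmf \<theta> n) f = EE (feller_pmf \<theta> m) f"
  unfolding feller_pmf_def using assms by (intro Pi_pmf_marginal) auto

lemma feller_pmf_mult:
  assumes "depends_on A f" "depends_on B g" "A \<inter> B = {}" "A \<subseteq> {1..n}" "B \<subseteq> {1..n}"
  shows "EE (feller_pmf \<theta> n) (\<lambda>\<omega>. f \<omega> * g \<omega>) = EE (feller_pmf \<theta> n) f * EE (feller_pmf \<theta> n) g"
  unfolding feller_pmf_def using assms by (intro Pi_pmf_expectation_mult[where A = A and B = B]) auto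

lemma feller_pmf_single:
  assumes "i \<in> {1..n}"
  shows "EE (feller_pmf \<theta> n) (\<lambda>\<xi>. f (\<xi> i)) = feller_prob \<theta> i * f True + (1 - feller_prob \<theta> i) * f False"
proof -
  have "EE (feller_pmf \<theta> n) (\<lambda>\<xi>. f (\<xi> i)) = EE (map_pmf (\<lambda>\<xi>. \<xi> i) (feller_pmf \<theta> n)) f" by simp
  also have "map_pmf (\<lambda>\<xi>. \<xi> i) (feller_pmf \<theta> n) = bernoulli_pmf (feller_prob \<theta> i)"
    using assms by (simp add: feller_pmf_def Pi_pmf_component)
  finally show ?thesis using feller_prob_bounds[of i] assms by (simp add: mult.commute)
qed

lemma feller_pmf_prod:
  assumes "A \<subseteq> {1..n}"
  shows "EE (feller_pmf \<theta> n) (\<lambda>\<xi>. \<Prod>i\<in>A. g i (\<xi> i)) = (\<Prod>i\<in>A. EE (feller_pmf \<theta> n) (\<lambda>\<xi>. g i (\<xi> i)))"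
  using finite_subset[OF assms] assms
proof (induction A rule: infinite_finite_induct)
  case (insert i A)
  then have "EE (feller_pmf \<theta> n) (\<lambda>\<xi>. g i (\<xi> i) * (\<Prod>i\<in>A. g i (\<xi> i))) =
    EE (feller_pmf \<theta> n) (\<lambda>\<xi>. g i (\<xi> i)) * EE (feller_pmf \<theta> n) (\<lambda>\<xi>. \<Prod>i\<in>A. g i (\<xi> i))"
    by (intro feller_pmf_mult[of "{i}" _ A]) (auto simp: depends_on_def intro!: prod.cong)
  with insert show ?case by simp
qed auto

end

section \<open>Reading the partition off a binary sequence\<close>

definition gap :: "(nat \<Rightarrow> bool) \<Rightarrow> nat \<Rightarrow> nat \<Rightarrow> bool" where
  "gap \<xi> j i \<longleftrightarrow> \<xi> j \<and> \<xi> (j + i) \<and> (\<forall>k\<in>{j<..<j + i}. \<not> \<xi> k)"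

text \<open>For \<open>l \<le> n\<close>, a last one at \<open>l\<close> yields the part
  \<open>n - l + 1\<close>, closed by the artificial one at position \<open>n + 1\<close> and not by
  a one of the sequence.\<close>

definition last_one :: "(nat \<Rightarrow> bool) \<Rightarrow> nat \<Rightarrow> nat \<Rightarrow> bool" where
  "last_one \<xi> n l \<longleftrightarrow> \<xi> l \<and> (\<forall>k\<in>{l<..n}. \<not> \<xi> k)"

lemma feller_count_gap:
  assumes "1 \<le> i" "i \<le> n"
  shows "feller_count \<xi> n i = card {j\<in>{1..n - i}. gap \<xi> j i} + of_bool (last_one \<xi> n (n - i + 1))"
proof -
  have prod: "(\<Prod>k\<in>A. 1 - of_bool (P k)) = (of_bool (\<forall>k\<in>A. \<not> P k) :: nat)" if "finite A" for A and P :: "nat \<Rightarrow> bool"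
    using that by (induction A rule: finite_induct) auto
  have i1: "{j + 1..<i + j} = {j<..<j + i}" for j by auto
  have i2: "{n - i + 2..n} = {n - i + 1<..n}" by auto
  have "of_bool (\<xi> j) * (\<Prod>k=j + 1..<i + j. 1 - of_bool (\<xi> k)) * of_bool (\<xi> (i + j)) = (of_bool (gap \<xi> j i) :: nat)" for j
    unfolding i1 prod[OF finite_greaterThanLessThan] gap_def by (auto simp: add.commute of_bool_def)
  moreover have "of_bool (\<xi> (n - i + 1)) * (\<Prod>k=n - i + 2..n. 1 - of_bool (\<xi> k)) = (of_bool (last_one \<xi> n (n - i + 1)) :: nat)"
    unfolding i2 prod[OF finite_greaterThanAtMost] last_one_def by simp
  ultimately have "feller_count \<xi> n i = (\<Sum>j=1..n - i. of_bool (gap \<xi> j i)) + of_bool (last_one \<xi> n (n - i + 1))"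
    by (simp only: feller_count_def)
  also have "(\<Sum>j=1..n - i. of_bool (gap \<xi> j i)) = (\<Sum>j\<in>{j\<in>{1..n - i}. gap \<xi> j i}. 1 :: nat)"
    by (rule sum.mono_neutral_cong_right) auto
  also have "\<dots> = card {j\<in>{1..n - i}. gap \<xi> j i}" by simp
  finally show ?thesis .
qed

lemma last_one_unique: "last_one \<xi> n l \<Longrightarrow> last_one \<xi> n l' \<Longrightarrow> l \<le> n \<Longrightarrow> l' \<le> n \<Longrightarrow> l = l'"
  unfolding last_one_def by (metis greaterThanAtMost_iff linorder_neqE_nat)

lemma last_one_exists:
  assumes "\<xi> 1" "n \<ge> 1"
  obtains l where "l \<in> {1..n}" "last_one \<xi> n l"
proof -
  let ?S = "{l\<in>{1..n}. \<xi> l}"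
  have S: "finite ?S" "1 \<in> ?S" using assms by auto
  then have "Max ?S \<in> ?S" by (intro Max_in) auto
  moreover have "\<not> \<xi> k" if "k \<in> {Max ?S<..n}" for k
  proof
    assume "\<xi> k"
    then have "k \<in> ?S" using that by auto
    then have "k \<le> Max ?S" using S by (intro Max_ge) auto
    then show False using that by auto
  qed
  ultimately have "Max ?S \<in> {1..n}" "last_one \<xi> n (Max ?S)"
    unfolding last_one_def by blast+
  then show ?thesis by (rule that)
qed

text \<open>Once the last one at \<open>l\<close> has produced its part, it plays the role of the
  artificial closing one for the string of length \<open>l - 1\<close>. So exactly one part is split
  off and the rest is again an instance of the same construction.\<close>

lemma feller_count_last_one:
  assumes l: "l \<in> {1..n}" "last_one \<xi> n l" and i: "i \<in> {1..n}"
  shows "feller_count \<xi> n i = (if i \<le> l - 1 then feller_count \<xi> (l - 1) i else 0) + of_bool (i = n - l + 1)"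
proof -
  have tail: "last_one \<xi> n (n - i + 1) \<longleftrightarrow> i = n - l + 1"
    using last_one_unique[OF l(2), of "n - i + 1"] l i by auto
  have le: "j + i \<le> l" if "gap \<xi> j i" "j + i \<le> n" for j
    using that l unfolding gap_def last_one_def by (meson greaterThanAtMost_iff not_le)
  show ?thesis
  proof (cases "i \<le> l - 1")
    case True
    \<comment> \<open>A gap ending exactly at \<open>l\<close> is complete in the long string, but
      it is the artificially closed part of the string of length \<open>l - 1\<close>.\<close>
    have "{j\<in>{1..n - i}. gap \<xi> j i} = {j\<in>{1..l - 1 - i}. gap \<xi> j i} \<union> (if gap \<xi> (l - i) i then {l - i} else {})"
    proof (intro set_eqI iffI)
      fix j assume j: "j \<in> {j\<in>{1..n - i}. gap \<xi> j i}"
      then have "j + i \<le> l" using le[of j] i by auto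
      then have "j = l - i \<or> j \<le> l - 1 - i" by linarith
      then show "j \<in> {j\<in>{1..l - 1 - i}. gap \<xi> j i} \<union> (if gap \<xi> (l - i) i then {l - i} else {})"
        using j by auto
    next
      fix j assume j: "j \<in> {j\<in>{1..l - 1 - i}. gap \<xi> j i} \<union> (if gap \<xi> (l - i) i then {l - i} else {})"
      have "l - i \<ge> 1" "l - i \<le> n - i" "l - 1 - i \<le> n - i" using True l by auto
      then show "j \<in> {j\<in>{1..n - i}. gap \<xi> j i}" using j by (auto split: if_splits)
    qed
    moreover have "gap \<xi> (l - i) i \<longleftrightarrow> last_one \<xi> (l - 1) (l - 1 - i + 1)"
    proof -
      have e: "l - 1 - i + 1 = l - i" "l - i + i = l" "{l - i<..<l} = {l - i<..l - 1}"
        using True l i by auto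
      have "\<xi> l" using l by (simp add: last_one_def)
      then show ?thesis unfolding gap_def last_one_def e by simp
    qed
    ultimately have "card {j\<in>{1..n - i}. gap \<xi> j i} = feller_count \<xi> (l - 1) i"
      using True i by (auto simp: feller_count_gap card_insert_if)
    then show ?thesis using i True tail by (simp add: feller_count_gap)
  next
    case False
    then have "{j\<in>{1..n - i}. gap \<xi> j i} = {}" using le i l by fastforce
    then show ?thesis using i False tail by (simp add: feller_count_gap)
  qed
qed

lemma feller_partition_last_one:
  assumes l: "l \<in> {1..n}" "last_one \<xi> n l"
  shows "feller_partition n n \<xi> = (\<lambda>i. feller_partition (l - 1) (l - 1) \<xi> i + of_bool (i = n - l + 1))"
  using feller_count_last_one[OF l] l by (auto simp: feller_partition_def fun_eq_iff)

text \<open>Strong induction along the last one: the part \<open>n - l + 1\<close> is added to a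
  partition of \<open>l - 1\<close>.\<close>

lemma feller_partition_in_partitions:
  assumes "n \<ge> 1 \<Longrightarrow> \<xi> 1"
  shows "feller_partition n n \<xi> \<in> partitions n"
  using assms
proof (induction n rule: less_induct)
  case (less n)
  show ?case
  proof (cases "n = 0")
    case False
    then have "\<xi> 1" using less by simp
    with False obtain l where l: "l \<in> {1..n}" "last_one \<xi> n l" using last_one_exists[of \<xi> n] by auto
    let ?p = "feller_partition (l - 1) (l - 1) \<xi>"
    have p: "?p \<in> partitions (l - 1)" using less.IH[of "l - 1"] l \<open>\<xi> 1\<close> by auto
    have "(\<Sum>i=1..n. i * ?p i) = (\<Sum>i=1..l - 1. i * ?p i)"
      using l by (intro sum.mono_neutral_right) (auto simp: feller_partition_def)
    also have "\<dots> = l - 1" using p by (simp add: partitions_def)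
    finally have "(\<Sum>i=1..n. i * (?p i + of_bool (i = n - l + 1))) = (l - 1) + (\<Sum>i=1..n. i * of_bool (i = n - l + 1))"
      by (simp add: distrib_left sum.distrib)
    also have "(\<Sum>i=1..n. i * of_bool (i = n - l + 1)) = (\<Sum>i=1..n. if i = n - l + 1 then i else 0)"
      by (intro sum.cong) auto
    also have "\<dots> = n - l + 1" using l by (subst sum.delta) auto
    finally have "(\<Sum>i=1..n. i * (?p i + of_bool (i = n - l + 1))) = n" using l by simp
    then show ?thesis
      unfolding feller_partition_last_one[OF l] using l by (auto simp: partitions_def feller_partition_def)
  qed (simp add: partitions_def feller_partition_def)
qed

section \<open>The Ewens sampling formula from the Feller coupling\<close>

lemma feller_count_depends: "i \<in> {1..n} \<Longrightarrow> (\<And>k. k \<in> {1..n} \<Longrightarrow> \<xi> k = \<xi>' k) \<Longrightarrow> feller_count \<xi> n i = feller_count \<xi>' n i"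
proof -
  assume i: "i \<in> {1..n}" and eq: "\<And>k. k \<in> {1..n} \<Longrightarrow> \<xi> k = \<xi>' k"
  have "gap \<xi> j i = gap \<xi>' j i" if "j \<in> {1..n - i}" for j
  proof -
    have "\<xi> k = \<xi>' k" if "j \<le> k" "k \<le> j + i" for k
      using that i \<open>j \<in> {1..n - i}\<close> by (intro eq) auto
    then show ?thesis by (auto simp: gap_def)
  qed
  then have "{j\<in>{1..n - i}. gap \<xi> j i} = {j\<in>{1..n - i}. gap \<xi>' j i}" by auto
  moreover have "last_one \<xi> n (n - i + 1) = last_one \<xi>' n (n - i + 1)"
    using i eq by (auto simp: last_one_def)
  ultimately show ?thesis using i by (simp add: feller_count_gap)
qed

lemma depends_on_feller_partition: "depends_on {1..n} (\<lambda>\<xi>. h (feller_partition n n \<xi>))"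
proof -
  have "feller_partition n n \<xi> = feller_partition n n \<xi>'" if "\<forall>i\<in>{1..n}. \<xi> i = \<xi>' i" for \<xi> \<xi>'
    using feller_count_depends[of _ n \<xi> \<xi>'] that by (auto simp: feller_partition_def fun_eq_iff)
  then show ?thesis unfolding depends_on_def by metis
qed

lemma remove_part_partition:
  assumes "\<alpha> \<in> partitions n" "a \<in> {1..n}" "\<alpha> a \<ge> 1"
  shows "\<alpha>(a := \<alpha> a - 1) \<in> partitions (n - a)"
proof -
  define \<beta> where "\<beta> = \<alpha>(a := \<alpha> a - 1)"
  have sum: "(\<Sum>i=1..n. i * \<beta> i) = n - a"
  proof -
    have "(\<Sum>i=1..n. i * \<alpha> i) = a * \<alpha> a + (\<Sum>i\<in>{1..n} - {a}. i * \<alpha> i)"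
      using assms by (subst sum.remove[of _ a]) auto
    moreover have "(\<Sum>i=1..n. i * \<beta> i) = a * (\<alpha> a - 1) + (\<Sum>i\<in>{1..n} - {a}. i * \<alpha> i)"
      using assms by (subst sum.remove[of _ a]) (auto simp: \<beta>_def)
    moreover have "a * \<alpha> a = a * (\<alpha> a - 1) + a" using assms(3) by (cases "\<alpha> a") auto
    moreover have "(\<Sum>i=1..n. i * \<alpha> i) = n" using assms(1) by (simp add: partitions_def)
    ultimately show ?thesis by linarith
  qed
  \<comment> \<open>A remaining part larger than \<open>n - a\<close> would by itself exceed the
    remaining total.\<close>
  have zero: "\<beta> i = 0" if "i > n - a" for i
  proof (cases "i \<in> {1..n}")
    case True
    have "i * \<beta> i \<le> (\<Sum>i=1..n. i * \<beta> i)" using True by (intro member_le_sum) auto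
    then have "i * \<beta> i \<le> n - a" by (simp only: sum)
    then have "i * \<beta> i < i * 1" using that by linarith
    then have "\<beta> i < 1" by (metis mult_less_cancel1)
    then show ?thesis by (simp only: less_one)
  next
    case False
    then show ?thesis using assms by (auto simp: partitions_def \<beta>_def)
  qed
  have "(\<Sum>i=1..n - a. i * \<beta> i) = (\<Sum>i=1..n. i * \<beta> i)"
    using zero by (intro sum.mono_neutral_left) auto
  moreover have "\<beta> 0 = 0" using assms by (auto simp: partitions_def \<beta>_def)
  then have "\<beta> i = 0" if "i \<notin> {1..n - a}" for i
    using zero[of i] that by (cases "i = 0") auto
  ultimately have "\<beta> \<in> partitions (n - a)" using sum by (simp add: partitions_def)
  then show ?thesis by (simp add: \<beta>_def)
qed

text \<open>Only the factor at \<open>a\<close> changes, by the ratio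
  \<open>\<theta> / (a * \<alpha> a)\<close>. The resulting \<open>a * \<alpha> a\<close> is what
  gets summed over \<open>a\<close> in the recursion for the sampling formula.\<close>

lemma ewens_weight_remove_part:
  assumes \<theta>: "\<theta> > 0" and \<alpha>: "\<alpha> \<in> partitions n" "a \<in> {1..n}" "\<alpha> a \<ge> 1"
  shows "\<theta> * ewens_weight \<theta> (n - a) (\<alpha>(a := \<alpha> a - 1)) = ewens_weight \<theta> n \<alpha> * (real a * real (\<alpha> a))"
proof -
  let ?\<beta> = "\<alpha>(a := \<alpha> a - 1)"
  define w where "w \<alpha> i = \<theta> ^ \<alpha> i / (real i ^ \<alpha> i * fact (\<alpha> i))" for \<alpha> :: "nat \<Rightarrow> nat" and i
  have \<beta>: "?\<beta> \<in> partitions (n - a)" by (rule remove_part_partition[OF \<alpha>])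
  have "ewens_weight \<theta> (n - a) ?\<beta> = (\<Prod>i=1..n. w ?\<beta> i)"
    unfolding ewens_weight_def w_def using \<beta> by (intro prod.mono_neutral_left) (auto simp: partitions_def)
  also have "\<dots> = w ?\<beta> a * (\<Prod>i\<in>{1..n} - {a}. w ?\<beta> i)" using \<alpha> by (intro prod.remove) auto
  also have "(\<Prod>i\<in>{1..n} - {a}. w ?\<beta> i) = (\<Prod>i\<in>{1..n} - {a}. w \<alpha> i)"
    by (intro prod.cong) (auto simp: w_def)
  finally have 1: "ewens_weight \<theta> (n - a) ?\<beta> = w ?\<beta> a * (\<Prod>i\<in>{1..n} - {a}. w \<alpha> i)" .
  have 2: "ewens_weight \<theta> n \<alpha> = w \<alpha> a * (\<Prod>i\<in>{1..n} - {a}. w \<alpha> i)"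
    unfolding ewens_weight_def w_def[symmetric] using \<alpha> by (intro prod.remove) auto
  obtain k where k: "\<alpha> a = Suc k" using \<alpha>(3) by (cases "\<alpha> a") auto
  have "\<theta> * w ?\<beta> a = w \<alpha> a * (real a * real (\<alpha> a))"
  proof -
    have nz: "real a \<noteq> 0" "real (Suc k) \<noteq> 0" using \<alpha>(2) by auto
    have "w \<alpha> a = \<theta> * \<theta> ^ k / (real a * real a ^ k * (real (Suc k) * fact k))"
      by (simp only: w_def k power_Suc fact_Suc)
    also have "\<dots> * (real a * real (\<alpha> a)) = \<theta> * (\<theta> ^ k / (real a ^ k * fact k))"
      unfolding k using nz by (simp add: divide_simps del: of_nat_Suc)
    finally show ?thesis by (simp add: w_def k)
  qed
  then show ?thesis unfolding 1 2 by (simp add: algebra_simps)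
qed

context
  fixes \<theta> :: real
  assumes \<theta>: "\<theta> > 0"
begin

text \<open>Since \<open>1 - feller_prob \<theta> k = (k - 1) / (\<theta> + k - 1)\<close>, the
  product over the zeros after \<open>l\<close> collapses into factorials and rising
  factorials.\<close>

lemma prob_last_one:
  assumes "l \<in> {1..n}"
  shows "EE (feller_pmf \<theta> n) (\<lambda>\<xi>. of_bool (last_one \<xi> n l)) =
    \<theta> * fact (n - 1) / fact (l - 1) * pochhammer \<theta> (l - 1) / pochhammer \<theta> n"
proof -
  let ?g = "\<lambda>i (b::bool). if i = l then of_bool b else of_bool (\<not> b) :: real"
  have prod: "(\<Prod>k\<in>A. of_bool (P k)) = (of_bool (\<forall>k\<in>A. P k) :: real)" if "finite A" for A and P :: "nat \<Rightarrow> bool"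
    using that by (induction A rule: finite_induct) auto
  have "(of_bool (last_one \<xi> n l) :: real) = (\<Prod>i\<in>{l..n}. ?g i (\<xi> i))" for \<xi>
  proof -
    have "(\<Prod>i\<in>{l..n}. ?g i (\<xi> i)) = of_bool (\<xi> l) * (\<Prod>i\<in>{l<..n}. ?g i (\<xi> i))"
    proof -
      have "{l..n} = insert l {l<..n}" using assms by auto
      then show ?thesis by simp
    qed
    also have "(\<Prod>i\<in>{l<..n}. ?g i (\<xi> i)) = (\<Prod>i\<in>{l<..n}. of_bool (\<not> \<xi> i))"
      by (intro prod.cong) auto
    also have "of_bool (\<xi> l) * \<dots> = of_bool (last_one \<xi> n l)"
      by (simp add: prod last_one_def)
    finally show ?thesis ..
  qed
  then have "EE (feller_pmf \<theta> n) (\<lambda>\<xi>. of_bool (last_one \<xi> n l)) = EE (feller_pmf \<theta> n) (\<lambda>\<xi>. \<Prod>i\<in>{l..n}. ?g i (\<xi> i))"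
    by (simp only:)
  also have "\<dots> = (\<Prod>i\<in>{l..n}. EE (feller_pmf \<theta> n) (\<lambda>\<xi>. ?g i (\<xi> i)))"
    using assms by (intro feller_pmf_prod[OF \<theta>]) auto
  also have "\<dots> = (\<Prod>i\<in>{l..n}. if i = l then feller_prob \<theta> i else 1 - feller_prob \<theta> i)"
    using assms by (intro prod.cong refl) (subst feller_pmf_single[OF \<theta>], auto)
  also have "\<dots> = \<theta> * fact (n - 1) / fact (l - 1) * pochhammer \<theta> (l - 1) / pochhammer \<theta> n"
  proof -
    have pp: "pochhammer \<theta> k > 0" for k using \<theta> by (intro pochhammer_pos)
    have "(\<Prod>i\<in>{l..l + k}. if i = l then feller_prob \<theta> i else 1 - feller_prob \<theta> i) =
        \<theta> * fact (l + k - 1) / fact (l - 1) * pochhammer \<theta> (l - 1) / pochhammer \<theta> (l + k)" for k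
    proof (induction k)
      case 0
      have "pochhammer \<theta> l = pochhammer \<theta> (l - 1) * (\<theta> + real l - 1)"
        using assms pochhammer_rec'[of \<theta> "l - 1"] by (simp add: of_nat_diff algebra_simps)
      then show ?case using assms \<theta> pp[of "l - 1"] pp[of l] by (simp add: feller_prob_def)
    next
      case (Suc k)
      have f: "fact (l + k) = real (l + k) * fact (l + k - 1)"
        using assms by (subst fact_reduce) auto
      have "(\<Prod>i\<in>{l..l + Suc k}. if i = l then feller_prob \<theta> i else 1 - feller_prob \<theta> i) =
        (\<Prod>i\<in>{l..l + k}. if i = l then feller_prob \<theta> i else 1 - feller_prob \<theta> i) * (1 - feller_prob \<theta> (l + Suc k))"
        by simp
      also have "1 - feller_prob \<theta> (l + Suc k) = real (l + k) / (\<theta> + real (l + k))"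
        using \<theta> assms by (simp add: feller_prob_def field_simps)
      finally show ?case
        unfolding Suc.IH using \<theta> pp[of "l + k"] f by (simp add: pochhammer_rec' field_simps)
    qed
    from this[of "n - l"] show ?thesis using assms by simp
  qed
  finally show ?thesis .
qed

text \<open>Conditioning on the position of the last one removes one part \<open>a\<close>; the recursion closes because
  \<open>\<Sum> a \<alpha>\<^sub>a = n\<close>.\<close>

theorem feller_partition_law:
  assumes "\<alpha> \<in> partitions n"
  shows "EE (feller_pmf \<theta> n) (\<lambda>\<xi>. of_bool (feller_partition n n \<xi> = \<alpha>)) = fact n / pochhammer \<theta> n * ewens_weight \<theta> n \<alpha>"
  using assms
proof (induction n arbitrary: \<alpha> rule: less_induct)
  case (less n)
  show ?case
  proof (cases "n = 0")
    case True
    then have "\<alpha> = (\<lambda>_. 0)" using less.prems by (auto simp: partitions_def)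
    then show ?thesis using True by (simp add: feller_partition_def ewens_weight_def)
  next
    case False
    have pp: "pochhammer \<theta> k > 0" for k using \<theta> by (intro pochhammer_pos)
    let ?E = "EE (feller_pmf \<theta> n)"
    \<comment> \<open>The guard \<open>\<alpha> a \<ge> 1\<close> matters: subtraction is truncated,
      so without it the update at \<open>a\<close> would return \<alpha> itself when
      \<open>a\<close> is not a part.\<close>
    define R where "R a \<xi> \<longleftrightarrow> \<alpha> a \<ge> 1 \<and> feller_partition (n - a) (n - a) \<xi> = \<alpha>(a := \<alpha> a - 1)" for a \<xi>
    have split: "of_bool (feller_partition n n \<xi> = \<alpha>) = (\<Sum>a=1..n. of_bool (last_one \<xi> n (n - a + 1)) * of_bool (R a \<xi>) :: real)"
      if "\<xi> \<in> set_pmf (feller_pmf \<theta> n)" for \<xi>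
    proof -
      have "\<xi> 1" using feller_pmf_first[OF \<theta> _ that] False by simp
      then obtain l where l: "l \<in> {1..n}" "last_one \<xi> n l" using last_one_exists[of \<xi> n] False by auto
      define a where "a = n - l + 1"
      have a: "a \<in> {1..n}" "n - a + 1 = l" "n - a = l - 1" using l by (auto simp: a_def)
      have "(\<Sum>a=1..n. of_bool (last_one \<xi> n (n - a + 1)) * of_bool (R a \<xi>) :: real) =
         (\<Sum>a'=1..n. if a' = a then of_bool (R a \<xi>) else 0)"
      proof (intro sum.cong refl)
        fix a' assume "a' \<in> {1..n}"
        then have "last_one \<xi> n (n - a' + 1) \<longleftrightarrow> a' = a"
          using last_one_unique[OF l(2), of "n - a' + 1"] l a by auto
        then show "of_bool (last_one \<xi> n (n - a' + 1)) * of_bool (R a' \<xi>) = (if a' = a then of_bool (R a \<xi>) else (0::real))"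
          by auto
      qed
      also have "\<dots> = of_bool (R a \<xi>)" using a by (simp add: sum.delta)
      also have "R a \<xi> \<longleftrightarrow> feller_partition n n \<xi> = \<alpha>"
        unfolding R_def a(3) feller_partition_last_one[OF l] a_def[symmetric]
        by (auto simp: fun_eq_iff split: if_splits)
      finally show ?thesis ..
    qed
    have "?E (\<lambda>\<xi>. of_bool (feller_partition n n \<xi> = \<alpha>)) =
       ?E (\<lambda>\<xi>. \<Sum>a=1..n. of_bool (last_one \<xi> n (n - a + 1)) * of_bool (R a \<xi>))"
      by (rule EE_cong) (rule split)
    also have "\<dots> = (\<Sum>a=1..n. ?E (\<lambda>\<xi>. of_bool (last_one \<xi> n (n - a + 1)) * of_bool (R a \<xi>)))"
      by (rule EE_sum[OF finite_feller_pmf[OF \<theta>]])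
    also have "\<dots> = (\<Sum>a=1..n. fact (n - 1) / pochhammer \<theta> n * ewens_weight \<theta> n \<alpha> * (real a * real (\<alpha> a)))"
    proof (intro sum.cong refl)
      fix a assume a: "a \<in> {1..n}"
      show "?E (\<lambda>\<xi>. of_bool (last_one \<xi> n (n - a + 1)) * of_bool (R a \<xi>)) =
          fact (n - 1) / pochhammer \<theta> n * ewens_weight \<theta> n \<alpha> * (real a * real (\<alpha> a))"
      proof (cases "\<alpha> a \<ge> 1")
        case True
        let ?\<beta> = "\<alpha>(a := \<alpha> a - 1)"
        have \<beta>: "?\<beta> \<in> partitions (n - a)" using remove_part_partition[OF less.prems a True] .
        have depl: "depends_on {n - a + 1..n} (\<lambda>\<xi>. of_bool (last_one \<xi> n (n - a + 1)) :: real)"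
          using a by (auto simp: depends_on_def last_one_def)
        have "?E (\<lambda>\<xi>. of_bool (last_one \<xi> n (n - a + 1)) * of_bool (R a \<xi>)) =
          ?E (\<lambda>\<xi>. of_bool (last_one \<xi> n (n - a + 1)) * of_bool (feller_partition (n - a) (n - a) \<xi> = ?\<beta>))"
          using True by (simp add: R_def)
        \<comment> \<open>The last one at \<open>n - a + 1\<close> is decided by coordinates from
          there on, the rest of the partition by those up to \<open>n - a\<close>.\<close>
        also have "\<dots> = ?E (\<lambda>\<xi>. of_bool (last_one \<xi> n (n - a + 1))) * ?E (\<lambda>\<xi>. of_bool (feller_partition (n - a) (n - a) \<xi> = ?\<beta>))"
          by (rule feller_pmf_mult[OF \<theta> depl depends_on_feller_partition]) (use a in auto)
        also have "?E (\<lambda>\<xi>. of_bool (feller_partition (n - a) (n - a) \<xi> = ?\<beta>)) =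
           EE (feller_pmf \<theta> (n - a)) (\<lambda>\<xi>. of_bool (feller_partition (n - a) (n - a) \<xi> = ?\<beta>))"
          by (rule feller_pmf_marginal[OF \<theta> _ depends_on_feller_partition]) auto
        also have "\<dots> = fact (n - a) / pochhammer \<theta> (n - a) * ewens_weight \<theta> (n - a) ?\<beta>"
          using a by (intro less.IH \<beta>) auto
        also have "?E (\<lambda>\<xi>. of_bool (last_one \<xi> n (n - a + 1))) = \<theta> * fact (n - 1) / fact (n - a) * pochhammer \<theta> (n - a) / pochhammer \<theta> n"
        proof -
          have "n - a + 1 \<in> {1..n}" using a by auto
          from prob_last_one[OF this] show ?thesis by simp
        qed
        also have "\<dots> * (fact (n - a) / pochhammer \<theta> (n - a) * ewens_weight \<theta> (n - a) ?\<beta>) =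
            fact (n - 1) / pochhammer \<theta> n * (\<theta> * ewens_weight \<theta> (n - a) ?\<beta>)"
          using pp[of "n - a"] by (simp add: field_simps)
        also have "\<dots> = fact (n - 1) / pochhammer \<theta> n * (ewens_weight \<theta> n \<alpha> * (real a * real (\<alpha> a)))"
          unfolding ewens_weight_remove_part[OF \<theta> less.prems a True] ..
        finally show ?thesis by simp
      next
        case False
        then show ?thesis by (simp add: R_def)
      qed
    qed
    also have "\<dots> = fact (n - 1) / pochhammer \<theta> n * ewens_weight \<theta> n \<alpha> * real (\<Sum>a=1..n. a * \<alpha> a)"
      by (simp add: sum_distrib_left)
    also have "(\<Sum>a=1..n. a * \<alpha> a) = n" using less.prems by (simp add: partitions_def)
    also have "fact (n - 1) / pochhammer \<theta> n * ewens_weight \<theta> n \<alpha> * real n = fact n / pochhammer \<theta> n * ewens_weight \<theta> n \<alpha>"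
      using False by (subst (2) fact_reduce) auto
    finally show ?thesis .
  qed
qed

lemma feller_partition_expectation:
  "EE (feller_pmf \<theta> n) (\<lambda>\<xi>. h (feller_partition n n \<xi>)) =
     fact n / pochhammer \<theta> n * (\<Sum>\<alpha>\<in>partitions n. h \<alpha> * ewens_weight \<theta> n \<alpha>)"
proof -
  have "EE (feller_pmf \<theta> n) (\<lambda>\<xi>. h (feller_partition n n \<xi>)) =
      EE (feller_pmf \<theta> n) (\<lambda>\<xi>. \<Sum>\<alpha>\<in>partitions n. h \<alpha> * of_bool (feller_partition n n \<xi> = \<alpha>))"
  proof (rule EE_cong)
    fix \<xi> assume \<xi>: "\<xi> \<in> set_pmf (feller_pmf \<theta> n)"
    have "feller_partition n n \<xi> \<in> partitions n"
      by (rule feller_partition_in_partitions) (rule feller_pmf_first[OF \<theta> _ \<xi>])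
    then show "h (feller_partition n n \<xi>) = (\<Sum>\<alpha>\<in>partitions n. h \<alpha> * of_bool (feller_partition n n \<xi> = \<alpha>))"
      using finite_partitions by (simp add: of_bool_def if_distrib sum.delta' cong: if_cong)
  qed
  also have "\<dots> = (\<Sum>\<alpha>\<in>partitions n. h \<alpha> * EE (feller_pmf \<theta> n) (\<lambda>\<xi>. of_bool (feller_partition n n \<xi> = \<alpha>)))"
    by (simp add: EE_sum[OF finite_feller_pmf[OF \<theta>]])
  also have "\<dots> = (\<Sum>\<alpha>\<in>partitions n. h \<alpha> * (fact n / pochhammer \<theta> n * ewens_weight \<theta> n \<alpha>))"
    by (intro sum.cong refl) (simp add: feller_partition_law)
  finally show ?thesis by (simp add: sum_distrib_left mult_ac)
qed

text \<open>The factor \<open>fact n / pochhammer \<theta> n\<close> is common to numerator and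
  denominator and cancels; up to it, \<open>ewens_Z\<close> is the mean of the density along the
  coupling.\<close>

lemma perturbed_ewens_expectation:
  fixes G :: "(nat \<Rightarrow> nat) \<Rightarrow> real"
  assumes \<eta>: "\<And>\<alpha>. \<alpha> \<in> partitions n \<Longrightarrow> 0 \<le> \<eta> \<alpha>" and Z: "ewens_Z \<theta> \<eta> n > 0"
  shows "integral\<^sup>L (perturbed_ewens \<theta> \<eta> n) G =
    EE (feller_pmf \<theta> n) (\<lambda>\<xi>. \<eta> (feller_partition n n \<xi>) * G (feller_partition n n \<xi>)) /
    EE (feller_pmf \<theta> n) (\<lambda>\<xi>. \<eta> (feller_partition n n \<xi>))"
proof -
  have w: "ewens_weight \<theta> n \<alpha> \<ge> 0" for \<alpha>
    using \<theta> unfolding ewens_weight_def by (intro prod_nonneg) auto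
  have c: "fact n / pochhammer \<theta> n > 0" using \<theta> by (intro divide_pos_pos pochhammer_pos) auto
  have "integral\<^sup>L (perturbed_ewens \<theta> \<eta> n) G = (\<Sum>\<alpha>\<in>partitions n. \<eta> \<alpha> / ewens_Z \<theta> \<eta> n * ewens_weight \<theta> n \<alpha> * G \<alpha>)"
    unfolding perturbed_ewens_def using \<eta> Z w
    by (subst lebesgue_integral_point_measure_finite) (auto simp: finite_partitions)
  also have "\<dots> = (\<Sum>\<alpha>\<in>partitions n. \<eta> \<alpha> * G \<alpha> * ewens_weight \<theta> n \<alpha>) / (\<Sum>\<alpha>\<in>partitions n. \<eta> \<alpha> * ewens_weight \<theta> n \<alpha>)"
    by (simp add: ewens_Z_def sum_divide_distrib mult_ac)
  finally show ?thesis
    using c feller_partition_expectation[of n "\<lambda>\<alpha>. \<eta> \<alpha> * G \<alpha>"] feller_partition_expectation[of n \<eta>]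
      pochhammer_pos[OF \<theta>, of n] by simp
qed

end

section \<open>Logarithmic sums\<close>

lemma power_Suc_diff_le:
  fixes a b :: real
  assumes "0 \<le> b" "b \<le> a"
  shows "a ^ Suc n - b ^ Suc n \<le> real (Suc n) * (a - b) * a ^ n"
proof (induction n)
  case (Suc n)
  have "a ^ Suc (Suc n) - b ^ Suc (Suc n) = a * (a ^ Suc n - b ^ Suc n) + (a - b) * b ^ Suc n"
    by (simp add: algebra_simps)
  also have "\<dots> \<le> a * (real (Suc n) * (a - b) * a ^ n) + (a - b) * a ^ Suc n"
    using assms by (intro add_mono mult_left_mono Suc power_mono) auto
  also have "\<dots> = real (Suc (Suc n)) * (a - b) * a ^ Suc n" by (simp add: algebra_simps)
  finally show ?case .
qed simp

text \<open>Sum against integral one step at a time, with the mean value theorem for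
  \<open>ln x ^ Suc r\<close>. The bound is shaped so that the induction closes:
  \<open>1 - 1 / m\<close> grows by \<open>1 / M - 1 / (M + 1)\<close>, which dominates the
  \<open>1 / (M + 1)^2\<close> error of \<open>q\<close>, and the last term absorbs
  \<open>\<theta> * (l' ^ r - l ^ r)\<close>.\<close>

lemma sum_log_power_nat:
  fixes q :: "nat \<Rightarrow> real"
  assumes q: "\<And>j. j \<ge> 1 \<Longrightarrow> \<bar>q j - \<theta> / real j\<bar> \<le> c / (real j)\<^sup>2" and \<theta>: "\<theta> \<ge> 0" and c: "c \<ge> 0" and m: "m \<ge> 1"
  shows "\<bar>(\<Sum>j=1..m. q j * ln (real j) ^ r) - \<theta> / real (Suc r) * ln (real m) ^ Suc r\<bar> \<le>
    (\<theta> + c) * (1 + (1 - 1 / real m) * ln (real m) ^ r) + \<theta> * ln (real m) ^ r"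
  using m
proof (induction m rule: nat_induct_at_least)
  case base
  have "\<bar>q 1\<bar> \<le> \<theta> + c" using q[of 1] \<theta> c by (auto simp: abs_le_iff)
  then show ?case using \<theta> c by (cases r) auto
next
  case (Suc m)
  define l where "l = ln (real m)"
  define l' where "l' = ln (real (Suc m))"
  have l: "0 \<le> l" "l \<le> l'" using Suc by (auto simp: l_def l'_def)
  define M where "M = real m"
  have M: "M \<ge> 1" "real (Suc m) = M + 1" using Suc by (auto simp: M_def)
  have lM: "l = ln M" "l' = ln (M + 1)" using M by (auto simp: l_def l'_def M_def)
  have deriv: "((\<lambda>x. ln x ^ Suc r) has_real_derivative real (Suc r) * ln x ^ r * (1 / x)) (at x)" if "x > 0" for x :: real
    using DERIV_power_Suc[OF DERIV_ln_divide[OF that], of r] by (simp add: mult_ac)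
  have "\<exists>z>M. z < M + 1 \<and> ln (M + 1) ^ Suc r - ln M ^ Suc r = (M + 1 - M) * (real (Suc r) * ln z ^ r * (1 / z))"
    by (rule MVT2) (use M in simp, rule deriv, use M in linarith)
  then obtain z where z: "M < z" "z < M + 1" "l' ^ Suc r - l ^ Suc r = real (Suc r) * (ln z ^ r / z)"
    unfolding lM by auto
  have lz: "l \<le> ln z" "ln z \<le> l'" using z M by (auto simp: lM)
  have up: "ln z ^ r / z \<le> l' ^ r / M" "l' ^ r / (M + 1) \<le> l' ^ r / M"
    using z M l lz by (auto intro!: frac_le power_mono)
  have low: "l ^ r / (M + 1) \<le> ln z ^ r / z" "l ^ r / (M + 1) \<le> l' ^ r / (M + 1)"
    using z M l lz by (auto intro!: frac_le power_mono divide_right_mono)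
  have "\<bar>l' ^ r / (M + 1) - ln z ^ r / z\<bar> \<le> l' ^ r / M - l ^ r / (M + 1)"
    using up low by linarith
  also have "\<dots> = l' ^ r * (1 / M - 1 / (M + 1)) + (l' ^ r - l ^ r) / (M + 1)"
    by (simp add: right_diff_distrib diff_divide_distrib)
  also have "\<dots> \<le> l' ^ r * (1 / M - 1 / (M + 1)) + (l' ^ r - l ^ r)"
  proof -
    have "(l' ^ r - l ^ r) / (M + 1) \<le> (l' ^ r - l ^ r) / 1"
      using l M by (intro divide_left_mono) (auto intro: power_mono)
    then show ?thesis by simp
  qed
  finally have A: "\<theta> * \<bar>l' ^ r / (M + 1) - ln z ^ r / z\<bar> \<le> \<theta> * (l' ^ r * (1 / M - 1 / (M + 1)) + (l' ^ r - l ^ r))"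
    using \<theta> by (intro mult_left_mono)
  have "\<bar>q (Suc m) - \<theta> / (M + 1)\<bar> * l' ^ r \<le> c / (M + 1)\<^sup>2 * l' ^ r"
    using q[of "Suc m"] l unfolding M(2) by (intro mult_right_mono) auto
  also have "\<dots> \<le> c * (1 / M - 1 / (M + 1)) * l' ^ r"
  proof (intro mult_right_mono)
    have "1 / (M + 1)\<^sup>2 \<le> 1 / (M * (M + 1))"
      using M by (intro divide_left_mono) (auto simp: power2_eq_square)
    also have "\<dots> = 1 / M - 1 / (M + 1)" using M by (simp add: field_simps)
    finally have "1 / (M + 1)\<^sup>2 \<le> 1 / M - 1 / (M + 1)" .
    then show "c / (M + 1)\<^sup>2 \<le> c * (1 / M - 1 / (M + 1))"
      using c mult_left_mono by fastforce
  qed (use l in auto)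
  finally have B: "\<bar>q (Suc m) - \<theta> / (M + 1)\<bar> * l' ^ r \<le> c * (1 / M - 1 / (M + 1)) * l' ^ r" .
  have "q (Suc m) * l' ^ r - \<theta> / real (Suc r) * (l' ^ Suc r - l ^ Suc r) =
     (q (Suc m) - \<theta> / (M + 1)) * l' ^ r + \<theta> * (l' ^ r / (M + 1) - ln z ^ r / z)"
  proof -
    have "\<theta> / real (Suc r) * (real (Suc r) * u) = \<theta> * u" for u by (simp del: of_nat_Suc)
    then show ?thesis unfolding z(3) by (simp add: left_diff_distrib right_diff_distrib)
  qed
  also have "\<bar>\<dots>\<bar> \<le> \<bar>q (Suc m) - \<theta> / (M + 1)\<bar> * l' ^ r + \<theta> * \<bar>l' ^ r / (M + 1) - ln z ^ r / z\<bar>"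
    using \<theta> l by (intro order_trans[OF abs_triangle_ineq]) (simp add: abs_mult)
  finally have tri: "\<bar>q (Suc m) * l' ^ r - \<theta> / real (Suc r) * (l' ^ Suc r - l ^ Suc r)\<bar> \<le>
     \<bar>q (Suc m) - \<theta> / (M + 1)\<bar> * l' ^ r + \<theta> * \<bar>l' ^ r / (M + 1) - ln z ^ r / z\<bar>" .
  have step: "\<bar>q (Suc m) * l' ^ r - \<theta> / real (Suc r) * (l' ^ Suc r - l ^ Suc r)\<bar> \<le>
     (\<theta> + c) * ((1 / M - 1 / (M + 1)) * l' ^ r) + \<theta> * (l' ^ r - l ^ r)"
  proof -
    have "c * D * l' ^ r + \<theta> * (l' ^ r * D + (l' ^ r - l ^ r)) = (\<theta> + c) * (D * l' ^ r) + \<theta> * (l' ^ r - l ^ r)" for D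
      by (simp add: algebra_simps)
    from this[of "1 / M - 1 / (M + 1)"] show ?thesis using A B tri by linarith
  qed
  have m1: "(\<theta> + c) * ((1 - 1 / M) * l ^ r) \<le> (\<theta> + c) * ((1 - 1 / M) * l' ^ r)"
    using \<theta> c l M by (intro mult_left_mono power_mono) auto
  have m2: "\<bar>(\<Sum>j=1..m. q j * ln (real j) ^ r) - \<theta> / real (Suc r) * l ^ Suc r\<bar> \<le>
    (\<theta> + c) * (1 + (1 - 1 / M) * l ^ r) + \<theta> * l ^ r"
    using Suc.IH by (simp only: l_def M_def)
  have m3: "(\<Sum>j=1..Suc m. q j * ln (real j) ^ r) - \<theta> / real (Suc r) * l' ^ Suc r =
     ((\<Sum>j=1..m. q j * ln (real j) ^ r) - \<theta> / real (Suc r) * l ^ Suc r) +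
     (q (Suc m) * l' ^ r - \<theta> / real (Suc r) * (l' ^ Suc r - l ^ Suc r))"
    by (simp add: l'_def algebra_simps)
  have dist: "(\<theta> + c) * (1 + y) = (\<theta> + c) + (\<theta> + c) * y" for y by (simp add: algebra_simps)
  have "\<bar>(\<Sum>j=1..Suc m. q j * ln (real j) ^ r) - \<theta> / real (Suc r) * l' ^ Suc r\<bar> \<le>
    (\<theta> + c) * (1 + (1 - 1 / M) * l' ^ r) + \<theta> * l ^ r + ((\<theta> + c) * ((1 / M - 1 / (M + 1)) * l' ^ r) + \<theta> * (l' ^ r - l ^ r))"
    using step m1 m2 unfolding m3 dist by linarith
  also have "\<dots> = (\<theta> + c) * (1 + (1 - 1 / (M + 1)) * l' ^ r) + \<theta> * l' ^ r"
    by (simp add: algebra_simps)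
  finally show ?case unfolding M(2) l'_def .
qed

lemma sum_log_power:
  fixes q :: "nat \<Rightarrow> real"
  assumes q: "\<And>j. j \<ge> 1 \<Longrightarrow> \<bar>q j - \<theta> / real j\<bar> \<le> c / (real j)\<^sup>2" and \<theta>: "\<theta> \<ge> 0" and c: "c \<ge> 0" and x: "x \<ge> 1"
  shows "\<bar>(\<Sum>j=1..nat \<lfloor>x\<rfloor>. q j * ln (real j) ^ r) - \<theta> / real (Suc r) * ln x ^ Suc r\<bar> \<le>
    4 * (\<theta> + c) * (1 + ln x) ^ r"
proof -
  define m where "m = nat \<lfloor>x\<rfloor>"
  have m: "m \<ge> 1" "real m \<le> x" "x < real m + 1" using x unfolding m_def by linarith+
  define l where "l = ln (real m)"
  have l: "0 \<le> l" "l \<le> ln x" using m by (auto simp: l_def)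
  \<comment> \<open>Rounding \<open>x\<close> down to \<open>m\<close> changes the logarithm by at
    most \<open>ln 2 < 1\<close>.\<close>
  have "x / real m \<le> 2" using m by (simp add: field_simps)
  then have "ln (x / real m) \<le> ln 2" using m x by (intro ln_mono) auto
  then have "ln x - l \<le> ln 2" using m x by (simp add: l_def ln_div)
  then have "ln x - l \<le> 1" using ln_2_less_1 by linarith
  have "ln x ^ Suc r - l ^ Suc r \<le> real (Suc r) * (ln x - l) * ln x ^ r"
    using l by (intro power_Suc_diff_le)
  also have "\<dots> \<le> real (Suc r) * 1 * ln x ^ r"
    using l \<open>ln x - l \<le> 1\<close> by (intro mult_right_mono mult_left_mono) auto
  finally have "(ln x ^ Suc r - l ^ Suc r) / real (Suc r) \<le> ln x ^ r" by (simp add: field_simps)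
  then have "\<theta> * ((ln x ^ Suc r - l ^ Suc r) / real (Suc r)) \<le> \<theta> * ln x ^ r" using \<theta> by (rule mult_left_mono)
  moreover have "0 \<le> \<theta> * ((ln x ^ Suc r - l ^ Suc r) / real (Suc r))"
    using \<theta> l power_mono[of l "ln x" "Suc r"] by (intro mult_nonneg_nonneg divide_nonneg_nonneg) auto
  ultimately have 1: "\<bar>\<theta> / real (Suc r) * l ^ Suc r - \<theta> / real (Suc r) * ln x ^ Suc r\<bar> \<le> \<theta> * ln x ^ r"
    by (simp add: diff_divide_distrib algebra_simps del: of_nat_Suc)
  have "\<bar>(\<Sum>j=1..m. q j * ln (real j) ^ r) - \<theta> / real (Suc r) * l ^ Suc r\<bar> \<le>
    (\<theta> + c) * (1 + (1 - 1 / real m) * l ^ r) + \<theta> * l ^ r"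
    unfolding l_def by (rule sum_log_power_nat) (use assms m in auto)
  also have "\<dots> \<le> (\<theta> + c) * (1 + ln x ^ r) + \<theta> * ln x ^ r"
  proof -
    have "(1 - 1 / real m) * l ^ r \<le> 1 * ln x ^ r" using l m by (intro mult_mono power_mono) auto
    then show ?thesis using \<theta> c l by (intro add_mono mult_left_mono power_mono) auto
  qed
  finally have "\<bar>(\<Sum>j=1..m. q j * ln (real j) ^ r) - \<theta> / real (Suc r) * ln x ^ Suc r\<bar> \<le>
     (\<theta> + c) * (1 + ln x ^ r) + 2 * (\<theta> * ln x ^ r)"
    using 1 by linarith
  also have "\<dots> \<le> (\<theta> + c) * (1 + ln x ^ r) + 2 * ((\<theta> + c) * ln x ^ r)"
    using c l by (intro add_left_mono mult_left_mono mult_right_mono) auto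
  \<comment> \<open>Both 1 and \<open>ln x ^ r\<close> are at most \<open>(1 + ln x) ^ r\<close>;
    the four copies make up the constant 4.\<close>
  also have "\<dots> \<le> (\<theta> + c) * ((1 + ln x) ^ r + (1 + ln x) ^ r) + 2 * ((\<theta> + c) * (1 + ln x) ^ r)"
  proof -
    have "1 \<le> (1 + ln x) ^ r" "ln x ^ r \<le> (1 + ln x) ^ r"
      using l by (auto intro!: one_le_power power_mono)
    then show ?thesis using \<theta> c by (intro add_mono mult_left_mono) auto
  qed
  also have "\<dots> = 4 * (\<theta> + c) * (1 + ln x) ^ r" by (simp add: algebra_simps)
  finally show ?thesis by (simp add: m_def)
qed

lemma harmonic_sum_le: "m \<ge> 1 \<Longrightarrow> (\<Sum>j=1..m. 1 / real j) \<le> 1 + ln (real m)"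
proof (induction m rule: nat_induct_at_least)
  case (Suc m)
  have "ln (real m / real (Suc m)) \<le> real m / real (Suc m) - 1"
    using Suc by (intro ln_le_minus_one) auto
  then have "1 / real (Suc m) \<le> ln (real (Suc m)) - ln (real m)"
    using Suc by (simp add: ln_div field_simps)
  then show ?case using Suc.IH by simp
qed simp

section \<open>Success probabilities compared with a harmonic sequence\<close>

context
  fixes \<theta> :: real
  assumes \<theta>: "\<theta> > 0"
begin

text \<open>The constant serves two cases: at \<open>j = 1\<close> the probability is 1 whatever
  \<theta> is, and for \<open>\<theta> \<ge> 1\<close> the denominator is at least
  \<open>j\<close>.\<close>

lemma feller_prob_le: "j \<ge> 1 \<Longrightarrow> feller_prob \<theta> j \<le> max 1 \<theta> / real j"
proof -
  assume j: "j \<ge> 1"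
  have "\<theta> * real j \<le> max 1 \<theta> * (\<theta> + real j - 1)"
  proof (cases "\<theta> \<ge> 1")
    case True
    then have "\<theta> * (\<theta> - 1) \<ge> 0" by simp
    then show ?thesis using True by (simp add: max_def algebra_simps)
  next
    case False
    then have "(1 - \<theta>) * (real j - 1) \<ge> 0" using j by (intro mult_nonneg_nonneg) auto
    then show ?thesis using False by (simp add: max_def algebra_simps)
  qed
  then show ?thesis using j \<theta> by (simp add: feller_prob_def divide_simps mult.commute)
qed

text \<open>The first summand bounds \<open>j^2\<close> times the distance of
  \<open>feller_prob \<theta> j\<close> from \<open>\<theta> / j\<close>, the second
  \<open>j^2\<close> times its square; together they serve means and variances alike.\<close>

definition rate_const :: real where
  "rate_const = (max 1 \<theta>) * \<bar>1 - \<theta>\<bar> + (max 1 \<theta>)\<^sup>2"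

lemma rate_const_nonneg: "rate_const \<ge> 0"
  by (simp add: rate_const_def)

lemma feller_prob_approx:
  assumes j: "j \<ge> 1"
  shows "\<bar>feller_prob \<theta> j - \<theta> / real j\<bar> \<le> rate_const / (real j)\<^sup>2"
    and "\<bar>feller_prob \<theta> j * (1 - feller_prob \<theta> j) - \<theta> / real j\<bar> \<le> rate_const / (real j)\<^sup>2"
proof -
  let ?C = "max 1 \<theta>"
  have p: "0 \<le> feller_prob \<theta> j" using feller_prob_bounds[OF \<theta>] j by blast
  have "feller_prob \<theta> j - \<theta> / real j = feller_prob \<theta> j * ((1 - \<theta>) / real j)"
    using j \<theta> by (simp add: feller_prob_def field_simps)
  then have "\<bar>feller_prob \<theta> j - \<theta> / real j\<bar> = feller_prob \<theta> j * (\<bar>1 - \<theta>\<bar> / real j)"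
    using p by (simp add: abs_mult)
  also have "\<dots> \<le> ?C / real j * (\<bar>1 - \<theta>\<bar> / real j)"
    by (intro mult_right_mono feller_prob_le j) auto
  finally have 1: "\<bar>feller_prob \<theta> j - \<theta> / real j\<bar> \<le> ?C * \<bar>1 - \<theta>\<bar> / (real j)\<^sup>2"
    by (simp add: power2_eq_square)
  have "feller_prob \<theta> j * feller_prob \<theta> j \<le> ?C / real j * (?C / real j)"
    by (intro mult_mono feller_prob_le j p) auto
  then have 2: "feller_prob \<theta> j * feller_prob \<theta> j \<le> ?C\<^sup>2 / (real j)\<^sup>2" by (simp add: power2_eq_square)
  have "0 \<le> feller_prob \<theta> j * feller_prob \<theta> j" using p by simp
  moreover have "0 \<le> ?C\<^sup>2 / (real j)\<^sup>2" by simp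
  moreover have "0 \<le> ?C * \<bar>1 - \<theta>\<bar> / (real j)\<^sup>2" by simp
  moreover have "rate_const / (real j)\<^sup>2 = ?C * \<bar>1 - \<theta>\<bar> / (real j)\<^sup>2 + ?C\<^sup>2 / (real j)\<^sup>2"
    by (simp add: rate_const_def add_divide_distrib)
  moreover have "feller_prob \<theta> j * (1 - feller_prob \<theta> j) = feller_prob \<theta> j - feller_prob \<theta> j * feller_prob \<theta> j"
    by (simp add: algebra_simps)
  ultimately show "\<bar>feller_prob \<theta> j - \<theta> / real j\<bar> \<le> rate_const / (real j)\<^sup>2"
    "\<bar>feller_prob \<theta> j * (1 - feller_prob \<theta> j) - \<theta> / real j\<bar> \<le> rate_const / (real j)\<^sup>2"
    using 1 2 by linarith+
qed

lemma sum_feller_prob_le: "m \<ge> 1 \<Longrightarrow> (\<Sum>j=1..m. feller_prob \<theta> j) \<le> max 1 \<theta> * (1 + ln (real m))"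
proof -
  assume m: "m \<ge> 1"
  have "(\<Sum>j=1..m. feller_prob \<theta> j) \<le> (\<Sum>j=1..m. max 1 \<theta> * (1 / real j))"
    by (intro sum_mono order_trans[OF feller_prob_le]) auto
  also have "\<dots> \<le> max 1 \<theta> * (1 + ln (real m))"
    unfolding sum_distrib_left[symmetric] using harmonic_sum_le[OF m] by (intro mult_left_mono) auto
  finally show ?thesis .
qed

lemma feller_prob_antimono: "1 \<le> j \<Longrightarrow> feller_prob \<theta> (Suc j) \<le> feller_prob \<theta> j"
  using \<theta> by (auto simp: feller_prob_def intro!: divide_left_mono)

end

section \<open>Parts as gaps between consecutive ones\<close>

text \<open>Complete gaps only, as pairs of starting point and length; the last part of the
  partition is not among them.\<close>

definition gaps :: "(nat \<Rightarrow> bool) \<Rightarrow> nat \<Rightarrow> (nat \<times> nat) set" where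
  "gaps \<xi> n = {(j, i). 1 \<le> j \<and> 1 \<le> i \<and> j + i \<le> n \<and> gap \<xi> j i}"

lemma finite_gaps [simp]: "finite (gaps \<xi> n)"
  by (rule finite_subset[of _ "{1..n} \<times> {1..n}"]) (auto simp: gaps_def)

lemma gaps_disjoint:
  assumes "(j, i) \<in> gaps \<xi> n" "(j', i') \<in> gaps \<xi> n" "j < j'"
  shows "j + i \<le> j'"
  using assms by (force simp: gaps_def gap_def not_le[symmetric])

lemma inj_on_gaps_start: "inj_on fst (gaps \<xi> n)"
proof (rule inj_onI, clarsimp)
  fix j i i' assume g: "(j, i) \<in> gaps \<xi> n" "(j, i') \<in> gaps \<xi> n"
  then have "\<not> i < i'" "\<not> i' < i" by (auto simp: gaps_def gap_def)
  then show "i = i'" by simp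
qed

text \<open>Every later one ends exactly one gap, begun at the preceding one, which exists because
  of \<open>\<xi> 1\<close>. This turns sums over gaps into sums over ones, whose terms are
  independent.\<close>

lemma bij_betw_gaps_end:
  assumes "\<xi> 1"
  shows "bij_betw (\<lambda>(j, i). j + i) (gaps \<xi> n) {k\<in>{2..n}. \<xi> k}"
  unfolding bij_betw_def
proof (intro conjI)
  show "inj_on (\<lambda>(j, i). j + i) (gaps \<xi> n)"
  proof (rule inj_onI, clarsimp)
    fix j i j' i' assume g: "(j, i) \<in> gaps \<xi> n" "(j', i') \<in> gaps \<xi> n" and eq: "j + i = j' + i'"
    have "1 \<le> i" "1 \<le> i'" using g by (auto simp: gaps_def)
    then have "\<not> j < j'" "\<not> j' < j" using gaps_disjoint[OF g] gaps_disjoint[OF g(2,1)] eq by auto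
    then show "j = j' \<and> i = i'" using eq by simp
  qed
  show "(\<lambda>(j, i). j + i) ` gaps \<xi> n = {k\<in>{2..n}. \<xi> k}"
  proof (intro equalityI subsetI)
    fix k assume k: "k \<in> {k\<in>{2..n}. \<xi> k}"
    then have "k - 1 \<ge> 1" by auto
    then obtain l where l: "l \<in> {1..k - 1}" "last_one \<xi> (k - 1) l"
      by (rule last_one_exists[of \<xi> "k - 1", OF assms])
    then have "(l, k - l) \<in> gaps \<xi> n" using k by (auto simp: gaps_def gap_def last_one_def)
    then show "k \<in> (\<lambda>(j, i). j + i) ` gaps \<xi> n" using l by force
  qed (auto simp: gaps_def gap_def)
qed

lemma sum_feller_count:
  fixes f :: "nat \<Rightarrow> real"
  shows "(\<Sum>i=1..n. real (feller_count \<xi> n i) * f i) =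
    (\<Sum>(j, i)\<in>gaps \<xi> n. f i) + (\<Sum>i=1..n. of_bool (last_one \<xi> n (n - i + 1)) * f i)"
proof -
  have "(\<Sum>i=1..n. real (feller_count \<xi> n i) * f i) =
     (\<Sum>i=1..n. real (card {j\<in>{1..n - i}. gap \<xi> j i}) * f i) + (\<Sum>i=1..n. of_bool (last_one \<xi> n (n - i + 1)) * f i)"
    by (simp add: feller_count_gap sum.distrib distrib_right)
  also have "(\<Sum>i=1..n. real (card {j\<in>{1..n - i}. gap \<xi> j i}) * f i) = (\<Sum>i=1..n. \<Sum>j\<in>{j\<in>{1..n - i}. gap \<xi> j i}. f i)"
    by simp
  also have "\<dots> = (\<Sum>(i, j)\<in>Sigma {1..n} (\<lambda>i. {j\<in>{1..n - i}. gap \<xi> j i}). f i)"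
    by (rule sum.Sigma) auto
  also have "\<dots> = (\<Sum>(j, i)\<in>gaps \<xi> n. f i)"
    by (rule sum.reindex_bij_witness[of _ "\<lambda>(j, i). (i, j)" "\<lambda>(i, j). (j, i)"]) (auto simp: gaps_def)
  finally show ?thesis .
qed

text \<open>The size \<open>a\<close> of the last part is fixed before \<open>f\<close>, so one
  \<open>a\<close> serves all test functions for the same sequence.\<close>

lemma sum_last_one:
  assumes "n \<ge> 1" "\<xi> 1"
  obtains a where "a \<in> {1..n}" "\<And>f :: nat \<Rightarrow> real. (\<Sum>i=1..n. of_bool (last_one \<xi> n (n - i + 1)) * f i) = f a"
proof -
  obtain l where l: "l \<in> {1..n}" "last_one \<xi> n l" using last_one_exists assms by blast
  define a where "a = n - l + 1"
  have "(\<Sum>i=1..n. of_bool (last_one \<xi> n (n - i + 1)) * f i) = f a" for f :: "nat \<Rightarrow> real"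
  proof -
    have "(\<Sum>i=1..n. of_bool (last_one \<xi> n (n - i + 1)) * f i) = (\<Sum>i=1..n. if i = a then f i else 0)"
    proof (intro sum.cong refl)
      fix i assume "i \<in> {1..n}"
      then have "last_one \<xi> n (n - i + 1) \<longleftrightarrow> i = a"
        using last_one_unique[OF l(2), of "n - i + 1"] l by (auto simp: a_def)
      then show "of_bool (last_one \<xi> n (n - i + 1)) * f i = (if i = a then f i else 0)" by auto
    qed
    also have "\<dots> = f a" using l by (subst sum.delta) (auto simp: a_def)
    finally show ?thesis .
  qed
  moreover have "a \<in> {1..n}" using l by (auto simp: a_def)
  ultimately show ?thesis using that by blast
qed

definition ones_log :: "(nat \<Rightarrow> bool) \<Rightarrow> nat \<Rightarrow> real \<Rightarrow> real" where
  "ones_log \<xi> n x = (\<Sum>k=1..n. of_bool (\<xi> k \<and> real k \<le> x) * ln (real k))"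

lemma ones_log_gaps:
  assumes "\<xi> 1" "n \<ge> 1"
  shows "ones_log \<xi> n x = (\<Sum>(j, i)\<in>gaps \<xi> n. of_bool (real (j + i) \<le> x) * ln (real (j + i)))"
proof -
  \<comment> \<open>The one at position 1 ends no gap, but \<open>ln 1 = 0\<close>.\<close>
  have "ones_log \<xi> n x = (\<Sum>k\<in>{k\<in>{2..n}. \<xi> k}. of_bool (real k \<le> x) * ln (real k))"
    unfolding ones_log_def
  proof (intro sum.mono_neutral_cong_right ballI)
    fix i assume "i \<in> {1..n} - {k \<in> {2..n}. \<xi> k}"
    then show "of_bool (\<xi> i \<and> real i \<le> x) * ln (real i) = 0" by (cases "i = 1") auto
  qed auto
  also have "\<dots> = (\<Sum>z\<in>gaps \<xi> n. of_bool (real (case z of (j, i) \<Rightarrow> j + i) \<le> x) * ln (real (case z of (j, i) \<Rightarrow> j + i)))"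
    by (rule sum.reindex_bij_betw[OF bij_betw_gaps_end[of \<xi> n, OF assms(1)], symmetric])
  finally show ?thesis by (simp add: case_prod_unfold)
qed

lemma ln_prod_parts:
  assumes "n \<ge> 1" "t \<le> 1"
  shows "ln (real (prod_parts n \<alpha> t)) = (\<Sum>i=1..n. real (\<alpha> i) * (of_bool (real i \<le> real n powr t) * ln (real i)))"
proof -
  have "real n powr t \<le> real n powr 1" using assms by (intro powr_mono) auto
  then have sub: "{i. 1 \<le> i \<and> real i \<le> real n powr t} \<subseteq> {1..n}" using assms by auto
  then have fin: "finite {i. 1 \<le> i \<and> real i \<le> real n powr t}" by (rule finite_subset) auto
  have "ln (real (prod_parts n \<alpha> t)) = (\<Sum>i | 1 \<le> i \<and> real i \<le> real n powr t. ln (real (i ^ \<alpha> i)))"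
    unfolding prod_parts_def of_nat_prod using fin by (intro ln_prod) auto
  also have "\<dots> = (\<Sum>i=1..n. real (\<alpha> i) * (of_bool (real i \<le> real n powr t) * ln (real i)))"
    using sub by (intro sum.mono_neutral_cong_left) (auto simp: ln_realpow)
  finally show ?thesis .
qed

text \<open>Replacing the length of a gap by its end point costs at most \<open>ln L\<close> and
  moves it past the cutoff by at most the factor \<open>L\<close>. The first cost appears in the
  lower bound, the second in the upper one; the last part adds between 0 and
  \<open>ln n\<close>.\<close>

lemma ln_prod_parts_sandwich:
  assumes n: "n \<ge> 1" and t: "t \<le> 1" and one: "\<xi> 1" and L: "L \<ge> 1"
    and long: "\<And>j i. (j, i) \<in> gaps \<xi> n \<Longrightarrow> real (j + i) \<le> L * real i"
  defines "A \<equiv> ln (real (prod_parts n (feller_partition n n \<xi>) t))"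
  shows "ones_log \<xi> n (real n powr t) - real (card (gaps \<xi> n)) * ln L \<le> A"
    and "A \<le> ones_log \<xi> n (L * real n powr t) + ln (real n)"
proof -
  let ?x = "real n powr t"
  let ?f = "\<lambda>i. of_bool (real i \<le> ?x) * ln (real i)"
  obtain a where a: "a \<in> {1..n}" "\<And>f :: nat \<Rightarrow> real. (\<Sum>i=1..n. of_bool (last_one \<xi> n (n - i + 1)) * f i) = f a"
    using sum_last_one[of n \<xi>, OF n one] by blast
  have "A = (\<Sum>i=1..n. real (feller_count \<xi> n i) * ?f i)"
    unfolding A_def ln_prod_parts[OF n t] by (intro sum.cong) (auto simp: feller_partition_def)
  also have "\<dots> = (\<Sum>(j, i)\<in>gaps \<xi> n. ?f i) + ?f a"
    unfolding sum_feller_count a(2) ..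
  finally have A: "A = (\<Sum>(j, i)\<in>gaps \<xi> n. ?f i) + ?f a" .
  have fa: "0 \<le> ?f a" "?f a \<le> ln (real n)" using a(1) by (auto simp: of_bool_def)
  have "ones_log \<xi> n ?x - real (card (gaps \<xi> n)) * ln L =
     (\<Sum>(j, i)\<in>gaps \<xi> n. of_bool (real (j + i) \<le> ?x) * ln (real (j + i)) - ln L)"
    unfolding ones_log_gaps[of \<xi> n, OF one n] by (simp add: case_prod_unfold sum_subtractf)
  also have "\<dots> \<le> (\<Sum>(j, i)\<in>gaps \<xi> n. ?f i)"
  proof (rule sum_mono, clarify)
    fix j i assume g: "(j, i) \<in> gaps \<xi> n"
    then have i: "i \<ge> 1" by (simp add: gaps_def)
    have "ln (real (j + i)) \<le> ln (L * real i)" using long[OF g] i L by (intro ln_mono) auto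
    also have "\<dots> = ln L + ln (real i)" using i L by (simp add: ln_mult)
    finally have "ln (real (j + i)) \<le> ln L + ln (real i)" .
    moreover have "0 \<le> ln L" "0 \<le> ln (real i)" using L i by auto
    ultimately show "of_bool (real (j + i) \<le> ?x) * ln (real (j + i)) - ln L \<le> ?f i" by (auto simp: of_bool_def)
  qed
  finally show "ones_log \<xi> n ?x - real (card (gaps \<xi> n)) * ln L \<le> A" using A fa by linarith
  have "(\<Sum>(j, i)\<in>gaps \<xi> n. ?f i) \<le> ones_log \<xi> n (L * ?x)"
    unfolding ones_log_gaps[of \<xi> n, OF one n]
  proof (rule sum_mono, clarify)
    fix j i assume g: "(j, i) \<in> gaps \<xi> n"
    then have i: "i \<ge> 1" by (simp add: gaps_def)
    have "real (j + i) \<le> L * ?x" if "real i \<le> ?x"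
    proof -
      have "L * real i \<le> L * ?x" using that L by (intro mult_left_mono) auto
      then show ?thesis using long[OF g] by linarith
    qed
    then show "?f i \<le> of_bool (real (j + i) \<le> L * ?x) * ln (real (j + i))"
      using i by (auto simp: of_bool_def)
  qed
  then show "A \<le> ones_log \<xi> n (L * ?x) + ln (real n)" using A fa by linarith
qed

section \<open>Product versus least common multiple\<close>

lemma multiplicity_eq_card:
  fixes p i n :: nat
  assumes p: "prime p" and i: "i \<in> {1..n}"
  shows "multiplicity p i = card {s\<in>{1..n}. p ^ s dvd i}"
proof -
  have iff: "p ^ s dvd i \<longleftrightarrow> s \<le> multiplicity p i" for s
    by (rule power_dvd_iff_le_multiplicity) (use p i in \<open>auto simp: prime_nat_iff\<close>)
  \<comment> \<open>The exponent is below \<open>i \<le> n\<close>, so testing powers up to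
    \<open>n\<close> loses nothing.\<close>
  have "multiplicity p i < 2 ^ multiplicity p i" by (rule less_exp)
  also have "\<dots> \<le> p ^ multiplicity p i" using prime_ge_2_nat[OF p] by (intro power_mono) auto
  also have "\<dots> \<le> i" using i by (intro dvd_imp_le multiplicity_dvd) auto
  finally have "multiplicity p i \<le> n" using i by simp
  then have "{s\<in>{1..n}. p ^ s dvd i} = {1..multiplicity p i}" unfolding iff by auto
  then show ?thesis by simp
qed

lemma ln_eq_sum_multiplicity:
  fixes m :: nat
  assumes m: "m > 0" and P: "finite P" "\<And>p. p \<in> P \<Longrightarrow> prime p" "prime_factors m \<subseteq> P"
  shows "ln (real m) = (\<Sum>p\<in>P. real (multiplicity p m) * ln (real p))"
proof -
  have "real m = (\<Prod>p\<in>prime_factors m. real p ^ multiplicity p m)"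
    using prime_factorization_nat[OF m] by (metis (no_types, lifting) of_nat_power of_nat_prod prod.cong)
  then have "ln (real m) = ln (\<Prod>p\<in>prime_factors m. real p ^ multiplicity p m)" by simp
  also have "\<dots> = (\<Sum>p\<in>prime_factors m. ln (real p ^ multiplicity p m))"
    by (intro ln_prod) (auto simp: in_prime_factors_iff prime_gt_0_nat)
  also have "\<dots> = (\<Sum>p\<in>prime_factors m. real (multiplicity p m) * ln (real p))"
    by (intro sum.cong refl) (auto simp: ln_realpow in_prime_factors_iff prime_gt_0_nat)
  also have "\<dots> = (\<Sum>p\<in>P. real (multiplicity p m) * ln (real p))"
    using P m by (intro sum.mono_neutral_left) (auto simp: in_prime_factors_iff not_dvd_imp_multiplicity_0)
  finally show ?thesis .
qed

definition multiples :: "nat set \<Rightarrow> (nat \<Rightarrow> nat) \<Rightarrow> nat \<Rightarrow> nat" where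
  "multiples A \<alpha> q = (\<Sum>i | i \<in> A \<and> q dvd i. \<alpha> i)"

text \<open>The exponent of \<open>p\<close> in the product counts, over all \<open>s\<close>, the
  parts divisible by \<open>p ^ s\<close>; in the least common multiple every \<open>s\<close> with
  at least one such part counts once. Truncated subtraction expresses the excess also when there is
  no such part.\<close>

lemma ln_prod_minus_ln_Lcm:
  fixes \<alpha> :: "nat \<Rightarrow> nat"
  assumes A: "A \<subseteq> {1..n}"
  defines "m \<equiv> \<Prod>i\<in>A. i ^ \<alpha> i" and "c \<equiv> Lcm {i\<in>A. \<alpha> i > 0}"
  shows "0 \<le> ln (real m) - ln (real c)"
    and "ln (real m) - ln (real c) \<le>
      (\<Sum>p | prime p \<and> p \<le> n. \<Sum>s=1..n. ln (real p) * real (multiples A \<alpha> (p ^ s) - 1))"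
proof -
  let ?P = "{p. prime p \<and> p \<le> n}"
  have finA: "finite A" using A by (rule finite_subset) auto
  have finP: "finite ?P" by (rule finite_subset[of _ "{..n}"]) auto
  have m0: "m > 0" unfolding m_def using A by (auto intro!: prod_pos)
  have dvd: "c dvd m"
    unfolding c_def
  proof (rule Lcm_least)
    fix i assume i: "i \<in> {i\<in>A. \<alpha> i > 0}"
    then have "i dvd i ^ \<alpha> i" by (simp add: dvd_power)
    also have "\<dots> dvd m" unfolding m_def using i finA by (intro dvd_prodI) auto
    finally show "i dvd m" .
  qed
  then have c0: "c > 0" using m0 by (auto intro: Nat.gr0I)
  show "0 \<le> ln (real m) - ln (real c)"
    using dvd_imp_le[OF dvd m0] c0 by (simp add: ln_mono)
  have pf: "prime_factors m \<subseteq> ?P"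
  proof
    fix p assume "p \<in> prime_factors m"
    then have p: "prime p" "p dvd m" by (auto simp: in_prime_factors_iff)
    then obtain i where i: "i \<in> A" "p dvd i ^ \<alpha> i"
      using prime_dvd_prod_iff[OF finA p(1), of "\<lambda>i. i ^ \<alpha> i"] unfolding m_def by auto
    then have "p dvd i" using p by (meson prime_dvd_power)
    then have "p \<le> n" using i A by (auto dest!: dvd_imp_le)
    then show "p \<in> ?P" using p by simp
  qed
  have pfc: "prime_factors c \<subseteq> ?P"
  proof
    fix p assume "p \<in> prime_factors c"
    then have "prime p" "p dvd m" using dvd by (auto simp: in_prime_factors_iff intro: dvd_trans)
    then show "p \<in> ?P" using pf m0 by (auto simp: in_prime_factors_iff)
  qed
  have key: "real (multiplicity p m) - real (multiplicity p c) \<le> (\<Sum>s=1..n. real (multiples A \<alpha> (p ^ s) - 1))"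
    if p: "p \<in> ?P" for p
  proof -
    have pp: "prime p" using p by simp
    have "multiplicity p m = (\<Sum>i\<in>A. multiplicity p (i ^ \<alpha> i))"
      unfolding m_def using A pp
      by (intro prime_elem_multiplicity_prod_distrib finA prime_imp_prime_elem) auto
    also have "\<dots> = (\<Sum>i\<in>A. \<alpha> i * multiplicity p i)"
      using A pp by (intro sum.cong refl prime_elem_multiplicity_power_distrib prime_imp_prime_elem) auto
    also have "\<dots> = (\<Sum>i\<in>A. \<Sum>s=1..n. \<alpha> i * of_bool (p ^ s dvd i))"
    proof (intro sum.cong refl)
      fix i assume "i \<in> A"
      then have "multiplicity p i = card {s\<in>{1..n}. p ^ s dvd i}" using A pp by (intro multiplicity_eq_card) auto
      also have "\<dots> = (\<Sum>s\<in>{s\<in>{1..n}. p ^ s dvd i}. 1)" by simp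
      also have "\<dots> = (\<Sum>s=1..n. of_bool (p ^ s dvd i))"
        by (intro sum.mono_neutral_cong_left) auto
      finally show "\<alpha> i * multiplicity p i = (\<Sum>s=1..n. \<alpha> i * of_bool (p ^ s dvd i))"
        by (simp only: sum_distrib_left)
    qed
    also have "\<dots> = (\<Sum>s=1..n. \<Sum>i\<in>A. \<alpha> i * of_bool (p ^ s dvd i))" by (rule sum.swap)
    also have "\<dots> = (\<Sum>s=1..n. multiples A \<alpha> (p ^ s))"
      unfolding multiples_def using finA by (intro sum.cong refl sum.mono_neutral_cong_right) auto
    finally have mm: "multiplicity p m = (\<Sum>s=1..n. multiples A \<alpha> (p ^ s))" .
    have "(\<Sum>s=1..n. of_bool (multiples A \<alpha> (p ^ s) \<ge> 1)) = card {s\<in>{1..n}. multiples A \<alpha> (p ^ s) \<ge> 1}"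
      by (simp add: of_bool_def sum.If_cases Int_def)
    also have "\<dots> \<le> card {1..multiplicity p c}"
    proof (rule card_mono)
      show "{s\<in>{1..n}. multiples A \<alpha> (p ^ s) \<ge> 1} \<subseteq> {1..multiplicity p c}"
      proof
        fix s assume s: "s \<in> {s\<in>{1..n}. multiples A \<alpha> (p ^ s) \<ge> 1}"
        then have "\<not> (\<forall>i\<in>{i. i \<in> A \<and> p ^ s dvd i}. \<alpha> i = 0)"
          using sum.neutral[of "{i. i \<in> A \<and> p ^ s dvd i}" \<alpha>] unfolding multiples_def by fastforce
        then obtain i where i: "i \<in> A" "p ^ s dvd i" "\<alpha> i > 0" by auto
        then have "i dvd c" unfolding c_def by (intro dvd_Lcm) auto
        then have "p ^ s dvd c" using i by (meson dvd_trans)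
        then have "s \<le> multiplicity p c"
          using c0 pp by (intro multiplicity_geI) (auto simp: prime_nat_iff)
        then show "s \<in> {1..multiplicity p c}" using s by auto
      qed
    qed auto
    finally have mc: "(\<Sum>s=1..n. of_bool (multiples A \<alpha> (p ^ s) \<ge> 1)) \<le> multiplicity p c" by simp
    have "multiplicity p m = (\<Sum>s=1..n. (multiples A \<alpha> (p ^ s) - 1) + of_bool (multiples A \<alpha> (p ^ s) \<ge> 1))"
      unfolding mm by (intro sum.cong refl) (auto simp: of_bool_def)
    also have "\<dots> \<le> (\<Sum>s=1..n. multiples A \<alpha> (p ^ s) - 1) + multiplicity p c"
      using mc by (simp add: sum.distrib)
    finally have "real (multiplicity p m) \<le> real ((\<Sum>s=1..n. multiples A \<alpha> (p ^ s) - 1) + multiplicity p c)"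
      by (rule of_nat_mono)
    then show ?thesis by simp
  qed
  have "ln (real m) - ln (real c) = (\<Sum>p\<in>?P. (real (multiplicity p m) - real (multiplicity p c)) * ln (real p))"
    using ln_eq_sum_multiplicity[OF m0 finP _ pf] ln_eq_sum_multiplicity[OF c0 finP _ pfc]
    by (simp add: sum_subtractf left_diff_distrib)
  also have "\<dots> \<le> (\<Sum>p\<in>?P. (\<Sum>s=1..n. real (multiples A \<alpha> (p ^ s) - 1)) * ln (real p))"
    by (intro sum_mono mult_right_mono key) (auto simp: prime_gt_0_nat Suc_leI)
  also have "\<dots> = (\<Sum>p\<in>?P. \<Sum>s=1..n. ln (real p) * real (multiples A \<alpha> (p ^ s) - 1))"
    by (simp add: sum_distrib_left mult.commute)
  finally show "ln (real m) - ln (real c) \<le> (\<Sum>p\<in>?P. \<Sum>s=1..n. ln (real p) * real (multiples A \<alpha> (p ^ s) - 1))" .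
qed

text \<open>The identity that the von Mangoldt function, summed over the divisors of
  \<open>a\<close>, gives \<open>ln a\<close>. It pays for the last part of the partition.\<close>

lemma sum_ln_prime_powers_le:
  assumes a: "a \<in> {1..n}"
  shows "(\<Sum>p | prime p \<and> p \<le> n. \<Sum>s=1..n. ln (real p) * of_bool (p ^ s dvd a)) = ln (real a)"
proof -
  have "(\<Sum>s=1..n. ln (real p) * of_bool (p ^ s dvd a)) = real (multiplicity p a) * ln (real p)"
    if "prime p" for p
  proof -
    have "(\<Sum>s=1..n. ln (real p) * of_bool (p ^ s dvd a)) = ln (real p) * (\<Sum>s=1..n. of_bool (p ^ s dvd a))"
      by (rule sum_distrib_left[symmetric])
    also have "(\<Sum>s=1..n. of_bool (p ^ s dvd a)) = real (card {s\<in>{1..n}. p ^ s dvd a})"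
      by (simp add: of_bool_def sum.If_cases Int_def)
    finally show ?thesis using multiplicity_eq_card[OF that a] by simp
  qed
  then have "(\<Sum>p | prime p \<and> p \<le> n. \<Sum>s=1..n. ln (real p) * of_bool (p ^ s dvd a)) =
      (\<Sum>p | prime p \<and> p \<le> n. real (multiplicity p a) * ln (real p))" by (intro sum.cong) auto
  also have "\<dots> = ln (real a)"
    by (intro ln_eq_sum_multiplicity[symmetric])
       (use a in \<open>auto simp: in_prime_factors_iff intro: finite_subset[of _ "{..n}"] dest!: dvd_imp_le\<close>)
  finally show ?thesis .
qed

text \<open>From \<open>ln m \<le> 8 * m powr (1 / 8)\<close> the terms are of order at most
  \<open>m powr (- (9 / 8))\<close>; any positive exponent below \<open>1 / 4\<close> would do in
  place of \<open>1 / 8\<close>.\<close>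

lemma summable_ln_powr: "summable (\<lambda>m::nat. ln (real m) * real m powr (- (5 / 4)))"
proof (rule summable_comparison_test')
  show "summable (\<lambda>m::nat. 8 * real m powr (- (9 / 8)))"
    by (intro summable_mult) (simp add: summable_real_powr_iff)
  fix m :: nat assume m: "m \<ge> 1"
  have "ln (real m powr (1 / 8)) \<le> real m powr (1 / 8) - 1" using m by (intro ln_le_minus_one) auto
  then have "ln (real m) \<le> 8 * real m powr (1 / 8)" using m by (simp add: ln_powr)
  then have "ln (real m) * real m powr (- (5 / 4)) \<le> 8 * real m powr (1 / 8) * real m powr (- (5 / 4))"
    by (intro mult_right_mono) auto
  also have "\<dots> = 8 * real m powr (- (9 / 8))" using m by (simp flip: powr_add)
  finally show "norm (ln (real m) * real m powr (- (5 / 4))) \<le> 8 * real m powr (- (9 / 8))"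
    using m by simp
qed

text \<open>Since \<open>p powr (- (5 / 4)) \<le> 1 / 2\<close>, summing over the powers of \<open>p\<close> costs only a factor 2.\<close>

lemma sum_prime_powers_bounded:
  obtains C where "C \<ge> 0"
    "\<And>n. (\<Sum>p | prime p \<and> p \<le> n. \<Sum>s=1..n. ln (real p) * real (p ^ s) powr (- (5 / 4))) \<le> C"
proof
  let ?f = "\<lambda>m::nat. ln (real m) * real m powr (- (5 / 4))"
  have nn: "?f m \<ge> 0" for m by (cases "m = 0") auto
  show "2 * suminf ?f \<ge> 0" using suminf_nonneg[OF summable_ln_powr nn] by simp
  fix n
  have "(\<Sum>s=1..n. ln (real p) * real (p ^ s) powr (- (5 / 4))) \<le> 2 * ?f p" if p: "prime p" for p
  proof -
    define x where "x = real p powr (- (5 / 4))"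
    have p2: "real p \<ge> 2" using prime_ge_2_nat[OF p] by simp
    have "x \<le> 2 powr (- (5 / 4))" unfolding x_def using p2 by (intro powr_mono2') auto
    also have "\<dots> \<le> 2 powr (- 1)" by (intro powr_mono) auto
    finally have x: "0 < x" "x \<le> 1 / 2" using p2 by (auto simp: x_def powr_minus_divide)
    \<comment> \<open>The factor \<open>1 - x ^ n\<close> makes the induction close: the new term is
      at most \<open>2 * x * (x ^ n - x ^ Suc n)\<close> because
      \<open>x \<le> 1 / 2\<close>.\<close>
    have "(\<Sum>s=1..n. x ^ s) \<le> 2 * x * (1 - x ^ n)"
    proof (induction n)
      case (Suc n)
      have "2 * (x ^ Suc n * x) \<le> 2 * (x ^ Suc n * (1 / 2))" using x by (intro mult_left_mono) auto
      then show ?case using Suc.IH by (simp add: algebra_simps)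
    qed simp
    also have "\<dots> \<le> 2 * x * 1" using x by (intro mult_left_mono) auto
    finally have geo: "(\<Sum>s=1..n. x ^ s) \<le> 2 * x" by simp
    have "real (p ^ s) powr (- (5 / 4)) = x ^ s" for s
      using p2 unfolding x_def by (simp add: powr_powr powr_realpow[symmetric] powr_powr mult.commute)
    then have "(\<Sum>s=1..n. ln (real p) * real (p ^ s) powr (- (5 / 4))) = ln (real p) * (\<Sum>s=1..n. x ^ s)"
      by (simp add: sum_distrib_left)
    also have "\<dots> \<le> ln (real p) * (2 * x)" using geo p2 by (intro mult_left_mono) auto
    finally show ?thesis by (simp add: x_def)
  qed
  then have "(\<Sum>p | prime p \<and> p \<le> n. \<Sum>s=1..n. ln (real p) * real (p ^ s) powr (- (5 / 4))) \<le>
     (\<Sum>p | prime p \<and> p \<le> n. 2 * ?f p)" by (intro sum_mono) auto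
  also have "\<dots> = 2 * (\<Sum>p | prime p \<and> p \<le> n. ?f p)" by (simp add: sum_distrib_left)
  also have "\<dots> \<le> 2 * suminf ?f"
    by (intro mult_left_mono sum_le_suminf summable_ln_powr) (auto simp: nn intro: finite_subset[of _ "{..n}"])
  finally show "(\<Sum>p | prime p \<and> p \<le> n. \<Sum>s=1..n. ln (real p) * real (p ^ s) powr (- (5 / 4))) \<le> 2 * suminf ?f" .
qed

section \<open>First and second moments of gaps\<close>

text \<open>Leaving out \<open>\<xi> j\<close> makes this, for \<open>i \<ge> 1\<close>, an event in
  the coordinates \<open>{j<..j + i}\<close>, independent of everything up to
  \<open>j\<close>.\<close>

definition next_one :: "(nat \<Rightarrow> bool) \<Rightarrow> nat \<Rightarrow> nat \<Rightarrow> bool" where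
  "next_one \<xi> j i \<longleftrightarrow> \<xi> (j + i) \<and> (\<forall>k\<in>{j<..<j + i}. \<not> \<xi> k)"

lemma gap_iff_next_one: "gap \<xi> j i \<longleftrightarrow> \<xi> j \<and> next_one \<xi> j i"
  by (auto simp: gap_def next_one_def)

definition mults :: "nat \<Rightarrow> nat \<Rightarrow> nat set" where
  "mults q N = {i\<in>{1..N}. q dvd i}"

lemma finite_mults [simp]: "finite (mults q N)" by (simp add: mults_def)

text \<open>Each multiple \<open>q * m\<close> stands for the \<open>q\<close> indices of the block
  ending at it, on which \<open>f\<close> is at least \<open>f (q * m)\<close>; the blocks are
  disjoint and the total mass is at most 1.\<close>

lemma sum_mults_antimono_le:
  fixes f :: "nat \<Rightarrow> real"
  assumes nn: "\<And>i. f i \<ge> 0" and anti: "\<And>i. 1 \<le> i \<Longrightarrow> f (Suc i) \<le> f i"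
    and le1: "\<And>N. (\<Sum>i=1..N. f i) \<le> 1" and q: "q \<ge> 1"
  shows "(\<Sum>i\<in>mults q N. f i) \<le> 1 / real q"
proof -
  have mono: "f b \<le> f a" if "1 \<le> a" "a \<le> b" for a b
    using that(2,1) by (induction b rule: dec_induct) (auto intro: order_trans[OF anti])
  have "real q * (\<Sum>m=1..M. f (q * m)) \<le> (\<Sum>i=1..q * M. f i)" for M
  proof (induction M)
    case (Suc M)
    have "{1..q * Suc M} = {1..q * M} \<union> {q * M + 1..q * Suc M}" by auto
    then have "(\<Sum>i=1..q * Suc M. f i) = (\<Sum>i=1..q * M. f i) + (\<Sum>i=q * M + 1..q * Suc M. f i)"
      by (simp only:) (rule sum.union_disjoint, auto)
    moreover have "(\<Sum>i=q * M + 1..q * Suc M. f (q * Suc M)) \<le> (\<Sum>i=q * M + 1..q * Suc M. f i)"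
      by (intro sum_mono mono) auto
    moreover have "(\<Sum>i=q * M + 1..q * Suc M. f (q * Suc M)) = real q * f (q * Suc M)" by simp
    moreover have "(\<Sum>m=1..Suc M. f (q * m)) = (\<Sum>m=1..M. f (q * m)) + f (q * Suc M)" by simp
    ultimately show ?case using Suc.IH by (simp only: distrib_left)
  qed simp
  from this[of "N div q"] le1[of "q * (N div q)"]
  have "real q * (\<Sum>m=1..N div q. f (q * m)) \<le> 1" by linarith
  moreover have "(\<Sum>i\<in>mults q N. f i) = (\<Sum>m=1..N div q. f (q * m))"
  proof -
    have "mults q N = (\<lambda>m. q * m) ` {1..N div q}"
    proof (intro equalityI subsetI)
      fix i assume "i \<in> mults q N"
      then obtain m where m: "i = q * m" "1 \<le> i" "i \<le> N" by (auto simp: mults_def)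
      then have "m \<in> {1..N div q}" using q by (cases m) (auto simp: less_eq_div_iff_mult_less_eq mult.commute)
      then show "i \<in> (\<lambda>m. q * m) ` {1..N div q}" using m by blast
    qed (use q in \<open>auto simp: mults_def less_eq_div_iff_mult_less_eq mult.commute\<close>)
    then show ?thesis using q by (simp add: sum.reindex inj_on_def)
  qed
  ultimately show ?thesis using q by (simp add: field_simps)
qed

lemma card_gaps_le: "real (card (gaps \<xi> n)) \<le> (\<Sum>k=1..n. of_bool (\<xi> k))"
proof -
  have "card (gaps \<xi> n) = card (fst ` gaps \<xi> n)" by (rule card_image[OF inj_on_gaps_start, symmetric])
  also have "\<dots> \<le> card {k\<in>{1..n}. \<xi> k}" by (rule card_mono) (auto simp: gaps_def gap_def)
  finally have "real (card (gaps \<xi> n)) \<le> real (card {k\<in>{1..n}. \<xi> k})" by simp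
  also have "\<dots> = (\<Sum>k\<in>{k\<in>{1..n}. \<xi> k}. 1)" by simp
  also have "\<dots> = (\<Sum>k=1..n. of_bool (\<xi> k))" by (rule sum.mono_neutral_cong_left) auto
  finally show ?thesis .
qed

definition gaps_mult :: "(nat \<Rightarrow> bool) \<Rightarrow> nat \<Rightarrow> nat \<Rightarrow> nat" where
  "gaps_mult \<xi> n q = card {(j, i)\<in>gaps \<xi> n. q dvd i}"

lemma gaps_mult_eq_sum: "real (gaps_mult \<xi> n q) = (\<Sum>j=1..n. \<Sum>i\<in>mults q (n - j). of_bool (\<xi> j) * of_bool (next_one \<xi> j i))"
proof -
  have fin: "finite {(j, i)\<in>gaps \<xi> n. q dvd i}" by (rule finite_subset[OF _ finite_gaps[of \<xi> n]]) auto
  have "real (gaps_mult \<xi> n q) = (\<Sum>z\<in>{(j, i)\<in>gaps \<xi> n. q dvd i}. 1)" by (simp add: gaps_mult_def)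
  also have "\<dots> = (\<Sum>(j, i)\<in>Sigma {1..n} (\<lambda>j. mults q (n - j)). of_bool (\<xi> j) * of_bool (next_one \<xi> j i))"
    by (rule sum.mono_neutral_cong_left)
       (auto simp: gaps_def mults_def gap_iff_next_one of_bool_def split: if_splits)
  also have "\<dots> = (\<Sum>j=1..n. \<Sum>i\<in>mults q (n - j). of_bool (\<xi> j) * of_bool (next_one \<xi> j i))"
    by (rule sum.Sigma[symmetric]) auto
  finally show ?thesis .
qed

text \<open>The gaps of length divisible by \<open>q\<close> that start at or after \<open>s\<close>, on the event that there is a
  one at \<open>s\<close>; the factor \<open>of_bool (\<xi> s)\<close> is left out to make this independent of \<open>\<xi>\<^sub>1, \<dots>, \<xi>\<^sub>s\<close>.\<close>

definition later_gaps :: "(nat \<Rightarrow> bool) \<Rightarrow> nat \<Rightarrow> nat \<Rightarrow> nat \<Rightarrow> real" where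
  "later_gaps \<xi> n q s = (\<Sum>i\<in>mults q (n - s). of_bool (next_one \<xi> s i)) +
     (\<Sum>j\<in>{s<..n}. \<Sum>i\<in>mults q (n - j). of_bool (\<xi> j) * of_bool (next_one \<xi> j i))"

text \<open>If there is a gap divisible by \<open>q\<close>, single out the first; all the others
  start at or after its end and are counted by \<open>later_gaps\<close>. Summing over every
  candidate for the first gap only adds nonnegative terms.\<close>

lemma gaps_mult_minus_one_le:
  "real (gaps_mult \<xi> n q - 1) \<le>
     (\<Sum>j=1..n. \<Sum>i\<in>mults q (n - j). (of_bool (\<xi> j) * of_bool (next_one \<xi> j i)) * later_gaps \<xi> n q (j + i))"
proof -
  let ?G = "{(j, i)\<in>gaps \<xi> n. q dvd i}"
  have later_nn: "later_gaps \<xi> n q s \<ge> 0" for s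
    unfolding later_gaps_def by (intro add_nonneg_nonneg sum_nonneg) auto
  have fin: "finite ?G" by (rule finite_subset[OF _ finite_gaps[of \<xi> n]]) auto
  show ?thesis
  proof (cases "?G = {}")
    case True
    then have "gaps_mult \<xi> n q = 0" by (simp only: gaps_mult_def card.empty)
    then show ?thesis using later_nn by (auto intro!: sum_nonneg)
  next
    case False
    then obtain j0 where "\<exists>i. (j0, i) \<in> ?G" "\<And>j. j < j0 \<Longrightarrow> \<not> (\<exists>i. (j, i) \<in> ?G)"
      using exists_least_iff[of "\<lambda>j. \<exists>i. (j, i) \<in> ?G"] by auto
    then obtain i0 where g0: "(j0, i0) \<in> ?G" and min: "\<And>j i. (j, i) \<in> ?G \<Longrightarrow> j0 \<le> j"
      by (meson not_le)
    let ?s = "j0 + i0"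
    have s: "?s \<le> n" "j0 \<ge> 1" "i0 \<ge> 1" using g0 by (auto simp: gaps_def)
    have later: "?s \<le> j \<and> j \<le> n \<and> i \<in> mults q (n - j) \<and> \<xi> j \<and> next_one \<xi> j i" if "(j, i) \<in> ?G - {(j0, i0)}" for j i
    proof -
      have g: "(j, i) \<in> gaps \<xi> n" "q dvd i" "(j, i) \<noteq> (j0, i0)" using that by auto
      have "j \<noteq> j0" using inj_onD[OF inj_on_gaps_start[of \<xi> n], of "(j, i)" "(j0, i0)"] g g0 by auto
      then have "j0 < j" using min[of j i] that by auto
      then have "?s \<le> j" using gaps_disjoint[of j0 i0 \<xi> n j i] g0 g by auto
      then show ?thesis using g by (auto simp: gaps_def gap_iff_next_one mults_def)
    qed
    have "real (gaps_mult \<xi> n q - 1) = real (card (?G - {(j0, i0)}))"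
      using g0 fin by (simp add: gaps_mult_def card_Diff_singleton)
    also have "\<dots> = (\<Sum>z\<in>?G - {(j0, i0)}. 1)" by simp
    also have "\<dots> \<le> (\<Sum>(j, i)\<in>Sigma {?s..n} (\<lambda>j. mults q (n - j)). of_bool (\<xi> j) * of_bool (next_one \<xi> j i))"
    proof (rule order_trans[OF eq_refl sum_mono2])
      show "(\<Sum>z\<in>?G - {(j0, i0)}. 1) = (\<Sum>(j, i)\<in>?G - {(j0, i0)}. of_bool (\<xi> j) * of_bool (next_one \<xi> j i) :: real)"
      proof (intro sum.cong refl)
        fix z assume z: "z \<in> ?G - {(j0, i0)}"
        obtain j i where ji: "z = (j, i)" by (cases z)
        show "1 = (case z of (j, i) \<Rightarrow> of_bool (\<xi> j) * (of_bool (next_one \<xi> j i) :: real))"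
          using later[of j i] z unfolding ji by simp
      qed
      show "?G - {(j0, i0)} \<subseteq> Sigma {?s..n} (\<lambda>j. mults q (n - j))"
      proof
        fix z assume z: "z \<in> ?G - {(j0, i0)}"
        obtain j i where ji: "z = (j, i)" by (cases z)
        show "z \<in> Sigma {?s..n} (\<lambda>j. mults q (n - j))"
          using later[of j i] z unfolding ji by simp
      qed
    qed auto
    also have "\<dots> = (\<Sum>j=?s..n. \<Sum>i\<in>mults q (n - j). of_bool (\<xi> j) * of_bool (next_one \<xi> j i))"
      by (rule sum.Sigma[symmetric]) auto
    \<comment> \<open>The next such gap may begin right at the end \<open>?s\<close> of the first
      one; there the indicator of \<open>\<xi> ?s\<close> is bounded by 1, which gives the separate
      first sum in \<open>later_gaps\<close>.\<close>
    also have "{?s..n} = insert ?s {?s<..n}" using s by auto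
    also have "(\<Sum>j\<in>insert ?s {?s<..n}. \<Sum>i\<in>mults q (n - j). of_bool (\<xi> j) * of_bool (next_one \<xi> j i)) \<le> later_gaps \<xi> n q ?s"
      by (auto simp: later_gaps_def intro!: sum_mono)
    also have "\<dots> = (of_bool (\<xi> j0) * of_bool (next_one \<xi> j0 i0)) * later_gaps \<xi> n q ?s"
      using g0 by (auto simp: gaps_def gap_iff_next_one)
    also have "\<dots> \<le> (\<Sum>i\<in>mults q (n - j0). (of_bool (\<xi> j0) * of_bool (next_one \<xi> j0 i)) * later_gaps \<xi> n q (j0 + i))"
      using s g0 later_nn by (intro member_le_sum) (auto simp: mults_def)
    also have "\<dots> \<le> (\<Sum>j=1..n. \<Sum>i\<in>mults q (n - j). (of_bool (\<xi> j) * of_bool (next_one \<xi> j i)) * later_gaps \<xi> n q (j + i))"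
      using s later_nn by (intro member_le_sum[where f = "\<lambda>j. \<Sum>i\<in>mults q (n - j). (of_bool (\<xi> j) * of_bool (next_one \<xi> j i)) * later_gaps \<xi> n q (j + i)"]) (auto intro!: sum_nonneg)
    finally show ?thesis .
  qed
qed

definition lcm_loss :: "(nat \<Rightarrow> bool) \<Rightarrow> nat \<Rightarrow> real" where
  "lcm_loss \<xi> n = (\<Sum>p | prime p \<and> p \<le> n. \<Sum>s=1..n. ln (real p) * real (gaps_mult \<xi> n (p ^ s) - 1))"

text \<open>The last part \<open>a\<close> raises the count for \<open>q\<close> by at most one, and
  only if \<open>q\<close> divides \<open>a\<close>; weighted by \<open>ln p\<close> over all prime
  powers this amounts to \<open>ln a\<close>. The rest is the loss from complete gaps, taken without
  cutoff so that the bound is uniform in \<open>t\<close>.\<close>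

lemma ln_prod_parts_minus_ln_lcm_parts:
  assumes n: "n \<ge> 1" and t: "t \<le> 1" and one: "\<xi> 1"
  defines "\<alpha> \<equiv> feller_partition n n \<xi>"
  shows "0 \<le> ln (real (prod_parts n \<alpha> t)) - ln (real (lcm_parts n \<alpha> t))"
    and "ln (real (prod_parts n \<alpha> t)) - ln (real (lcm_parts n \<alpha> t)) \<le> lcm_loss \<xi> n + ln (real n)"
proof -
  let ?A = "{i. 1 \<le> i \<and> real i \<le> real n powr t}"
  have "real n powr t \<le> real n powr 1" using n t by (intro powr_mono) auto
  then have A: "?A \<subseteq> {1..n}" using n by auto
  have lcm: "lcm_parts n \<alpha> t = Lcm {i\<in>?A. \<alpha> i > 0}"
    unfolding lcm_parts_def by (rule arg_cong[of _ _ Lcm]) auto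
  note diff = ln_prod_minus_ln_Lcm[OF A, of \<alpha>]
  show "0 \<le> ln (real (prod_parts n \<alpha> t)) - ln (real (lcm_parts n \<alpha> t))"
    unfolding lcm prod_parts_def by (rule diff(1))
  obtain a where a: "a \<in> {1..n}" "\<And>f :: nat \<Rightarrow> real. (\<Sum>i=1..n. of_bool (last_one \<xi> n (n - i + 1)) * f i) = f a"
    using sum_last_one[of n \<xi>, OF n one] by blast
  have D: "real (multiples ?A \<alpha> q - 1) \<le> real (gaps_mult \<xi> n q - 1) + of_bool (q dvd a)" for q
  proof -
    have "multiples ?A \<alpha> q \<le> (\<Sum>i | i \<in> {1..n} \<and> q dvd i. \<alpha> i)"
      unfolding multiples_def using A by (intro sum_mono2) auto
    then have "real (multiples ?A \<alpha> q) \<le> real (\<Sum>i | i \<in> {1..n} \<and> q dvd i. \<alpha> i)" by (rule of_nat_mono)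
    also have "\<dots> = (\<Sum>i=1..n. real (feller_count \<xi> n i) * of_bool (q dvd i))"
      unfolding of_nat_sum \<alpha>_def by (intro sum.mono_neutral_cong_left) (auto simp: feller_partition_def)
    also have "\<dots> = (\<Sum>(j, i)\<in>gaps \<xi> n. of_bool (q dvd i)) + of_bool (q dvd a)"
      unfolding sum_feller_count a(2) ..
    also have "(\<Sum>(j, i)\<in>gaps \<xi> n. of_bool (q dvd i)) = (\<Sum>z\<in>{(j, i)\<in>gaps \<xi> n. q dvd i}. 1 :: real)"
      by (rule sum.mono_neutral_cong_right) auto
    also have "\<dots> = real (gaps_mult \<xi> n q)" by (simp add: gaps_mult_def)
    finally have "real (multiples ?A \<alpha> q) \<le> real (gaps_mult \<xi> n q + of_bool (q dvd a))" by simp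
    then have "multiples ?A \<alpha> q \<le> gaps_mult \<xi> n q + of_bool (q dvd a)" by (simp only: of_nat_le_iff)
    then have "multiples ?A \<alpha> q - 1 \<le> (gaps_mult \<xi> n q - 1) + of_bool (q dvd a)" by (auto simp: of_bool_def)
    then have "real (multiples ?A \<alpha> q - 1) \<le> real ((gaps_mult \<xi> n q - 1) + of_bool (q dvd a))" by (rule of_nat_mono)
    then show ?thesis by simp
  qed
  have "ln (real (prod_parts n \<alpha> t)) - ln (real (lcm_parts n \<alpha> t)) \<le>
      (\<Sum>p | prime p \<and> p \<le> n. \<Sum>s=1..n. ln (real p) * real (multiples ?A \<alpha> (p ^ s) - 1))"
    unfolding lcm prod_parts_def by (rule diff(2))
  also have "\<dots> \<le> (\<Sum>p | prime p \<and> p \<le> n. \<Sum>s=1..n. ln (real p) * (real (gaps_mult \<xi> n (p ^ s) - 1) + of_bool (p ^ s dvd a)))"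
    by (intro sum_mono mult_left_mono D) (auto simp: prime_gt_0_nat Suc_leI)
  also have "\<dots> = lcm_loss \<xi> n + (\<Sum>p | prime p \<and> p \<le> n. \<Sum>s=1..n. ln (real p) * of_bool (p ^ s dvd a))"
    by (simp only: lcm_loss_def distrib_left sum.distrib)
  also have "\<dots> = lcm_loss \<xi> n + ln (real a)" by (simp only: sum_ln_prime_powers_le[OF a(1)])
  also have "\<dots> \<le> lcm_loss \<xi> n + ln (real n)" using a(1) by simp
  finally show "ln (real (prod_parts n \<alpha> t)) - ln (real (lcm_parts n \<alpha> t)) \<le> lcm_loss \<xi> n + ln (real n)" .
qed

section \<open>Probabilities of gaps\<close>

context
  fixes \<theta> :: real
  assumes \<theta>: "\<theta> > 0"
begin

text \<open>Probability that the first one after \<open>j\<close> stands at \<open>j + i\<close>;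
  the factor for a one at \<open>j\<close> itself is kept apart.\<close>

definition gap_prob :: "nat \<Rightarrow> nat \<Rightarrow> real" where
  "gap_prob j i = feller_prob \<theta> (j + i) * (\<Prod>k\<in>{j<..<j + i}. 1 - feller_prob \<theta> k)"

lemma prod_prob_bounds: "1 \<le> j \<Longrightarrow> 0 \<le> (\<Prod>k\<in>{j<..<m}. 1 - feller_prob \<theta> k)"
  by (intro prod_nonneg) (use feller_prob_bounds[OF \<theta>] in auto)

lemma gap_prob_nonneg: "1 \<le> j \<Longrightarrow> 0 \<le> gap_prob j i"
  unfolding gap_prob_def by (intro mult_nonneg_nonneg prod_prob_bounds feller_prob_bounds[OF \<theta>]) auto

text \<open>One more step adds a factor at most 1 for a zero and replaces a success probability by
  the next, smaller one. Monotonicity is what controls the mass on multiples of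
  \<open>q\<close>.\<close>

lemma gap_prob_antimono:
  assumes "1 \<le> j" "1 \<le> i"
  shows "gap_prob j (Suc i) \<le> gap_prob j i"
proof -
  have "{j<..<j + Suc i} = insert (j + i) {j<..<j + i}" using assms by auto
  then have "gap_prob j (Suc i) = (feller_prob \<theta> (Suc (j + i)) * (1 - feller_prob \<theta> (j + i))) * (\<Prod>k\<in>{j<..<j + i}. 1 - feller_prob \<theta> k)"
    by (simp add: gap_prob_def)
  also have "\<dots> \<le> (feller_prob \<theta> (j + i) * 1) * (\<Prod>k\<in>{j<..<j + i}. 1 - feller_prob \<theta> k)"
    using assms feller_prob_bounds[OF \<theta>, of "j + i"] feller_prob_antimono[OF \<theta>, of "j + i"]
    by (intro mult_right_mono mult_mono prod_prob_bounds) auto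
  finally show ?thesis by (simp add: gap_prob_def)
qed

text \<open>The complementary event is that none of the \<open>N\<close> positions after
  \<open>j\<close> carries a one.\<close>

lemma sum_gap_prob: "(\<Sum>i=1..N. gap_prob j i) = 1 - (\<Prod>k\<in>{j<..j + N}. 1 - feller_prob \<theta> k)"
proof (induction N)
  case (Suc N)
  have "{j<..j + Suc N} = insert (j + Suc N) {j<..j + N}" "{j<..<j + Suc N} = {j<..j + N}" by auto
  then show ?case using Suc.IH by (simp add: gap_prob_def algebra_simps)
qed simp

lemma sum_mults_gap_prob_le:
  assumes "1 \<le> j" "q \<ge> 1"
  shows "(\<Sum>i\<in>mults q N. gap_prob j i) \<le> 1 / real q"
proof (rule sum_mults_antimono_le)
  show "(\<Sum>i=1..N. gap_prob j i) \<le> 1" for N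
  proof -
    have "0 \<le> (\<Prod>k\<in>{j<..j + N}. 1 - feller_prob \<theta> k)"
      by (intro prod_nonneg) (use feller_prob_bounds(2)[OF \<theta>] in auto)
    then show ?thesis unfolding sum_gap_prob by simp
  qed
qed (use assms gap_prob_nonneg gap_prob_antimono in auto)

lemma next_one_depends: "depends_on {j<..j + i} (\<lambda>\<xi>. next_one \<xi> j i)" if "i \<ge> 1"
  using that by (auto simp: depends_on_def next_one_def)

lemma prob_next_one:
  assumes "1 \<le> j" "1 \<le> i" "j + i \<le> n"
  shows "EE (feller_pmf \<theta> n) (\<lambda>\<xi>. of_bool (next_one \<xi> j i)) = gap_prob j i"
proof -
  let ?g = "\<lambda>k (b::bool). if k = j + i then of_bool b else of_bool (\<not> b) :: real"
  have prod: "(\<Prod>k\<in>A. of_bool (P k)) = (of_bool (\<forall>k\<in>A. P k) :: real)" if "finite A" for A and P :: "nat \<Rightarrow> bool"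
    using that by (induction A rule: finite_induct) auto
  have ins: "{j<..j + i} = insert (j + i) {j<..<j + i}" using assms by auto
  have "(of_bool (next_one \<xi> j i) :: real) = (\<Prod>k\<in>{j<..j + i}. ?g k (\<xi> k))" for \<xi>
  proof -
    have "(\<Prod>k\<in>{j<..j + i}. ?g k (\<xi> k)) = of_bool (\<xi> (j + i)) * (\<Prod>k\<in>{j<..<j + i}. ?g k (\<xi> k))"
      unfolding ins by simp
    also have "(\<Prod>k\<in>{j<..<j + i}. ?g k (\<xi> k)) = (\<Prod>k\<in>{j<..<j + i}. of_bool (\<not> \<xi> k))"
      by (intro prod.cong) auto
    also have "of_bool (\<xi> (j + i)) * \<dots> = of_bool (next_one \<xi> j i)"
      by (simp add: prod next_one_def)
    finally show ?thesis ..
  qed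
  then have "EE (feller_pmf \<theta> n) (\<lambda>\<xi>. of_bool (next_one \<xi> j i)) = EE (feller_pmf \<theta> n) (\<lambda>\<xi>. \<Prod>k\<in>{j<..j + i}. ?g k (\<xi> k))"
    by (simp only:)
  also have "\<dots> = (\<Prod>k\<in>{j<..j + i}. EE (feller_pmf \<theta> n) (\<lambda>\<xi>. ?g k (\<xi> k)))"
    using assms by (intro feller_pmf_prod[OF \<theta>]) auto
  also have "\<dots> = (\<Prod>k\<in>{j<..j + i}. if k = j + i then feller_prob \<theta> k else 1 - feller_prob \<theta> k)"
    using assms by (intro prod.cong refl) (subst feller_pmf_single[OF \<theta>], auto)
  also have "\<dots> = gap_prob j i"
  proof -
    have "(\<Prod>k\<in>{j<..<j + i}. if k = j + i then feller_prob \<theta> k else 1 - feller_prob \<theta> k) =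
      (\<Prod>k\<in>{j<..<j + i}. 1 - feller_prob \<theta> k)" by (intro prod.cong) auto
    then show ?thesis unfolding ins gap_prob_def by simp
  qed
  finally show ?thesis .
qed

lemma prob_one: "k \<in> {1..n} \<Longrightarrow> EE (feller_pmf \<theta> n) (\<lambda>\<xi>. of_bool (\<xi> k)) = feller_prob \<theta> k"
  by (subst feller_pmf_single[OF \<theta>]) auto

lemma prob_gap:
  assumes "1 \<le> j" "1 \<le> i" "j + i \<le> n"
  shows "EE (feller_pmf \<theta> n) (\<lambda>\<xi>. of_bool (\<xi> j) * of_bool (next_one \<xi> j i)) = feller_prob \<theta> j * gap_prob j i"
proof -
  have "EE (feller_pmf \<theta> n) (\<lambda>\<xi>. of_bool (\<xi> j) * of_bool (next_one \<xi> j i)) =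
    EE (feller_pmf \<theta> n) (\<lambda>\<xi>. of_bool (\<xi> j)) * EE (feller_pmf \<theta> n) (\<lambda>\<xi>. of_bool (next_one \<xi> j i))"
    by (rule feller_pmf_mult[OF \<theta>, where A = "{j}" and B = "{j<..j + i}"])
       (use assms next_one_depends[of i j] in \<open>auto simp: depends_on_def\<close>)
  then show ?thesis using assms prob_one[of j n] prob_next_one by simp
qed

definition mean_ones :: "nat \<Rightarrow> real" where
  "mean_ones n = (\<Sum>k=1..n. feller_prob \<theta> k)"

lemma mean_ones_nonneg: "mean_ones n \<ge> 0"
  unfolding mean_ones_def by (intro sum_nonneg) (use feller_prob_bounds[OF \<theta>] in auto)

lemma expectation_ones: "EE (feller_pmf \<theta> n) (\<lambda>\<xi>. \<Sum>k=1..n. of_bool (\<xi> k)) = mean_ones n"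
  unfolding mean_ones_def by (subst EE_sum[OF finite_feller_pmf[OF \<theta>]]) (auto simp: prob_one intro!: sum.cong)

lemma gap_sum_le:
  assumes "q \<ge> 1" "J \<subseteq> {1..n}"
  shows "(\<Sum>j\<in>J. \<Sum>i\<in>mults q (n - j). feller_prob \<theta> j * gap_prob j i) \<le> mean_ones n / real q"
proof -
  have "(\<Sum>j\<in>J. \<Sum>i\<in>mults q (n - j). feller_prob \<theta> j * gap_prob j i) \<le> (\<Sum>j\<in>J. feller_prob \<theta> j * (1 / real q))"
    unfolding sum_distrib_left[symmetric] using assms
    by (intro sum_mono mult_left_mono sum_mults_gap_prob_le feller_prob_bounds[OF \<theta>]) auto
  also have "\<dots> \<le> (\<Sum>j=1..n. feller_prob \<theta> j * (1 / real q))"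
    using assms feller_prob_bounds[OF \<theta>] by (intro sum_mono2 mult_nonneg_nonneg) auto
  also have "\<dots> = mean_ones n / real q" by (simp add: mean_ones_def sum_divide_distrib)
  finally show ?thesis .
qed

lemma expectation_gaps_mult_le:
  assumes "q \<ge> 1"
  shows "EE (feller_pmf \<theta> n) (\<lambda>\<xi>. real (gaps_mult \<xi> n q)) \<le> mean_ones n / real q"
proof -
  have "EE (feller_pmf \<theta> n) (\<lambda>\<xi>. real (gaps_mult \<xi> n q)) = (\<Sum>j=1..n. \<Sum>i\<in>mults q (n - j). feller_prob \<theta> j * gap_prob j i)"
    unfolding gaps_mult_eq_sum
    by (simp only: EE_sum[OF finite_feller_pmf[OF \<theta>]]) (auto intro!: sum.cong prob_gap simp: mults_def)
  also have "\<dots> \<le> mean_ones n / real q" using assms by (intro gap_sum_le) auto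
  finally show ?thesis .
qed

lemma later_gaps_depends:
  "depends_on {s<..n} (\<lambda>\<xi>. later_gaps \<xi> n q s)"
  unfolding depends_on_def
proof (intro allI impI)
  fix \<xi> \<xi>' :: "nat \<Rightarrow> bool" assume eq: "\<forall>i\<in>{s<..n}. \<xi> i = \<xi>' i"
  have "next_one \<xi> j i = next_one \<xi>' j i" if "s \<le> j" "i \<in> mults q (n - j)" for j i
    by (rule depends_onD[OF next_one_depends]) (use that eq in \<open>auto simp: mults_def\<close>)
  then show "later_gaps \<xi> n q s = later_gaps \<xi>' n q s"
    unfolding later_gaps_def using eq by (intro arg_cong2[where f = "(+)"] sum.cong) auto
qed

lemma expectation_later_gaps_le:
  assumes "q \<ge> 1" "1 \<le> s" "s \<le> n"
  shows "EE (feller_pmf \<theta> n) (\<lambda>\<xi>. later_gaps \<xi> n q s) \<le> (1 + mean_ones n) / real q"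
proof -
  have "EE (feller_pmf \<theta> n) (\<lambda>\<xi>. later_gaps \<xi> n q s) =
     (\<Sum>i\<in>mults q (n - s). gap_prob s i) + (\<Sum>j\<in>{s<..n}. \<Sum>i\<in>mults q (n - j). feller_prob \<theta> j * gap_prob j i)"
    unfolding later_gaps_def using assms
    by (simp only: EE_sum[OF finite_feller_pmf[OF \<theta>]] EE_add[OF finite_feller_pmf[OF \<theta>]])
       (intro arg_cong2[where f = "(+)"] sum.cong prob_gap prob_next_one refl, auto simp: mults_def)
  also have "\<dots> \<le> 1 / real q + mean_ones n / real q"
    using assms by (intro add_mono gap_sum_le sum_mults_gap_prob_le) auto
  finally show ?thesis by (simp add: add_divide_distrib)
qed

text \<open>The first gap reads the coordinates \<open>{j..j + i}\<close> and the later gaps those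
  after \<open>j + i\<close>, so every term factors; each of the two factors contributes one
  \<open>1 / q\<close>.\<close>

lemma expectation_gaps_mult_minus_one_le_square:
  assumes q: "q \<ge> 1"
  shows "EE (feller_pmf \<theta> n) (\<lambda>\<xi>. real (gaps_mult \<xi> n q - 1)) \<le> mean_ones n / real q * ((1 + mean_ones n) / real q)"
proof -
  note fs = finite_feller_pmf[OF \<theta>, of n]
  have "EE (feller_pmf \<theta> n) (\<lambda>\<xi>. real (gaps_mult \<xi> n q - 1)) \<le>
     EE (feller_pmf \<theta> n) (\<lambda>\<xi>. \<Sum>j=1..n. \<Sum>i\<in>mults q (n - j). (of_bool (\<xi> j) * of_bool (next_one \<xi> j i)) * later_gaps \<xi> n q (j + i))"
    by (intro EE_mono[OF fs] gaps_mult_minus_one_le)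
  also have "\<dots> = (\<Sum>j=1..n. \<Sum>i\<in>mults q (n - j). EE (feller_pmf \<theta> n) (\<lambda>\<xi>. (of_bool (\<xi> j) * of_bool (next_one \<xi> j i)) * later_gaps \<xi> n q (j + i)))"
    by (simp only: EE_sum[OF fs])
  also have "\<dots> \<le> (\<Sum>j=1..n. \<Sum>i\<in>mults q (n - j). feller_prob \<theta> j * gap_prob j i * ((1 + mean_ones n) / real q))"
  proof (intro sum_mono)
    fix j i assume j: "j \<in> {1..n}" and i: "i \<in> mults q (n - j)"
    have ji: "1 \<le> i" "j + i \<le> n" using i j by (auto simp: mults_def)
    have dep: "depends_on {j..j + i} (\<lambda>\<xi>. of_bool (\<xi> j) * of_bool (next_one \<xi> j i) :: real)"
      using ji by (auto simp: depends_on_def next_one_def)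
    have "EE (feller_pmf \<theta> n) (\<lambda>\<xi>. (of_bool (\<xi> j) * of_bool (next_one \<xi> j i)) * later_gaps \<xi> n q (j + i)) =
      EE (feller_pmf \<theta> n) (\<lambda>\<xi>. of_bool (\<xi> j) * of_bool (next_one \<xi> j i)) * EE (feller_pmf \<theta> n) (\<lambda>\<xi>. later_gaps \<xi> n q (j + i))"
      by (rule feller_pmf_mult[OF \<theta> dep later_gaps_depends]) (use j ji in auto)
    also have "\<dots> \<le> feller_prob \<theta> j * gap_prob j i * ((1 + mean_ones n) / real q)"
    proof -
      have "0 \<le> feller_prob \<theta> j * gap_prob j i"
        using j gap_prob_nonneg[of j i] feller_prob_bounds[OF \<theta>, of j] by simp
      moreover have "EE (feller_pmf \<theta> n) (\<lambda>\<xi>. later_gaps \<xi> n q (j + i)) \<le> (1 + mean_ones n) / real q"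
        using j ji q by (intro expectation_later_gaps_le) auto
      ultimately show ?thesis using j ji prob_gap[of j i n] by (simp only: mult_left_mono atLeastAtMost_iff)
    qed
    finally show "EE (feller_pmf \<theta> n) (\<lambda>\<xi>. (of_bool (\<xi> j) * of_bool (next_one \<xi> j i)) * later_gaps \<xi> n q (j + i)) \<le>
       feller_prob \<theta> j * gap_prob j i * ((1 + mean_ones n) / real q)" .
  qed
  also have "\<dots> = (\<Sum>j=1..n. \<Sum>i\<in>mults q (n - j). feller_prob \<theta> j * gap_prob j i) * ((1 + mean_ones n) / real q)"
    by (simp only: sum_distrib_right)
  also have "\<dots> \<le> mean_ones n / real q * ((1 + mean_ones n) / real q)"
    using q mean_ones_nonneg by (intro mult_right_mono gap_sum_le) auto
  finally show ?thesis .
qed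

text \<open>The first and second moment bounds are \<open>y\<close> and \<open>y\<^sup>2\<close> with \<open>y = (1 + mean_ones n) / q\<close>; an
  exponent strictly between 1 and \<open>3 / 2\<close> makes the sum over \<open>q\<close> converge and keeps the power of
  \<open>mean_ones n\<close>, which is of order \<open>log n\<close>, below \<open>3 / 2\<close>.\<close>

lemma expectation_gaps_mult_minus_one_le:
  assumes q: "q \<ge> 1"
  shows "EE (feller_pmf \<theta> n) (\<lambda>\<xi>. real (gaps_mult \<xi> n q - 1)) \<le> (1 + mean_ones n) powr (5 / 4) * real q powr (- (5 / 4))"
proof -
  define y where "y = (1 + mean_ones n) / real q"
  have y: "y > 0" using q mean_ones_nonneg[of n] by (auto simp: y_def intro!: divide_pos_pos)
  have le: "mean_ones n / real q \<le> y" unfolding y_def by (intro divide_right_mono) auto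
  have "EE (feller_pmf \<theta> n) (\<lambda>\<xi>. real (gaps_mult \<xi> n q - 1)) \<le> EE (feller_pmf \<theta> n) (\<lambda>\<xi>. real (gaps_mult \<xi> n q))"
    by (intro EE_mono finite_feller_pmf[OF \<theta>]) auto
  then have 1: "EE (feller_pmf \<theta> n) (\<lambda>\<xi>. real (gaps_mult \<xi> n q - 1)) \<le> y"
    using expectation_gaps_mult_le[OF q, of n] le by linarith
  have "mean_ones n / real q * y \<le> y * y" using le y by (intro mult_right_mono) auto
  then have 2: "EE (feller_pmf \<theta> n) (\<lambda>\<xi>. real (gaps_mult \<xi> n q - 1)) \<le> y * y"
    using expectation_gaps_mult_minus_one_le_square[OF q, of n] by (simp add: y_def)
  have "min y (y * y) \<le> y powr (5 / 4)"
  proof (cases "y \<ge> 1")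
    case True
    then have "y powr 1 \<le> y powr (5 / 4)" by (intro powr_mono) auto
    then show ?thesis using y by simp
  next
    case False
    then have "y powr 2 \<le> y powr (5 / 4)" using y by (intro powr_mono') auto
    then show ?thesis using y by (simp add: power2_eq_square min.coboundedI2)
  qed
  also have "\<dots> = (1 + mean_ones n) powr (5 / 4) * real q powr (- (5 / 4))"
    unfolding y_def using mean_ones_nonneg[of n] by (simp add: powr_divide powr_minus_divide)
  finally show ?thesis using 1 2 by linarith
qed

lemma expectation_lcm_loss_le:
  assumes C: "\<And>n. (\<Sum>p | prime p \<and> p \<le> n. \<Sum>s=1..n. ln (real p) * real (p ^ s) powr (- (5 / 4))) \<le> C"
  shows "EE (feller_pmf \<theta> n) (\<lambda>\<xi>. lcm_loss \<xi> n) \<le> C * (1 + mean_ones n) powr (5 / 4)"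
proof -
  note fs = finite_feller_pmf[OF \<theta>, of n]
  have "EE (feller_pmf \<theta> n) (\<lambda>\<xi>. lcm_loss \<xi> n) =
     (\<Sum>p | prime p \<and> p \<le> n. \<Sum>s=1..n. ln (real p) * EE (feller_pmf \<theta> n) (\<lambda>\<xi>. real (gaps_mult \<xi> n (p ^ s) - 1)))"
    unfolding lcm_loss_def by (simp only: EE_sum[OF fs] integral_mult_right_zero)
  also have "\<dots> \<le> (\<Sum>p | prime p \<and> p \<le> n. \<Sum>s=1..n. ln (real p) * ((1 + mean_ones n) powr (5 / 4) * real (p ^ s) powr (- (5 / 4))))"
  proof (intro sum_mono mult_left_mono expectation_gaps_mult_minus_one_le)
    fix p s :: nat assume "p \<in> {p. prime p \<and> p \<le> n}"
    then have "p \<ge> 1" using prime_ge_1_nat by auto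
    then show "1 \<le> p ^ s" "0 \<le> ln (real p)" by auto
  qed
  also have "\<dots> = (\<Sum>p | prime p \<and> p \<le> n. \<Sum>s=1..n. ln (real p) * real (p ^ s) powr (- (5 / 4))) * (1 + mean_ones n) powr (5 / 4)"
    by (simp add: sum_distrib_left sum_distrib_right mult_ac)
  also have "\<dots> \<le> C * (1 + mean_ones n) powr (5 / 4)" by (intro mult_right_mono C) auto
  finally show ?thesis .
qed

definition short_gap :: "(nat \<Rightarrow> bool) \<Rightarrow> nat \<Rightarrow> real \<Rightarrow> bool" where
  "short_gap \<xi> n L \<longleftrightarrow> (\<exists>(j, i)\<in>gaps \<xi> n. L * real i < real (j + i))"

text \<open>Union bound over pairs of ones at \<open>k - i\<close> and \<open>k\<close> with
  \<open>i < k / L\<close>, ignoring the zeros between them. As \<open>L \<ge> 2\<close>, both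
  positions are at least \<open>k / 2\<close>, so each pair has probability of order
  \<open>1 / k^2\<close>; there are at most \<open>k / L\<close> choices of \<open>i\<close>, and
  the harmonic sum gives the logarithm.\<close>

lemma prob_short_gap_le:
  assumes L: "L \<ge> 2" and n: "n \<ge> 1"
  shows "EE (feller_pmf \<theta> n) (\<lambda>\<xi>. of_bool (short_gap \<xi> n L)) \<le> 2 * (max 1 \<theta>)\<^sup>2 * (1 + ln (real n)) / L"
proof -
  note fs = finite_feller_pmf[OF \<theta>, of n]
  let ?C = "max 1 \<theta>"
  let ?I = "\<lambda>k. {i\<in>{1..<k}. L * real i < real k}"
  have "of_bool (short_gap \<xi> n L) \<le> (\<Sum>k=1..n. \<Sum>i\<in>?I k. of_bool (\<xi> (k - i)) * of_bool (\<xi> k) :: real)" for \<xi>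
  proof (cases "short_gap \<xi> n L")
    case True
    then obtain j i where g: "(j, i) \<in> gaps \<xi> n" "L * real i < real (j + i)" by (auto simp: short_gap_def)
    then have ji: "1 \<le> j" "1 \<le> i" "j + i \<le> n" "\<xi> j" "\<xi> (j + i)" by (auto simp: gaps_def gap_def)
    have "1 = (of_bool (\<xi> (j + i - i)) * of_bool (\<xi> (j + i)) :: real)" using ji by simp
    also have "\<dots> \<le> (\<Sum>i'\<in>?I (j + i). of_bool (\<xi> (j + i - i')) * of_bool (\<xi> (j + i)))"
      using ji g by (intro member_le_sum[where f = "\<lambda>i'. of_bool (\<xi> (j + i - i')) * of_bool (\<xi> (j + i))"]) auto
    also have "\<dots> \<le> (\<Sum>k=1..n. \<Sum>i\<in>?I k. of_bool (\<xi> (k - i)) * of_bool (\<xi> k))"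
      using ji by (intro member_le_sum[where f = "\<lambda>k. \<Sum>i\<in>?I k. of_bool (\<xi> (k - i)) * of_bool (\<xi> k)"]) (auto intro!: sum_nonneg)
    finally show ?thesis using True by simp
  qed (auto intro!: sum_nonneg)
  then have "EE (feller_pmf \<theta> n) (\<lambda>\<xi>. of_bool (short_gap \<xi> n L)) \<le>
     EE (feller_pmf \<theta> n) (\<lambda>\<xi>. \<Sum>k=1..n. \<Sum>i\<in>?I k. of_bool (\<xi> (k - i)) * of_bool (\<xi> k))"
    by (intro EE_mono[OF fs])
  also have "\<dots> = (\<Sum>k=1..n. \<Sum>i\<in>?I k. EE (feller_pmf \<theta> n) (\<lambda>\<xi>. of_bool (\<xi> (k - i)) * of_bool (\<xi> k)))"
    by (simp only: EE_sum[OF fs])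
  also have "\<dots> \<le> (\<Sum>k=1..n. 2 * ?C\<^sup>2 / L * (1 / real k))"
  proof (rule sum_mono)
    fix k assume k: "k \<in> {1..n}"
    have "(\<Sum>i\<in>?I k. EE (feller_pmf \<theta> n) (\<lambda>\<xi>. of_bool (\<xi> (k - i)) * of_bool (\<xi> k))) \<le> (\<Sum>i\<in>?I k. 2 * ?C\<^sup>2 / (real k)\<^sup>2)"
    proof (rule sum_mono)
      fix i assume i: "i \<in> ?I k"
      have "2 * real i \<le> L * real i" using L by (intro mult_right_mono) auto
      moreover have "L * real i < real k" "i < k" using i by auto
      ultimately have half: "real k / 2 \<le> real (k - i)" by (simp add: of_nat_diff)
      have "EE (feller_pmf \<theta> n) (\<lambda>\<xi>. of_bool (\<xi> (k - i)) * of_bool (\<xi> k)) =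
        EE (feller_pmf \<theta> n) (\<lambda>\<xi>. of_bool (\<xi> (k - i))) * EE (feller_pmf \<theta> n) (\<lambda>\<xi>. of_bool (\<xi> k))"
        by (rule feller_pmf_mult[OF \<theta>, where A = "{k - i}" and B = "{k}"])
           (use i k in \<open>auto simp: depends_on_def\<close>)
      also have "\<dots> = feller_prob \<theta> (k - i) * feller_prob \<theta> k"
      proof -
        have "k - i \<in> {1..n}" using i k by auto
        then show ?thesis using k by (simp only: prob_one)
      qed
      also have "\<dots> \<le> (?C / (real k / 2)) * (?C / real k)"
      proof (intro mult_mono)
        have "feller_prob \<theta> (k - i) \<le> ?C / real (k - i)" using i by (intro feller_prob_le[OF \<theta>]) auto
        also have "\<dots> \<le> ?C / (real k / 2)" using half k by (intro divide_left_mono) auto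
        finally show "feller_prob \<theta> (k - i) \<le> ?C / (real k / 2)" .
        show "feller_prob \<theta> k \<le> ?C / real k" using k by (intro feller_prob_le[OF \<theta>]) auto
        show "0 \<le> feller_prob \<theta> k" using k feller_prob_bounds[OF \<theta>] by auto
        show "0 \<le> ?C / (real k / 2)" by (intro divide_nonneg_nonneg) auto
      qed
      also have "\<dots> = 2 * ?C\<^sup>2 / (real k)\<^sup>2" by (simp add: power2_eq_square)
      finally show "EE (feller_pmf \<theta> n) (\<lambda>\<xi>. of_bool (\<xi> (k - i)) * of_bool (\<xi> k)) \<le> 2 * ?C\<^sup>2 / (real k)\<^sup>2" .
    qed
    also have "\<dots> = real (card (?I k)) * (2 * ?C\<^sup>2 / (real k)\<^sup>2)" by simp
    also have "\<dots> \<le> (real k / L) * (2 * ?C\<^sup>2 / (real k)\<^sup>2)"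
    proof (rule mult_right_mono)
      have "card (?I k) \<le> card {1..nat \<lfloor>real k / L\<rfloor>}"
      proof (rule card_mono)
        show "?I k \<subseteq> {1..nat \<lfloor>real k / L\<rfloor>}"
        proof
          fix i assume i: "i \<in> ?I k"
          then have "real i \<le> real k / L" using L by (simp add: field_simps)
          then show "i \<in> {1..nat \<lfloor>real k / L\<rfloor>}" using i by (auto simp: le_nat_floor)
        qed
      qed auto
      then have "real (card (?I k)) \<le> real (nat \<lfloor>real k / L\<rfloor>)" by simp
      also have "\<dots> \<le> real k / L" using L by (intro of_nat_floor) auto
      finally show "real (card (?I k)) \<le> real k / L" .
    qed auto
    also have "\<dots> = 2 * ?C\<^sup>2 / L * (1 / real k)" using k by (simp add: power2_eq_square)
    finally show "(\<Sum>i\<in>?I k. EE (feller_pmf \<theta> n) (\<lambda>\<xi>. of_bool (\<xi> (k - i)) * of_bool (\<xi> k))) \<le> 2 * ?C\<^sup>2 / L * (1 / real k)" .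
  qed
  also have "\<dots> \<le> 2 * ?C\<^sup>2 / L * (1 + ln (real n))"
    unfolding sum_distrib_left[symmetric] using L by (intro mult_left_mono harmonic_sum_le n) auto
  finally show ?thesis by simp
qed

end

section \<open>Oscillation of the centred sums\<close>

definition cent :: "real \<Rightarrow> nat \<Rightarrow> bool \<Rightarrow> real" where
  "cent \<theta> j b = (of_bool b - feller_prob \<theta> j) * ln (real j)"

text \<open>Asymptotic standard deviation of the sum of \<open>\<xi> j * ln j\<close> over
  \<open>j \<le> n\<close>: the variance behaves like the integral of
  \<open>\<theta> * (ln x)^2 / x\<close>.\<close>

definition sdev :: "real \<Rightarrow> nat \<Rightarrow> real" where
  "sdev \<theta> n = sqrt (\<theta> * ln (real n) ^ 3 / 3)"

text \<open>Equidistant in \<open>t\<close>, hence geometric in the position. The first grid point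
  is 1, where the centred summand vanishes because \<open>ln 1 = 0\<close>.\<close>

definition gridpt :: "nat \<Rightarrow> nat \<Rightarrow> nat \<Rightarrow> nat" where
  "gridpt n k b = nat \<lfloor>real n powr (real b / real k)\<rfloor>"

lemma gridpt_mono:
  assumes "n \<ge> 1" "a \<le> b"
  shows "gridpt n k a \<le> gridpt n k b"
  unfolding gridpt_def using assms by (intro nat_mono floor_mono powr_mono divide_right_mono) auto

lemma gridpt_0: "n \<ge> 1 \<Longrightarrow> gridpt n k 0 = 1"
  by (simp add: gridpt_def)

lemma gridpt_end: "n \<ge> 1 \<Longrightarrow> k \<ge> 1 \<Longrightarrow> gridpt n k k = n"
  by (simp add: gridpt_def)

lemma gridpt_le: "n \<ge> 1 \<Longrightarrow> k \<ge> 1 \<Longrightarrow> b \<le> k \<Longrightarrow> gridpt n k b \<le> n"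
  using gridpt_mono[of n b k k] gridpt_end[of n k] by simp

lemma filterlim_ln_real_at_top: "filterlim (\<lambda>n. ln (real n)) at_top sequentially"
  by real_asymp

context
  fixes \<theta> :: real
  assumes \<theta>: "\<theta> > 0"
begin

lemma sdev_pos: "n \<ge> 2 \<Longrightarrow> sdev \<theta> n > 0"
  using \<theta> by (simp add: sdev_def)

lemma sdev_nonneg: "sdev \<theta> n \<ge> 0"
proof (cases "n = 0")
  case False
  then show ?thesis using \<theta> by (simp add: sdev_def)
qed (simp add: sdev_def)

lemma sdev_square: "n \<ge> 1 \<Longrightarrow> (sdev \<theta> n)\<^sup>2 = \<theta> * ln (real n) ^ 3 / 3"
  using \<theta> by (simp add: sdev_def)

lemma cent_mean: "j \<in> {1..n} \<Longrightarrow> EE (feller_pmf \<theta> n) (\<lambda>\<xi>. cent \<theta> j (\<xi> j)) = 0"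
  by (subst feller_pmf_single[OF \<theta>]) (auto simp: cent_def algebra_simps)

lemma cent_variance: "j \<in> {1..n} \<Longrightarrow> EE (feller_pmf \<theta> n) (\<lambda>\<xi>. (cent \<theta> j (\<xi> j))\<^sup>2) =
    feller_prob \<theta> j * (1 - feller_prob \<theta> j) * ln (real j) ^ 2"
  by (subst feller_pmf_single[OF \<theta>]) (auto simp: cent_def power_mult_distrib power2_eq_square algebra_simps)

lemma cent_abs_le:
  assumes "j \<ge> 1"
  shows "\<bar>cent \<theta> j b\<bar> \<le> ln (real j)"
proof -
  have "\<bar>of_bool b - feller_prob \<theta> j\<bar> \<le> 1" using feller_prob_bounds[OF \<theta> assms] by (auto simp: of_bool_def)
  then have "\<bar>of_bool b - feller_prob \<theta> j\<bar> * ln (real j) \<le> 1 * ln (real j)"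
    using assms by (intro mult_right_mono) auto
  then show ?thesis using assms by (simp add: cent_def abs_mult)
qed

lemma cent_fourth_moment_le:
  assumes j: "j \<in> {1..n}"
  shows "EE (feller_pmf \<theta> n) (\<lambda>\<xi>. cent \<theta> j (\<xi> j) ^ 4) \<le>
    (ln (real n))\<^sup>2 * EE (feller_pmf \<theta> n) (\<lambda>\<xi>. (cent \<theta> j (\<xi> j))\<^sup>2)"
proof -
  have "cent \<theta> j b ^ 4 \<le> (ln (real n))\<^sup>2 * (cent \<theta> j b)\<^sup>2" for b
  proof -
    have "\<bar>cent \<theta> j b\<bar> \<le> ln (real n)" using cent_abs_le[of j b] j by (auto intro: order_trans)
    then have "\<bar>cent \<theta> j b\<bar>\<^sup>2 \<le> (ln (real n))\<^sup>2" by (intro power_mono) auto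
    then have "(cent \<theta> j b)\<^sup>2 * (cent \<theta> j b)\<^sup>2 \<le> (ln (real n))\<^sup>2 * (cent \<theta> j b)\<^sup>2"
      by (intro mult_right_mono) auto
    then show ?thesis by (simp flip: power_add)
  qed
  then have "EE (feller_pmf \<theta> n) (\<lambda>\<xi>. cent \<theta> j (\<xi> j) ^ 4) \<le> EE (feller_pmf \<theta> n) (\<lambda>\<xi>. (ln (real n))\<^sup>2 * (cent \<theta> j (\<xi> j))\<^sup>2)"
    by (intro EE_mono finite_feller_pmf[OF \<theta>])
  then show ?thesis by simp
qed

text \<open>The sum is \<open>\<theta> / 3 * (t * ln n) ^ 3\<close> up to order
  \<open>(ln n)^2\<close>; division by the asymptotic variance leaves \<open>t ^ 3\<close>, the
  clock of the limiting Brownian motion.\<close>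

lemma variance_limit:
  assumes t: "t \<ge> 0"
  shows "(\<lambda>n. (\<Sum>j=1..nat \<lfloor>real n powr t\<rfloor>. feller_prob \<theta> j * (1 - feller_prob \<theta> j) * ln (real j) ^ 2) / (sdev \<theta> n)\<^sup>2) \<longlonglongrightarrow> t ^ 3"
proof -
  let ?V = "\<lambda>n. \<Sum>j=1..nat \<lfloor>real n powr t\<rfloor>. feller_prob \<theta> j * (1 - feller_prob \<theta> j) * ln (real j) ^ 2"
  \<comment> \<open>The error of \<open>sum_log_power\<close> with
    \<open>1 + t * l \<le> (1 + t) * (1 + l)\<close>, divided by
    \<open>\<theta> * l ^ 3 / 3\<close>.\<close>
  let ?K = "4 * (\<theta> + rate_const \<theta>) * (1 + t)\<^sup>2 * 3 / \<theta>"
  have "((\<lambda>n. (1 + ln (real n))\<^sup>2 / ln (real n) ^ 3) \<longlongrightarrow> 0) sequentially" by real_asymp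
  then have lim: "(\<lambda>n. ?K * ((1 + ln (real n))\<^sup>2 / ln (real n) ^ 3)) \<longlonglongrightarrow> 0"
    by (rule tendsto_mult_right_zero)
  have "(\<lambda>n. t ^ 3 - ?V n / (sdev \<theta> n)\<^sup>2) \<longlonglongrightarrow> 0"
  proof (rule Lim_null_comparison[OF _ lim])
    show "\<forall>\<^sub>F n in sequentially. norm (t ^ 3 - ?V n / (sdev \<theta> n)\<^sup>2) \<le> ?K * ((1 + ln (real n))\<^sup>2 / ln (real n) ^ 3)"
      using eventually_ge_at_top[of 2]
    proof eventually_elim
      case (elim n)
      define l where "l = ln (real n)"
      have l: "l > 0" using elim by (simp add: l_def)
      have x1: "real n powr t \<ge> 1" using elim t by (intro ge_one_powr_ge_zero) auto
      have lx: "ln (real n powr t) = t * l" using elim by (simp add: l_def ln_powr)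
      have "\<bar>?V n - \<theta> / real (Suc 2) * (t * l) ^ Suc 2\<bar> \<le> 4 * (\<theta> + rate_const \<theta>) * (1 + t * l) ^ 2"
        unfolding lx[symmetric]
        by (rule sum_log_power[OF feller_prob_approx(2)[OF \<theta>] less_imp_le[OF \<theta>] rate_const_nonneg[OF \<theta>] x1])
      also have "\<dots> \<le> 4 * (\<theta> + rate_const \<theta>) * ((1 + t) * (1 + l)) ^ 2"
      proof (intro mult_left_mono power_mono)
        show "1 + t * l \<le> (1 + t) * (1 + l)" using t l by (simp add: algebra_simps)
      qed (use \<theta> rate_const_nonneg[OF \<theta>] t l in auto)
      finally have V: "\<bar>?V n - \<theta> / 3 * (t * l) ^ 3\<bar> \<le> 4 * (\<theta> + rate_const \<theta>) * (1 + t)\<^sup>2 * (1 + l)\<^sup>2"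
        by (simp add: numeral_3_eq_3[symmetric] power_mult_distrib mult.assoc eval_nat_numeral(3)[symmetric] del: power_Suc)
      have s: "(sdev \<theta> n)\<^sup>2 = \<theta> * l ^ 3 / 3" using elim by (simp add: sdev_square l_def)
      have spos: "\<theta> * l ^ 3 / 3 > 0" using \<theta> l by simp
      have "t ^ 3 - ?V n / (sdev \<theta> n)\<^sup>2 = - ((?V n - \<theta> / 3 * (t * l) ^ 3) / (\<theta> * l ^ 3 / 3))"
        unfolding s using spos \<theta> l by (simp add: field_simps)
      then have "norm (t ^ 3 - ?V n / (sdev \<theta> n)\<^sup>2) = \<bar>?V n - \<theta> / 3 * (t * l) ^ 3\<bar> / (\<theta> * l ^ 3 / 3)"
        using spos by (simp only: real_norm_def abs_minus_cancel abs_divide abs_of_pos)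
      also have "\<dots> \<le> 4 * (\<theta> + rate_const \<theta>) * (1 + t)\<^sup>2 * (1 + l)\<^sup>2 / (\<theta> * l ^ 3 / 3)"
        using V spos by (intro divide_right_mono) auto
      also have "\<dots> = ?K * ((1 + l)\<^sup>2 / l ^ 3)" using \<theta> l by (simp add: field_simps)
      finally show ?case by (simp only: l_def)
    qed
  qed
  from tendsto_diff[OF tendsto_const[of "t ^ 3"] this] show ?thesis by simp
qed

lemma ln_square_over_variance_tendsto_0: "(\<lambda>n. (ln (real n))\<^sup>2 / (sdev \<theta> n)\<^sup>2) \<longlonglongrightarrow> 0"
  unfolding sdev_def using \<theta> by real_asymp

section \<open>Oscillation within the blocks\<close>

definition block_var :: "nat \<Rightarrow> nat \<Rightarrow> nat \<Rightarrow> real" where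
  "block_var n k b = (\<Sum>j\<in>{gridpt n k b<..gridpt n k (Suc b)}. feller_prob \<theta> j * (1 - feller_prob \<theta> j) * ln (real j) ^ 2)"

lemma block_var_limit:
  "(\<lambda>n. block_var n k b / (sdev \<theta> n)\<^sup>2) \<longlonglongrightarrow> (real (Suc b) / real k) ^ 3 - (real b / real k) ^ 3"
proof -
  let ?V = "\<lambda>n t. \<Sum>j=1..nat \<lfloor>real n powr t\<rfloor>. feller_prob \<theta> j * (1 - feller_prob \<theta> j) * ln (real j) ^ 2"
  have "(\<lambda>n. ?V n (real (Suc b) / real k) / (sdev \<theta> n)\<^sup>2 - ?V n (real b / real k) / (sdev \<theta> n)\<^sup>2)
      \<longlonglongrightarrow> (real (Suc b) / real k) ^ 3 - (real b / real k) ^ 3"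
    by (intro tendsto_diff variance_limit) auto
  then show ?thesis
  proof (rule Lim_transform_eventually)
    show "\<forall>\<^sub>F n in sequentially. ?V n (real (Suc b) / real k) / (sdev \<theta> n)\<^sup>2 - ?V n (real b / real k) / (sdev \<theta> n)\<^sup>2 =
        block_var n k b / (sdev \<theta> n)\<^sup>2"
      using eventually_ge_at_top[of 1]
    proof eventually_elim
      case (elim n)
      have "{1..gridpt n k (Suc b)} = {1..gridpt n k b} \<union> {gridpt n k b<..gridpt n k (Suc b)}"
        using gridpt_mono[OF elim, of b "Suc b" k] by auto
      then have "?V n (real (Suc b) / real k) = ?V n (real b / real k) + block_var n k b"
        unfolding block_var_def gridpt_def[symmetric] by (simp only:) (rule sum.union_disjoint, auto)
      then show ?case by (simp add: diff_divide_distrib[symmetric])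
    qed
  qed
qed

definition osc :: "nat \<Rightarrow> nat \<Rightarrow> real \<Rightarrow> (nat \<Rightarrow> bool) \<Rightarrow> bool" where
  "osc n k e \<xi> \<longleftrightarrow> (\<exists>b<k. \<exists>m\<in>{gridpt n k b..gridpt n k (Suc b)}.
     e * sdev \<theta> n \<le> \<bar>\<Sum>j\<in>{gridpt n k b<..m}. cent \<theta> j (\<xi> j)\<bar>)"

text \<open>Union bound over the blocks, maximal inequality, fourth-moment bound. Second moments
  would lead to the sum of the block variances, which does not shrink as \<open>k\<close> grows;
  here the main term is the sum of their squares.\<close>

lemma prob_osc_le:
  assumes n: "n \<ge> 2" and k: "k \<ge> 1" and e: "e > 0"
  shows "EE (feller_pmf \<theta> n) (\<lambda>\<xi>. of_bool (osc n k e \<xi>)) \<le>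
    (\<Sum>b<k. 3 * (block_var n k b / (sdev \<theta> n)\<^sup>2)\<^sup>2 + (ln (real n))\<^sup>2 / (sdev \<theta> n)\<^sup>2 * (block_var n k b / (sdev \<theta> n)\<^sup>2)) / e ^ 4"
proof -
  let ?E = "EE (feller_pmf \<theta> n)"
  let ?bad = "\<lambda>b \<xi>. \<exists>m\<in>{gridpt n k b..gridpt n k (Suc b)}. e * sdev \<theta> n \<le> \<bar>\<Sum>j\<in>{gridpt n k b<..m}. cent \<theta> j (\<xi> j)\<bar>"
  note fs = finite_feller_pmf[OF \<theta>, of n]
  have s: "sdev \<theta> n > 0" by (rule sdev_pos[OF n])
  have each: "?E (\<lambda>\<xi>. of_bool (?bad b \<xi>)) \<le>
     (3 * (block_var n k b / (sdev \<theta> n)\<^sup>2)\<^sup>2 + (ln (real n))\<^sup>2 / (sdev \<theta> n)\<^sup>2 * (block_var n k b / (sdev \<theta> n)\<^sup>2)) / e ^ 4"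
    if b: "b < k" for b
  proof -
    let ?A = "{gridpt n k b<..gridpt n k (Suc b)}"
    have "gridpt n k (Suc b) \<le> n" using n k b by (intro gridpt_le) auto
    then have A: "?A \<subseteq> {1..n}" by auto
    have mean: "EE (Pi_pmf {1..n} False (\<lambda>i. bernoulli_pmf (feller_prob \<theta> i))) (\<lambda>\<omega>. cent \<theta> j (\<omega> j)) = 0"
      if "j \<in> {1..n}" for j
      using cent_mean[OF that] by (simp add: feller_pmf_def)
    have var: "(\<Sum>j\<in>?A. ?E (\<lambda>\<xi>. (cent \<theta> j (\<xi> j))\<^sup>2)) = block_var n k b"
      unfolding block_var_def using A by (intro sum.cong refl cent_variance) auto
    have "(e * sdev \<theta> n) ^ 4 * ?E (\<lambda>\<xi>. of_bool (?bad b \<xi>)) \<le> ?E (\<lambda>\<xi>. (\<Sum>j\<in>?A. cent \<theta> j (\<xi> j)) ^ 4)"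
      unfolding feller_pmf_def
      by (rule maximal_inequality_fourth_moment[OF _ A _ mean]) (use e s in auto)
    also have "\<dots> \<le> 3 * (\<Sum>j\<in>?A. ?E (\<lambda>\<xi>. (cent \<theta> j (\<xi> j))\<^sup>2))\<^sup>2 + (\<Sum>j\<in>?A. ?E (\<lambda>\<xi>. cent \<theta> j (\<xi> j) ^ 4))"
      unfolding feller_pmf_def
      by (rule centered_sum_fourth_moment[OF _ mean A]) auto
    also have "\<dots> \<le> 3 * (\<Sum>j\<in>?A. ?E (\<lambda>\<xi>. (cent \<theta> j (\<xi> j))\<^sup>2))\<^sup>2 + (\<Sum>j\<in>?A. (ln (real n))\<^sup>2 * ?E (\<lambda>\<xi>. (cent \<theta> j (\<xi> j))\<^sup>2))"
      using A by (intro add_left_mono sum_mono cent_fourth_moment_le) auto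
    also have "\<dots> = 3 * (block_var n k b)\<^sup>2 + (ln (real n))\<^sup>2 * block_var n k b"
      unfolding sum_distrib_left[symmetric] var ..
    finally have "?E (\<lambda>\<xi>. of_bool (?bad b \<xi>)) \<le> (3 * (block_var n k b)\<^sup>2 + (ln (real n))\<^sup>2 * block_var n k b) / (e * sdev \<theta> n) ^ 4"
      using e s by (simp add: pos_le_divide_eq mult.commute)
    also have "\<dots> = (3 * (block_var n k b / (sdev \<theta> n)\<^sup>2)\<^sup>2 + (ln (real n))\<^sup>2 / (sdev \<theta> n)\<^sup>2 * (block_var n k b / (sdev \<theta> n)\<^sup>2)) / e ^ 4"
      using e s by (simp add: divide_simps power_mult_distrib)
    finally show ?thesis .
  qed
  have "of_bool (osc n k e \<xi>) \<le> (\<Sum>b<k. of_bool (?bad b \<xi>) :: real)" for \<xi>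
  proof (cases "osc n k e \<xi>")
    case True
    then obtain b where b: "b < k" "?bad b \<xi>" unfolding osc_def by blast
    have "(of_bool (?bad b \<xi>) :: real) \<le> (\<Sum>b<k. of_bool (?bad b \<xi>))"
      using b(1) by (intro member_le_sum[where f = "\<lambda>b. of_bool (?bad b \<xi>)"]) auto
    then show ?thesis using True b(2) by simp
  qed (auto intro!: sum_nonneg)
  then have "?E (\<lambda>\<xi>. of_bool (osc n k e \<xi>)) \<le> ?E (\<lambda>\<xi>. \<Sum>b<k. of_bool (?bad b \<xi>))"
    by (intro EE_mono[OF fs])
  also have "\<dots> = (\<Sum>b<k. ?E (\<lambda>\<xi>. of_bool (?bad b \<xi>)))" by (rule EE_sum[OF fs])
  also have "\<dots> \<le> (\<Sum>b<k. (3 * (block_var n k b / (sdev \<theta> n)\<^sup>2)\<^sup>2 + (ln (real n))\<^sup>2 / (sdev \<theta> n)\<^sup>2 * (block_var n k b / (sdev \<theta> n)\<^sup>2)) / e ^ 4)"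
    by (intro sum_mono each) auto
  finally show ?thesis by (simp add: sum_divide_distrib)
qed

lemma eventually_prob_osc_le:
  assumes k: "k \<ge> 1" and e: "e > 0"
  shows "\<forall>\<^sub>F n in sequentially. EE (feller_pmf \<theta> n) (\<lambda>\<xi>. of_bool (osc n k e \<xi>)) \<le> 10 / (real k * e ^ 4)"
proof -
  define \<Delta> where "\<Delta> b = (real (Suc b) / real k) ^ 3 - (real b / real k) ^ 3" for b
  have \<Delta>: "0 \<le> \<Delta> b" "\<Delta> b \<le> 3 / real k" if "b < k" for b
  proof -
    show "0 \<le> \<Delta> b" unfolding \<Delta>_def using power_mono[of "real b / real k" "real (Suc b) / real k" 3]
      by (simp add: divide_right_mono)
    have "(real (Suc b) / real k) ^ Suc 2 - (real b / real k) ^ Suc 2 \<le>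
        real (Suc 2) * (real (Suc b) / real k - real b / real k) * (real (Suc b) / real k)\<^sup>2"
      by (rule power_Suc_diff_le) (auto simp: divide_right_mono)
    also have "\<dots> \<le> real (Suc 2) * (real (Suc b) / real k - real b / real k) * 1\<^sup>2"
    proof (intro mult_left_mono power_mono)
      show "real (Suc b) / real k \<le> 1" using that by (simp add: divide_simps)
    qed (auto simp: divide_right_mono)
    also have "real (Suc 2) * (real (Suc b) / real k - real b / real k) * 1\<^sup>2 = 3 / real k"
      by (simp add: diff_divide_distrib[symmetric])
    finally show "\<Delta> b \<le> 3 / real k" by (simp only: \<Delta>_def eval_nat_numeral(3))
  qed
  have tot: "(\<Sum>b<k. \<Delta> b) = 1"
    using k unfolding \<Delta>_def by (subst sum_lessThan_telescope) auto
  note small = ln_square_over_variance_tendsto_0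
  have "(\<lambda>n. (\<Sum>b<k. 3 * (block_var n k b / (sdev \<theta> n)\<^sup>2)\<^sup>2 + (ln (real n))\<^sup>2 / (sdev \<theta> n)\<^sup>2 * (block_var n k b / (sdev \<theta> n)\<^sup>2)) / e ^ 4)
     \<longlonglongrightarrow> (\<Sum>b<k. 3 * (\<Delta> b)\<^sup>2 + 0 * \<Delta> b) / e ^ 4"
    unfolding \<Delta>_def by (intro tendsto_intros block_var_limit small) (use e in auto)
  \<comment> \<open>Each \<open>\<Delta> b\<close> is at most \<open>3 / k\<close> and they add up
    to 1, so the numerator is at most \<open>9 / k\<close>; the 10 leaves room for a strict
    inequality.\<close>
  moreover have "(\<Sum>b<k. 3 * (\<Delta> b)\<^sup>2 + 0 * \<Delta> b) / e ^ 4 < 10 / (real k * e ^ 4)"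
  proof -
    have "(\<Sum>b<k. 3 * (\<Delta> b)\<^sup>2 + 0 * \<Delta> b) = 3 * (\<Sum>b<k. \<Delta> b * \<Delta> b)"
      by (simp add: sum_distrib_left power2_eq_square)
    also have "\<dots> \<le> 3 * (\<Sum>b<k. 3 / real k * \<Delta> b)"
      using \<Delta> by (intro mult_left_mono sum_mono mult_right_mono) auto
    also have "\<dots> = 9 / real k" by (simp only: sum_distrib_left[symmetric] tot)
    also have "\<dots> < 10 / real k" using k by (simp add: divide_strict_right_mono)
    finally have "(\<Sum>b<k. 3 * (\<Delta> b)\<^sup>2 + 0 * \<Delta> b) / e ^ 4 < 10 / real k / e ^ 4"
      using e by (intro divide_strict_right_mono) auto
    then show ?thesis by (simp only: divide_divide_eq_left)
  qed
  ultimately have "\<forall>\<^sub>F n in sequentially. (\<Sum>b<k. 3 * (block_var n k b / (sdev \<theta> n)\<^sup>2)\<^sup>2 +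
      (ln (real n))\<^sup>2 / (sdev \<theta> n)\<^sup>2 * (block_var n k b / (sdev \<theta> n)\<^sup>2)) / e ^ 4 < 10 / (real k * e ^ 4)"
    by (rule order_tendstoD(2))
  with eventually_ge_at_top[of 2] show ?thesis
    by eventually_elim (use prob_osc_le[OF _ k e] in force)
qed

text \<open>The thresholds are such that the exceptional probability vanishes while all resulting errors
  are \<open>o((log n)\<^bsup>3/2\<^esup>)\<close>.\<close>

definition good :: "nat \<Rightarrow> (nat \<Rightarrow> bool) \<Rightarrow> bool" where
  "good n \<xi> \<longleftrightarrow> \<xi> 1 \<and> \<not> short_gap \<xi> n ((ln (real n))\<^sup>2) \<and>
     (\<Sum>k=1..n. of_bool (\<xi> k)) \<le> ln (real n) powr (5 / 4) \<and> lcm_loss \<xi> n \<le> ln (real n) powr (11 / 8)"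

lemma lcm_loss_nonneg: "lcm_loss \<xi> n \<ge> 0"
  unfolding lcm_loss_def by (intro sum_nonneg mult_nonneg_nonneg) (auto simp: prime_gt_0_nat Suc_leI)

text \<open>With \<open>l = ln n\<close>, a short gap has probability of order at most
  \<open>1 / l\<close>. Markov's inequality handles the others: the number of ones has mean of order
  at most \<open>l\<close> against \<open>l powr (5 / 4)\<close>, and the lcm loss has mean of order
  at most \<open>l powr (5 / 4)\<close> against \<open>l powr (11 / 8)\<close>.\<close>

lemma prob_bad_tendsto_0: "(\<lambda>n. EE (feller_pmf \<theta> n) (\<lambda>\<xi>. of_bool (\<not> good n \<xi>))) \<longlonglongrightarrow> 0"
proof -
  obtain C where C: "C \<ge> 0"
    "\<And>n. (\<Sum>p | prime p \<and> p \<le> n. \<Sum>s=1..n. ln (real p) * real (p ^ s) powr (- (5 / 4))) \<le> C"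
    using sum_prime_powers_bounded by blast
  let ?c = "max 1 \<theta>"
  define B where "B l = 2 * ?c\<^sup>2 * (1 + l) / l\<^sup>2 + ?c * (1 + l) / l powr (5 / 4) +
      (C * (2 * ?c) powr (5 / 4)) * (1 + l) powr (5 / 4) / l powr (11 / 8)" for l :: real
  \<comment> \<open>The asymptotic comparison needs the signs of its constants:
    \<open>max 1 \<theta>\<close> becomes a generic positive \<open>c\<close>, and
    \<open>C = 0\<close> is a case of its own.\<close>
  have "(\<lambda>n. 2 * c\<^sup>2 * (1 + ln (real n)) / (ln (real n))\<^sup>2 + c * (1 + ln (real n)) / ln (real n) powr (5 / 4) +
      (C * (2 * c) powr (5 / 4)) * (1 + ln (real n)) powr (5 / 4) / ln (real n) powr (11 / 8)) \<longlonglongrightarrow> 0"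
    if "c > 0" for c :: real
  proof -
    have "C = 0 \<or> C > 0" using C(1) by auto
    then show ?thesis using that by (cases "C = 0") (simp, real_asymp, simp, real_asymp)
  qed
  from this[of ?c] have lim: "(\<lambda>n. B (ln (real n))) \<longlonglongrightarrow> 0" unfolding B_def by simp
  have "\<forall>\<^sub>F n in sequentially. ln (real n) \<ge> 2"
    using filterlim_ln_real_at_top by (simp add: filterlim_at_top)
  then have "\<forall>\<^sub>F n in sequentially. norm (EE (feller_pmf \<theta> n) (\<lambda>\<xi>. of_bool (\<not> good n \<xi>))) \<le> B (ln (real n))"
    using eventually_ge_at_top[of 2]
  proof eventually_elim
    case (elim n)
    let ?E = "EE (feller_pmf \<theta> n)"
    note fs = finite_feller_pmf[OF \<theta>, of n]
    define l where "l = ln (real n)"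
    have l: "l \<ge> 2" using elim by (simp add: l_def)
    have H: "mean_ones \<theta> n \<le> ?c * (1 + l)"
      unfolding mean_ones_def[OF \<theta>] l_def using elim by (intro sum_feller_prob_le[OF \<theta>]) auto
    have "?E (\<lambda>\<xi>. of_bool (\<not> good n \<xi>)) \<le>
       ?E (\<lambda>\<xi>. of_bool (short_gap \<xi> n (l\<^sup>2)) + (\<Sum>k=1..n. of_bool (\<xi> k)) / l powr (5 / 4) + lcm_loss \<xi> n / l powr (11 / 8))"
    proof (rule EE_mono[OF fs])
      fix \<xi> assume \<xi>: "\<xi> \<in> set_pmf (feller_pmf \<theta> n)"
      have one: "\<xi> 1" using feller_pmf_first[OF \<theta> _ \<xi>] elim by simp
      have nn: "0 \<le> (\<Sum>k=1..n. of_bool (\<xi> k)) / l powr (5 / 4)" "0 \<le> lcm_loss \<xi> n / l powr (11 / 8)"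
        using lcm_loss_nonneg by (auto intro!: divide_nonneg_nonneg sum_nonneg)
      have lp: "l powr (5 / 4) > 0" "l powr (11 / 8) > 0" using l by auto
      consider "short_gap \<xi> n (l\<^sup>2)" | "(\<Sum>k=1..n. of_bool (\<xi> k)) > l powr (5 / 4)" | "lcm_loss \<xi> n > l powr (11 / 8)" | "good n \<xi>"
        using one unfolding good_def l_def by linarith
      then show "of_bool (\<not> good n \<xi>) \<le> of_bool (short_gap \<xi> n (l\<^sup>2)) + (\<Sum>k=1..n. of_bool (\<xi> k)) / l powr (5 / 4) + lcm_loss \<xi> n / l powr (11 / 8)"
      proof cases
        case 2
        then have "1 \<le> (\<Sum>k=1..n. of_bool (\<xi> k)) / l powr (5 / 4)" using lp by (simp add: divide_simps)
        then show ?thesis using nn by (simp add: of_bool_def)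
      next
        case 3
        then have "1 \<le> lcm_loss \<xi> n / l powr (11 / 8)" using lp by (simp add: divide_simps)
        then show ?thesis using nn by (simp add: of_bool_def)
      qed (use nn in \<open>auto simp: of_bool_def\<close>)
    qed
    also have "\<dots> = ?E (\<lambda>\<xi>. of_bool (short_gap \<xi> n (l\<^sup>2))) + mean_ones \<theta> n / l powr (5 / 4) + ?E (\<lambda>\<xi>. lcm_loss \<xi> n) / l powr (11 / 8)"
      by (simp only: EE_add[OF fs] integral_divide_zero expectation_ones[OF \<theta>])
    also have "\<dots> \<le> 2 * ?c\<^sup>2 * (1 + l) / l\<^sup>2 + ?c * (1 + l) / l powr (5 / 4) + (C * (2 * ?c) powr (5 / 4)) * (1 + l) powr (5 / 4) / l powr (11 / 8)"
    proof (intro add_mono divide_right_mono H)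
      have "l\<^sup>2 \<ge> 2" using l power_mono[of 2 l 2] by simp
      then show "?E (\<lambda>\<xi>. of_bool (short_gap \<xi> n (l\<^sup>2))) \<le> 2 * ?c\<^sup>2 * (1 + l) / l\<^sup>2"
        unfolding l_def using elim by (intro prob_short_gap_le[OF \<theta>]) auto
      have "?E (\<lambda>\<xi>. lcm_loss \<xi> n) \<le> C * (1 + mean_ones \<theta> n) powr (5 / 4)"
        by (rule expectation_lcm_loss_le[OF \<theta> C(2)])
      also have "\<dots> \<le> C * (2 * ?c * (1 + l)) powr (5 / 4)"
      proof (intro mult_left_mono powr_mono2)
        have "1 * 1 \<le> ?c * (1 + l)" using l by (intro mult_mono) auto
        then show "1 + mean_ones \<theta> n \<le> 2 * ?c * (1 + l)" using H by linarith
      qed (use C mean_ones_nonneg[OF \<theta>, of n] in auto)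
      also have "\<dots> = (C * (2 * ?c) powr (5 / 4)) * (1 + l) powr (5 / 4)" using l by (simp add: powr_mult)
      finally show "?E (\<lambda>\<xi>. lcm_loss \<xi> n) \<le> (C * (2 * ?c) powr (5 / 4)) * (1 + l) powr (5 / 4)" .
    qed auto
    also have "\<dots> = B l" by (simp add: B_def)
    finally show ?case by (simp add: l_def)
  qed
  then show ?thesis by (rule Lim_null_comparison[OF _ lim])
qed

end

section \<open>Approximation by a step process\<close>

definition partial_sum :: "real \<Rightarrow> nat \<Rightarrow> (nat \<Rightarrow> bool) \<Rightarrow> nat \<Rightarrow> real" where
  "partial_sum \<theta> K \<xi> m = (\<Sum>j\<in>{K<..m}. cent \<theta> j (\<xi> j))"

text \<open>With \<open>L = l^2\<close> the terms are: the error of replacing means by integrals;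
  the bound on the number of ones times \<open>ln L\<close>, from lengths replaced by end points;
  the last part; and two terms for the growth of \<open>\<theta> / 2 * (t * l)^2\<close> when
  \<open>t * l\<close> increases by \<open>ln L\<close> and \<open>t \<le> 1\<close>.\<close>

definition prod_error :: "real \<Rightarrow> real \<Rightarrow> real" where
  "prod_error \<theta> l = 4 * (\<theta> + rate_const \<theta>) * (1 + l) + l powr (5 / 4) * ln (l\<^sup>2) + l +
     \<theta> * l * ln (l\<^sup>2) + \<theta> / 2 * (ln (l\<^sup>2))\<^sup>2"

text \<open>On top of the error for products: the lcm loss, the last part once more, and the first
  \<open>K\<close> centred terms.\<close>

definition total_error :: "real \<Rightarrow> nat \<Rightarrow> real \<Rightarrow> real" where
  "total_error \<theta> K l = prod_error \<theta> l + l powr (11 / 8) + l + (\<Sum>j=1..K. ln (real j))"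

context
  fixes \<theta> :: real
  assumes \<theta>: "\<theta> > 0"
begin

lemma ones_log_centered:
  assumes y: "1 \<le> y" "y \<le> real n"
  shows "\<bar>ones_log \<xi> n y - partial_sum \<theta> 0 \<xi> (nat \<lfloor>y\<rfloor>) - \<theta> / 2 * (ln y)\<^sup>2\<bar> \<le> 4 * (\<theta> + rate_const \<theta>) * (1 + ln (real n))"
proof -
  let ?M = "nat \<lfloor>y\<rfloor>"
  have iff: "real k \<le> y \<longleftrightarrow> k \<le> ?M" for k using y by linarith
  have M: "?M \<le> n" using y by linarith
  have "ones_log \<xi> n y = (\<Sum>j=1..?M. of_bool (\<xi> j) * ln (real j))"
    unfolding ones_log_def iff using M by (intro sum.mono_neutral_cong_right) auto
  also have "\<dots> = (\<Sum>j=1..?M. cent \<theta> j (\<xi> j)) + (\<Sum>j=1..?M. feller_prob \<theta> j * ln (real j) ^ 1)"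
    by (simp add: cent_def sum.distrib[symmetric] algebra_simps)
  also have "{1..?M} = {0<..?M}" by auto
  finally have "ones_log \<xi> n y - partial_sum \<theta> 0 \<xi> ?M = (\<Sum>j\<in>{0<..?M}. feller_prob \<theta> j * ln (real j) ^ 1)"
    by (simp add: partial_sum_def)
  also have "{0<..?M} = {1..?M}" by auto
  finally have *: "ones_log \<xi> n y - partial_sum \<theta> 0 \<xi> ?M = (\<Sum>j=1..?M. feller_prob \<theta> j * ln (real j) ^ 1)" .
  have "\<bar>(\<Sum>j=1..?M. feller_prob \<theta> j * ln (real j) ^ 1) - \<theta> / real (Suc 1) * ln y ^ Suc 1\<bar> \<le> 4 * (\<theta> + rate_const \<theta>) * (1 + ln y) ^ 1"
    by (rule sum_log_power[OF feller_prob_approx(1)[OF \<theta>] less_imp_le[OF \<theta>] rate_const_nonneg[OF \<theta>] y(1)])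
  also have "\<dots> \<le> 4 * (\<theta> + rate_const \<theta>) * (1 + ln (real n))"
    using y \<theta> rate_const_nonneg[OF \<theta>] by (simp add: mult_left_mono)
  finally show ?thesis unfolding * by (simp add: power2_eq_square)
qed

text \<open>Two blocks are allowed because the cutoff enlarged by the factor \<open>L\<close> may
  leave the block of \<open>n powr t\<close>, though by no more than one further block; the minimum
  with \<open>k\<close> caps the range at \<open>n\<close>.\<close>

lemma partial_sum_osc:
  assumes n: "n \<ge> 2" and k: "k \<ge> 1" and e: "e > 0" and nosc: "\<not> osc \<theta> n k e \<xi>" and b: "b \<le> k"
    and M: "gridpt n k b \<le> M" "M \<le> gridpt n k (min (b + 2) k)"
  shows "\<bar>partial_sum \<theta> 0 \<xi> M - partial_sum \<theta> 0 \<xi> (gridpt n k b)\<bar> \<le> 2 * e * sdev \<theta> n"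
proof -
  let ?s = "\<lambda>a m. \<Sum>j\<in>{a<..m}. cent \<theta> j (\<xi> j)"
  have split: "?s a m = ?s a c + ?s c m" if "a \<le> c" "c \<le> m" for a c m :: nat
  proof -
    have "{a<..m} = {a<..c} \<union> {c<..m}" using that by auto
    then show ?thesis by (simp add: sum.union_disjoint)
  qed
  have small: "\<bar>?s (gridpt n k b') m\<bar> < e * sdev \<theta> n" if "b' < k" "m \<in> {gridpt n k b'..gridpt n k (Suc b')}" for b' m
    using nosc that unfolding osc_def[OF \<theta>] by (meson not_le)
  have nn: "e * sdev \<theta> n \<ge> 0" using e sdev_nonneg[OF \<theta>] by simp
  have diff: "partial_sum \<theta> 0 \<xi> M - partial_sum \<theta> 0 \<xi> (gridpt n k b) = ?s (gridpt n k b) M"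
    unfolding partial_sum_def using split[of 0 "gridpt n k b" M] M by simp
  consider "b = k" | "b < k" "M \<le> gridpt n k (Suc b)" | "b < k" "gridpt n k (Suc b) < M" using b by linarith
  then have "\<bar>?s (gridpt n k b) M\<bar> \<le> 2 * e * sdev \<theta> n"
  proof cases
    case 1
    then have "M = gridpt n k b" using M by simp
    then show ?thesis using nn by simp
  next
    case 2
    then show ?thesis using small[of b M] M nn by auto
  next
    case 3
    have "Suc b < k"
    proof (rule ccontr)
      assume "\<not> Suc b < k"
      then have "min (b + 2) k = Suc b" using 3 by auto
      then show False using M 3 by simp
    qed
    then have "min (b + 2) k = Suc (Suc b)" by auto
    then have "M \<in> {gridpt n k (Suc b)..gridpt n k (Suc (Suc b))}" using M 3 by auto
    then have "\<bar>?s (gridpt n k (Suc b)) M\<bar> < e * sdev \<theta> n" using small[of "Suc b" M] \<open>Suc b < k\<close> by blast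
    moreover have "gridpt n k b \<le> gridpt n k (Suc b)" using n by (intro gridpt_mono) auto
    then have "\<bar>?s (gridpt n k b) (gridpt n k (Suc b))\<bar> < e * sdev \<theta> n" using small[of b "gridpt n k (Suc b)"] 3 by auto
    moreover have "?s (gridpt n k b) M = ?s (gridpt n k b) (gridpt n k (Suc b)) + ?s (gridpt n k (Suc b)) M"
      using 3 \<open>gridpt n k b \<le> gridpt n k (Suc b)\<close> by (intro split) auto
    ultimately show ?thesis by linarith
  qed
  then show ?thesis unfolding diff .
qed

text \<open>The condition \<open>ln (l^2) * k \<le> l\<close> says that the factor
  \<open>L = l^2\<close> is at most one grid step on the logarithmic scale. Both cutoffs of the
  sandwich therefore lie within two blocks of the grid point below \<open>t\<close>, where
  oscillation is controlled; what remains has bounds depending on \<open>l\<close> alone.\<close>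

lemma ln_prod_parts_close:
  fixes n k :: nat
  defines "l \<equiv> ln (real n)"
  assumes n: "n \<ge> 2" and k: "k \<ge> 1" and e: "e > 0" and l1: "l \<ge> 1" and kl: "ln (l\<^sup>2) * real k \<le> l"
    and good: "good n \<xi>" and nosc: "\<not> osc \<theta> n k e \<xi>" and t: "t \<in> {0..1}"
  shows "\<bar>ln (real (prod_parts n (feller_partition n n \<xi>) t)) - \<theta> * t\<^sup>2 * l\<^sup>2 / 2 -
     partial_sum \<theta> 0 \<xi> (gridpt n k (nat \<lfloor>t * real k\<rfloor>))\<bar> \<le> 2 * e * sdev \<theta> n + prod_error \<theta> l"
proof -
  define b where "b = nat \<lfloor>t * real k\<rfloor>"
  define L where "L = l\<^sup>2"
  define x where "x = real n powr t"
  \<comment> \<open>The centring estimate needs a cutoff of at most \<open>n\<close>; capping does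
    not change \<open>ones_log\<close>, which only sees positions up to \<open>n\<close>.\<close>
  define y where "y = min (L * x) (real n)"
  define A where "A = ln (real (prod_parts n (feller_partition n n \<xi>) t))"
  have L1: "L \<ge> 1" using l1 unfolding L_def by (rule one_le_power)
  have n1: "n \<ge> 1" "real n > 0" using n by auto
  have bk: "b \<le> k" unfolding b_def by (rule grid_index_le[OF t])
  have tk: "real b \<le> t * real k" "t * real k < real b + 1"
  proof -
    have "t * real k \<ge> 0" using t by simp
    then show "real b \<le> t * real k" "t * real k < real b + 1" unfolding b_def by linarith+
  qed
  have bt: "real b / real k \<le> t" using tk k by (simp add: field_simps)
  have x1: "1 \<le> x" unfolding x_def using n t by (intro ge_one_powr_ge_zero) auto
  have xn: "x \<le> real n" unfolding x_def using n t powr_mono[of t 1 "real n"] by simp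
  have xLx: "x \<le> L * x" using mult_right_mono[OF L1, of x] x1 by simp
  have y: "x \<le> y" "1 \<le> y" "y \<le> real n" "y \<le> L * x" 
  proof -
    have "1 \<le> L * x" using x1 xLx by linarith
    moreover have "1 \<le> real n" using n by simp
    ultimately show "1 \<le> y" unfolding y_def by (rule min.boundedI)
    show "x \<le> y" unfolding y_def using xLx xn by (rule min.boundedI)
    show "y \<le> real n" "y \<le> L * x" unfolding y_def by (rule min.cobounded2, rule min.cobounded1)
  qed
  have lnx: "ln x = t * l" using n by (simp add: x_def l_def ln_powr)
  have lny: "0 \<le> ln y" "ln y \<le> t * l + ln L"
  proof -
    show "0 \<le> ln y" using y by simp
    have "ln y \<le> ln (L * x)" using y by (intro ln_mono) auto
    then show "ln y \<le> t * l + ln L" using L1 x1 lnx by (simp add: ln_mult)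
  qed
  have lnL: "ln L \<ge> 0" using L1 by simp
  have h: "ln L \<le> l / real k" using kl k by (simp add: L_def field_simps)
  have yle: "y \<le> real n powr (real (min (b + 2) k) / real k)"
  proof (cases "b + 2 \<le> k")
    case True
    have "ln y \<le> t * l + l / real k" using lny h by linarith
    also have "\<dots> = (t * real k + 1) / real k * l" using k by (simp add: field_simps)
    also have "\<dots> \<le> (real (b + 2) / real k) * l"
      using tk l1 by (intro mult_right_mono divide_right_mono) auto
    finally have "ln y \<le> ln (real n powr (real (b + 2) / real k))" using n by (simp add: ln_powr l_def)
    then have "y \<le> real n powr (real (b + 2) / real k)" using y n1 by (subst (asm) ln_le_cancel_iff) auto
    then show ?thesis using True by (simp add: min_def)
  next
    case False
    then have "min (b + 2) k = k" by auto
    then show ?thesis using y k n1 by simp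
  qed
  have gb: "gridpt n k b \<le> nat \<lfloor>x\<rfloor>" unfolding gridpt_def x_def
    using bt n by (intro nat_mono floor_mono powr_mono) auto
  have Mx: "gridpt n k b \<le> nat \<lfloor>x\<rfloor>" "nat \<lfloor>x\<rfloor> \<le> gridpt n k (min (b + 2) k)"
    and My: "gridpt n k b \<le> nat \<lfloor>y\<rfloor>" "nat \<lfloor>y\<rfloor> \<le> gridpt n k (min (b + 2) k)"
  proof -
    show "gridpt n k b \<le> nat \<lfloor>x\<rfloor>" by (rule gb)
    show "gridpt n k b \<le> nat \<lfloor>y\<rfloor>" using gb y(1) by (meson floor_mono le_trans nat_mono)
    show "nat \<lfloor>y\<rfloor> \<le> gridpt n k (min (b + 2) k)" unfolding gridpt_def
      using yle by (intro nat_mono floor_mono)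
    then show "nat \<lfloor>x\<rfloor> \<le> gridpt n k (min (b + 2) k)" using y(1) by (meson floor_mono le_trans nat_mono)
  qed
  have Sx: "\<bar>partial_sum \<theta> 0 \<xi> (nat \<lfloor>x\<rfloor>) - partial_sum \<theta> 0 \<xi> (gridpt n k b)\<bar> \<le> 2 * e * sdev \<theta> n"
    by (rule partial_sum_osc[OF n k e nosc bk Mx])
  have Sy: "\<bar>partial_sum \<theta> 0 \<xi> (nat \<lfloor>y\<rfloor>) - partial_sum \<theta> 0 \<xi> (gridpt n k b)\<bar> \<le> 2 * e * sdev \<theta> n"
    by (rule partial_sum_osc[OF n k e nosc bk My])
  have one: "\<xi> 1" and long: "\<And>j i. (j, i) \<in> gaps \<xi> n \<Longrightarrow> real (j + i) \<le> L * real i"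
    and ones: "(\<Sum>k=1..n. of_bool (\<xi> k)) \<le> l powr (5 / 4)"
    using good unfolding good_def[OF \<theta>] short_gap_def[OF \<theta>] by (auto simp: L_def l_def not_less)
  have "real (card (gaps \<xi> n)) * ln L \<le> l powr (5 / 4) * ln L"
    using card_gaps_le[of \<xi> n] ones lnL by (intro mult_right_mono) auto
  moreover have "ones_log \<xi> n x - real (card (gaps \<xi> n)) * ln L \<le> A"
    unfolding A_def x_def by (rule ln_prod_parts_sandwich(1)[of n t \<xi> L, OF n1(1) _ one L1 long]) (use t in auto)
  moreover have "A \<le> ones_log \<xi> n (L * x) + l"
    unfolding A_def x_def l_def by (rule ln_prod_parts_sandwich(2)[of n t \<xi> L, OF n1(1) _ one L1 long]) (use t in auto)
  moreover have "ones_log \<xi> n (L * x) = ones_log \<xi> n y"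
    unfolding ones_log_def y_def by (intro sum.cong) auto
  moreover have cx: "\<bar>ones_log \<xi> n x - partial_sum \<theta> 0 \<xi> (nat \<lfloor>x\<rfloor>) - \<theta> / 2 * (t * l)\<^sup>2\<bar> \<le> 4 * (\<theta> + rate_const \<theta>) * (1 + l)"
    using ones_log_centered[OF x1 xn, of \<xi>] by (simp only: lnx l_def)
  moreover have cy: "\<bar>ones_log \<xi> n y - partial_sum \<theta> 0 \<xi> (nat \<lfloor>y\<rfloor>) - \<theta> / 2 * (ln y)\<^sup>2\<bar> \<le> 4 * (\<theta> + rate_const \<theta>) * (1 + l)"
    using ones_log_centered[OF y(2,3), of \<xi>] by (simp only: l_def)
  moreover have "\<theta> / 2 * (ln y)\<^sup>2 \<le> \<theta> / 2 * (t * l)\<^sup>2 + \<theta> * l * ln L + \<theta> / 2 * (ln L)\<^sup>2"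
  proof -
    have "(ln y)\<^sup>2 \<le> (t * l + ln L)\<^sup>2" using lny by (intro power_mono)
    also have "\<dots> = (t * l)\<^sup>2 + 2 * (t * (l * ln L)) + (ln L)\<^sup>2" by (simp add: power2_sum algebra_simps)
    also have "\<dots> \<le> (t * l)\<^sup>2 + 2 * (1 * (l * ln L)) + (ln L)\<^sup>2"
      using t l1 lnL by (intro add_mono mult_left_mono mult_right_mono) auto
    finally have "\<theta> / 2 * (ln y)\<^sup>2 \<le> \<theta> / 2 * ((t * l)\<^sup>2 + 2 * (1 * (l * ln L)) + (ln L)\<^sup>2)"
      using \<theta> by (intro mult_left_mono) auto
    then show ?thesis by (simp add: algebra_simps)
  qed
  moreover have "\<theta> * t\<^sup>2 * l\<^sup>2 / 2 = \<theta> / 2 * (t * l)\<^sup>2" by (simp add: power_mult_distrib)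
  moreover have "0 \<le> l powr (5 / 4) * ln L" "0 \<le> \<theta> * l * ln L" "0 \<le> \<theta> / 2 * (ln L)\<^sup>2" "0 \<le> l"
    using lnL l1 \<theta> by auto
  moreover have "prod_error \<theta> l = 4 * (\<theta> + rate_const \<theta>) * (1 + l) + l powr (5 / 4) * ln L + l + \<theta> * l * ln L + \<theta> / 2 * (ln L)\<^sup>2"
    by (simp add: prod_error_def L_def)
  ultimately show ?thesis using Sx Sy unfolding A_def[symmetric] b_def[symmetric] by linarith
qed

text \<open>The bound is the same for all \<open>m\<close>; for fixed \<open>K\<close> it is
  negligible after normalisation, so the first \<open>K\<close> coordinates may be
  discarded.\<close>

lemma partial_sum_drop:
  "\<bar>partial_sum \<theta> 0 \<xi> m - partial_sum \<theta> K \<xi> m\<bar> \<le> (\<Sum>j=1..K. ln (real j))"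
proof -
  have "{0<..m} = {0<..min m K} \<union> {K<..m}" by auto
  then have "partial_sum \<theta> 0 \<xi> m = (\<Sum>j\<in>{0<..min m K}. cent \<theta> j (\<xi> j)) + partial_sum \<theta> K \<xi> m"
    unfolding partial_sum_def by (simp only:) (rule sum.union_disjoint, auto)
  then have "\<bar>partial_sum \<theta> 0 \<xi> m - partial_sum \<theta> K \<xi> m\<bar> \<le> (\<Sum>j\<in>{0<..min m K}. \<bar>cent \<theta> j (\<xi> j)\<bar>)"
    by simp
  also have "\<dots> \<le> (\<Sum>j\<in>{0<..min m K}. ln (real j))"
    by (intro sum_mono cent_abs_le[OF \<theta>]) auto
  also have "\<dots> \<le> (\<Sum>j=1..K. ln (real j))" by (intro sum_mono2) auto
  finally show ?thesis .
qed

lemma normalized_log_process_close: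
  fixes n k :: nat
  defines "l \<equiv> ln (real n)"
  assumes n: "n \<ge> 2" and k: "k \<ge> 1" and e: "e > 0" and l1: "l \<ge> 1" and kl: "ln (l\<^sup>2) * real k \<le> l"
    and good: "good n \<xi>" and nosc: "\<not> osc \<theta> n k e \<xi>"
    and parts: "parts = prod_parts \<or> parts = lcm_parts"
  shows "skorohod_dist (normalized_log_process \<theta> parts n (feller_partition n n \<xi>))
     (grid_step k (\<lambda>b. partial_sum \<theta> K \<xi> (gridpt n k b) / sdev \<theta> n)) \<le> 2 * e + total_error \<theta> K l / sdev \<theta> n"
proof (rule skorohod_dist_le_sup)
  let ?\<alpha> = "feller_partition n n \<xi>"
  show "normalized_log_process \<theta> parts n ?\<alpha> \<in> skorohod_space"
    using parts skorohod_space_normalized_log_process[OF n] by auto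
  show "grid_step k (\<lambda>b. partial_sum \<theta> K \<xi> (gridpt n k b) / sdev \<theta> n) \<in> skorohod_space"
    by (rule grid_step_in_space[OF k])
  have s: "sdev \<theta> n > 0" by (rule sdev_pos[OF \<theta> n])
  have lnl: "ln (l\<^sup>2) \<ge> 0" using l1 one_le_power[of l 2] by simp
  have pe: "prod_error \<theta> l \<ge> 0"
    unfolding prod_error_def using l1 lnl \<theta> rate_const_nonneg[OF \<theta>] by (intro add_nonneg_nonneg mult_nonneg_nonneg) auto
  have sumnn: "(\<Sum>j=1..K. ln (real j)) \<ge> 0" by (intro sum_nonneg) auto
  show "0 \<le> 2 * e + total_error \<theta> K l / sdev \<theta> n"
    unfolding total_error_def using e s pe l1 sumnn by (intro add_nonneg_nonneg divide_nonneg_nonneg) auto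
  fix t :: real assume t: "t \<in> {0..1}"
  define b where "b = nat \<lfloor>t * real k\<rfloor>"
  define c where "c = \<theta> * t\<^sup>2 * l\<^sup>2 / 2"
  have one: "\<xi> 1" and loss: "lcm_loss \<xi> n \<le> l powr (11 / 8)"
    using good unfolding good_def[OF \<theta>] l_def by auto
  have P: "\<bar>ln (real (prod_parts n ?\<alpha> t)) - c - partial_sum \<theta> 0 \<xi> (gridpt n k b)\<bar> \<le> 2 * e * sdev \<theta> n + prod_error \<theta> l"
    unfolding c_def b_def l_def by (rule ln_prod_parts_close) (use assms t in auto)
  have "0 \<le> ln (real (prod_parts n ?\<alpha> t)) - ln (real (lcm_parts n ?\<alpha> t))"
    "ln (real (prod_parts n ?\<alpha> t)) - ln (real (lcm_parts n ?\<alpha> t)) \<le> lcm_loss \<xi> n + l"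
    unfolding l_def using ln_prod_parts_minus_ln_lcm_parts[of n t \<xi>] n t one by auto
  then have "\<bar>ln (real (parts n ?\<alpha> t)) - ln (real (prod_parts n ?\<alpha> t))\<bar> \<le> l powr (11 / 8) + l"
    using parts loss l1 by auto
  moreover have "\<bar>partial_sum \<theta> 0 \<xi> (gridpt n k b) - partial_sum \<theta> K \<xi> (gridpt n k b)\<bar> \<le> (\<Sum>j=1..K. ln (real j))"
    by (rule partial_sum_drop)
  ultimately have main: "\<bar>ln (real (parts n ?\<alpha> t)) - c - partial_sum \<theta> K \<xi> (gridpt n k b)\<bar> \<le> 2 * e * sdev \<theta> n + total_error \<theta> K l"
    using P unfolding total_error_def by linarith
  have "normalized_log_process \<theta> parts n ?\<alpha> t - grid_step k (\<lambda>b. partial_sum \<theta> K \<xi> (gridpt n k b) / sdev \<theta> n) t =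
    (ln (real (parts n ?\<alpha> t)) - c - partial_sum \<theta> K \<xi> (gridpt n k b)) / sdev \<theta> n"
    using t by (simp add: normalized_log_process_def grid_step_def b_def c_def l_def sdev_def diff_divide_distrib)
  then have "\<bar>normalized_log_process \<theta> parts n ?\<alpha> t - grid_step k (\<lambda>b. partial_sum \<theta> K \<xi> (gridpt n k b) / sdev \<theta> n) t\<bar> =
    \<bar>ln (real (parts n ?\<alpha> t)) - c - partial_sum \<theta> K \<xi> (gridpt n k b)\<bar> / sdev \<theta> n"
    using s by (simp only: abs_divide abs_of_pos)
  also have "\<dots> \<le> (2 * e * sdev \<theta> n + total_error \<theta> K l) / sdev \<theta> n"
    using main s by (intro divide_right_mono) auto
  also have "\<dots> = 2 * e + total_error \<theta> K l / sdev \<theta> n" using s by (simp add: add_divide_distrib)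
  finally show "\<bar>normalized_log_process \<theta> parts n ?\<alpha> t - grid_step k (\<lambda>b. partial_sum \<theta> K \<xi> (gridpt n k b) / sdev \<theta> n) t\<bar> \<le>
     2 * e + total_error \<theta> K l / sdev \<theta> n" .
qed

text \<open>In \<open>l = ln n\<close> the largest term has order \<open>l powr (11 / 8)\<close>,
  below the order \<open>l powr (3 / 2)\<close> of the normaliser.\<close>

lemma total_error_tendsto_0: "(\<lambda>n. total_error \<theta> K (ln (real n)) / sdev \<theta> n) \<longlonglongrightarrow> 0"
proof -
  define c where "c = 4 * (\<theta> + rate_const \<theta>)"
  define S where "S = (\<Sum>j=1..K. ln (real j))"
  have "c > 0" using \<theta> rate_const_nonneg[OF \<theta>] by (simp add: c_def)
  moreover have "S = 0 \<or> S > 0" using sum_nonneg[of "{1..K}" "\<lambda>j. ln (real j)"] by (force simp: S_def)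
  ultimately show ?thesis
    unfolding total_error_def prod_error_def sdev_def c_def[symmetric] S_def[symmetric]
    using \<theta> by (cases "S = 0") (simp, real_asymp, simp, real_asymp)
qed

end

section \<open>Functional limit theorem and mixing\<close>

context
  fixes \<theta> :: real
  assumes \<theta>: "\<theta> > 0"
begin

text \<open>The maximum with \<open>K\<close> cuts the first \<open>K\<close> coordinates out of
  every block, so that block sums are independent of weights reading only
  \<open>1..K\<close>.\<close>

definition block :: "nat \<Rightarrow> nat \<Rightarrow> nat \<Rightarrow> nat \<Rightarrow> nat set" where
  "block K n k i = {max K (gridpt n k i)<..gridpt n k (Suc i)}"

definition block_sum :: "nat \<Rightarrow> nat \<Rightarrow> nat \<Rightarrow> nat \<Rightarrow> (nat \<Rightarrow> bool) \<Rightarrow> real" where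
  "block_sum K n k i \<xi> = (\<Sum>j\<in>block K n k i. cent \<theta> j (\<xi> j) / sdev \<theta> n)"

lemma block_subset:
  assumes "i < k"
  shows "block K n k i \<subseteq> {1..n}"
proof (cases "n \<ge> 1")
  case True
  then have "gridpt n k (Suc i) \<le> n" using assms by (intro gridpt_le) auto
  then show ?thesis by (auto simp: block_def)
next
  case False
  then have "n = 0" by simp
  then show ?thesis by (simp add: block_def gridpt_def)
qed

lemma disjoint_blocks:
  assumes "n \<ge> 1"
  shows "disjoint_family_on (block K n k) I"
proof -
  have "block K n k i \<inter> block K n k i' = {}" if "i < i'" for i i'
    using gridpt_mono[OF assms, of "Suc i" i' k] that by (auto simp: block_def)
  then show ?thesis unfolding disjoint_family_on_def by (metis Int_commute linorder_neqE_nat)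
qed

lemma partial_sum_eq_block_sums:
  assumes "n \<ge> 1" "K \<ge> 1"
  shows "partial_sum \<theta> K \<xi> (gridpt n k b) / sdev \<theta> n = (\<Sum>i<b. block_sum K n k i \<xi>)"
proof (induction b)
  case 0
  \<comment> \<open>The first grid point is 1, so with \<open>K \<ge> 1\<close> the sum starts
    empty.\<close>
  then show ?case using assms by (simp add: partial_sum_def gridpt_0)
next
  case (Suc b)
  have "{K<..gridpt n k (Suc b)} = {K<..gridpt n k b} \<union> block K n k b"
    using gridpt_mono[OF assms(1), of b "Suc b" k] by (auto simp: block_def)
  moreover have "{K<..gridpt n k b} \<inter> block K n k b = {}" by (auto simp: block_def)
  moreover have "finite (block K n k b)" by (simp add: block_def)
  ultimately have "partial_sum \<theta> K \<xi> (gridpt n k (Suc b)) = partial_sum \<theta> K \<xi> (gridpt n k b) + (\<Sum>j\<in>block K n k b. cent \<theta> j (\<xi> j))"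
    unfolding partial_sum_def by (simp only: sum.union_disjoint finite_greaterThanAtMost)
  then show ?case using Suc.IH by (simp add: add_divide_distrib block_sum_def sum_divide_distrib)
qed

text \<open>Variance of the increment of \<open>W (t ^ 3)\<close> over the grid interval starting at
  \<open>i / k\<close>.\<close>

definition incr_var :: "nat \<Rightarrow> nat \<Rightarrow> real" where
  "incr_var k i = (real (Suc i) / real k) ^ 3 - (real i / real k) ^ 3"

lemma incr_var_pos: "k \<ge> 1 \<Longrightarrow> incr_var k i > 0"
  unfolding incr_var_def using power_strict_mono[of "real i / real k" "real (Suc i) / real k" 3]
  by (simp add: divide_strict_right_mono)

text \<open>Discarding coordinates up to \<open>K\<close> changes the variance of a block by at most
  the constant \<open>c\<close>, which vanishes after division by the growing normaliser.\<close>

lemma block_sum_variance_limit: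
  assumes i: "i < k"
  shows "(\<lambda>n. \<Sum>j\<in>block K n k i. EE (feller_pmf \<theta> n) (\<lambda>\<xi>. (cent \<theta> j (\<xi> j) / sdev \<theta> n)\<^sup>2)) \<longlonglongrightarrow> incr_var k i"
proof -
  let ?q = "\<lambda>j. feller_prob \<theta> j * (1 - feller_prob \<theta> j) * ln (real j) ^ 2"
  have q0: "0 \<le> ?q j" if "j \<ge> 1" for j
    using feller_prob_bounds[OF \<theta> that] by simp
  define c where "c = (\<Sum>j=1..K. ?q j)"
  have c0: "(\<lambda>n. c / (sdev \<theta> n)\<^sup>2) \<longlonglongrightarrow> 0"
    unfolding sdev_def using \<theta> by real_asymp
  let ?V = "\<lambda>n. \<Sum>j\<in>block K n k i. EE (feller_pmf \<theta> n) (\<lambda>\<xi>. (cent \<theta> j (\<xi> j) / sdev \<theta> n)\<^sup>2)"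
  have V: "?V n = (\<Sum>j\<in>block K n k i. ?q j) / (sdev \<theta> n)\<^sup>2" for n
  proof -
    have "EE (feller_pmf \<theta> n) (\<lambda>\<xi>. (cent \<theta> j (\<xi> j) / sdev \<theta> n)\<^sup>2) = ?q j / (sdev \<theta> n)\<^sup>2" if "j \<in> block K n k i" for j
    proof -
      have "j \<in> {1..n}" using that block_subset[OF i] by blast
      then show ?thesis by (simp add: power_divide cent_variance[OF \<theta>])
    qed
    then show ?thesis by (simp add: sum_divide_distrib)
  qed
  have bv: "block_var \<theta> n k i = (\<Sum>j\<in>{gridpt n k i<..gridpt n k (Suc i)}. ?q j)" for n
    by (rule block_var_def[OF \<theta>])
  have close: "norm (?V n - block_var \<theta> n k i / (sdev \<theta> n)\<^sup>2) \<le> c / (sdev \<theta> n)\<^sup>2" for n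
  proof -
    let ?G = "{gridpt n k i<..gridpt n k (Suc i)}"
    have "?G = block K n k i \<union> (?G - block K n k i)" by (auto simp: block_def)
    then have "(\<Sum>j\<in>?G. ?q j) = (\<Sum>j\<in>block K n k i. ?q j) + (\<Sum>j\<in>?G - block K n k i. ?q j)"
      by (metis (no_types, lifting) sum.subset_diff add.commute finite_greaterThanAtMost Un_upper1)
    moreover have "(\<Sum>j\<in>?G - block K n k i. ?q j) \<le> c"
      unfolding c_def by (intro sum_mono2) (auto simp: block_def intro!: q0)
    moreover have "0 \<le> (\<Sum>j\<in>?G - block K n k i. ?q j)" by (intro sum_nonneg q0) auto
    ultimately have "\<bar>(\<Sum>j\<in>block K n k i. ?q j) - block_var \<theta> n k i\<bar> \<le> c" unfolding bv by linarith
    then show ?thesis unfolding V by (simp add: diff_divide_distrib[symmetric] divide_right_mono)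
  qed
  have "(\<lambda>n. ?V n - block_var \<theta> n k i / (sdev \<theta> n)\<^sup>2) \<longlonglongrightarrow> 0"
    by (rule Lim_null_comparison[OF _ c0]) (use close in auto)
  from tendsto_add[OF this block_var_limit[OF \<theta>, of k i]] show ?thesis by (simp add: incr_var_def)
qed

lemma indep_vars_coordinates:
  "prob_space.indep_vars (measure_pmf (feller_pmf \<theta> n)) (\<lambda>_. count_space UNIV) (\<lambda>j \<xi>. \<xi> j) {1..n}"
  unfolding feller_pmf_def by (rule indep_vars_Pi_pmf) auto

lemma block_sum_weak_conv:
  assumes i: "i < k"
  shows "weak_conv_m (\<lambda>n. distr (measure_pmf (feller_pmf \<theta> n)) borel (block_sum K n k i))
    (distr std_normal_distribution borel (\<lambda>x. sqrt (incr_var k i) * x))"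
  unfolding block_sum_def
\<comment> \<open>The uniform bound \<open>ln n / sdev \<theta> n\<close> is written as the root of
  a quotient of squares, whose limit is known from
  \<open>ln_square_over_variance_tendsto_0\<close>.\<close>
proof (rule bounded_array_CLT[where c = "\<lambda>n. sqrt ((ln (real n))\<^sup>2 / (sdev \<theta> n)\<^sup>2)"])
  fix n
  show "prob_space (measure_pmf (feller_pmf \<theta> n))" by (rule measure_pmf.prob_space_axioms)
  show "finite (block K n k i)" by (simp add: block_def)
  show "prob_space.indep_vars (measure_pmf (feller_pmf \<theta> n)) (\<lambda>_. borel) (\<lambda>j \<xi>. cent \<theta> j (\<xi> j) / sdev \<theta> n) (block K n k i)"
    by (rule prob_space.indep_vars_compose2[OF measure_pmf.prob_space_axioms prob_space.indep_vars_subset[OF measure_pmf.prob_space_axioms indep_vars_coordinates block_subset[OF i]],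
          where Y = "\<lambda>j b. cent \<theta> j b / sdev \<theta> n"]) auto
  fix j assume j: "j \<in> block K n k i"
  then have j': "j \<in> {1..n}" using block_subset[OF i] by blast
  show "EE (feller_pmf \<theta> n) (\<lambda>\<xi>. cent \<theta> j (\<xi> j) / sdev \<theta> n) = 0"
    using cent_mean[OF \<theta> j'] by simp
  fix \<xi>
  have "\<bar>cent \<theta> j (\<xi> j)\<bar> \<le> ln (real n)" using cent_abs_le[OF \<theta>, of j "\<xi> j"] j' by (auto intro: order_trans)
  then have "\<bar>cent \<theta> j (\<xi> j)\<bar> / sdev \<theta> n \<le> \<bar>ln (real n)\<bar> / sdev \<theta> n"
    using sdev_nonneg[OF \<theta>] by (intro divide_right_mono) auto
  then show "\<bar>cent \<theta> j (\<xi> j) / sdev \<theta> n\<bar> \<le> sqrt ((ln (real n))\<^sup>2 / (sdev \<theta> n)\<^sup>2)"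
    using sdev_nonneg[OF \<theta>, of n] by (simp add: real_sqrt_divide)
next
  show "(\<lambda>n. sqrt ((ln (real n))\<^sup>2 / (sdev \<theta> n)\<^sup>2)) \<longlonglongrightarrow> 0"
    using tendsto_real_sqrt[OF ln_square_over_variance_tendsto_0[OF \<theta>]] by simp
  show "(\<lambda>n. \<Sum>j\<in>block K n k i. EE (feller_pmf \<theta> n) (\<lambda>\<xi>. (cent \<theta> j (\<xi> j) / sdev \<theta> n)\<^sup>2)) \<longlonglongrightarrow> incr_var k i"
    by (rule block_sum_variance_limit[OF i])
  show "0 \<le> incr_var k i" using incr_var_pos[of k i] i by simp
qed simp

lemma block_sums_law:
  assumes n: "n \<ge> 1" and k: "k \<ge> 1" and h: "h \<in> borel_measurable (PiM {..<k} (\<lambda>_. borel))"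
  shows "EE (feller_pmf \<theta> n) (\<lambda>\<xi>. h (\<lambda>i\<in>{..<k}. block_sum K n k i \<xi>)) =
    (\<integral>x. h x \<partial>PiM {..<k} (\<lambda>i. distr (measure_pmf (feller_pmf \<theta> n)) borel (block_sum K n k i)))"
proof -
  have "prob_space.indep_vars (measure_pmf (feller_pmf \<theta> n)) (\<lambda>i. PiM (block K n k i) (\<lambda>_. count_space UNIV))
      (\<lambda>i \<xi>. restrict (\<lambda>j. \<xi> j) (block K n k i)) {..<k}"
    by (rule prob_space.indep_vars_restrict[OF measure_pmf.prob_space_axioms indep_vars_coordinates _ disjoint_blocks[OF n]]) (use block_subset in auto)
  then have "prob_space.indep_vars (measure_pmf (feller_pmf \<theta> n)) (\<lambda>_. borel) (\<lambda>i \<xi>. \<Sum>j\<in>block K n k i. cent \<theta> j (restrict (\<lambda>j. \<xi> j) (block K n k i) j) / sdev \<theta> n) {..<k}"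
    by (rule prob_space.indep_vars_compose2[OF measure_pmf.prob_space_axioms, where Y = "\<lambda>i r. \<Sum>j\<in>block K n k i. cent \<theta> j (r j) / sdev \<theta> n"])
       (auto intro!: borel_measurable_sum measurable_compose[OF measurable_component_singleton])
  moreover have "(\<lambda>i \<xi>. \<Sum>j\<in>block K n k i. cent \<theta> j (restrict (\<lambda>j. \<xi> j) (block K n k i) j) / sdev \<theta> n) = block_sum K n k"
    by (intro ext) (simp add: block_sum_def)
  ultimately have indep: "prob_space.indep_vars (measure_pmf (feller_pmf \<theta> n)) (\<lambda>_. borel) (block_sum K n k) {..<k}" by simp
  have "distr (measure_pmf (feller_pmf \<theta> n)) (PiM {..<k} (\<lambda>_. borel)) (\<lambda>\<xi>. \<lambda>i\<in>{..<k}. block_sum K n k i \<xi>) =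
     PiM {..<k} (\<lambda>i. distr (measure_pmf (feller_pmf \<theta> n)) borel (block_sum K n k i))"
    using indep by (subst (asm) prob_space.indep_vars_iff_distr_eq_PiM'[OF measure_pmf.prob_space_axioms]) (use k in \<open>auto simp: lessThan_empty_iff\<close>)
  moreover have "integral\<^sup>L (distr (measure_pmf (feller_pmf \<theta> n)) (PiM {..<k} (\<lambda>_. borel)) (\<lambda>\<xi>. \<lambda>i\<in>{..<k}. block_sum K n k i \<xi>)) h
     = EE (feller_pmf \<theta> n) (\<lambda>\<xi>. h (\<lambda>i\<in>{..<k}. block_sum K n k i \<xi>))"
    by (rule integral_distr[OF _ h]) (auto simp: space_PiM)
  ultimately show ?thesis by simp
qed

section \<open>Comparison with the time-changed Brownian motion\<close>

context
  fixes N :: "'w measure" and W :: "real \<Rightarrow> 'w \<Rightarrow> real"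
  assumes BM: "standard_brownian_motion N W"
begin

lemma prob_space_BM: "prob_space N"
  using BM by (simp add: standard_brownian_motion_def)

lemma BM_cube_measurable: "t \<in> {0..1} \<Longrightarrow> W (t ^ 3) \<in> borel_measurable N"
  using BM by (simp add: standard_brownian_motion_def)

lemma BM_cube_continuous: "\<omega> \<in> space N \<Longrightarrow> continuous_on {0..1} (\<lambda>t. W (t ^ 3) \<omega>)"
proof -
  assume "\<omega> \<in> space N"
  then have "continuous_on {0..} (\<lambda>t. W t \<omega>)" using BM by (simp add: standard_brownian_motion_def)
  then show ?thesis by (rule continuous_on_compose2) (auto intro!: continuous_intros)
qed

abbreviation (input) W_path :: "'w \<Rightarrow> real \<Rightarrow> real" where
  "W_path \<equiv> \<lambda>\<omega>. \<lambda>t\<in>{0..1}. W (t ^ 3) \<omega>"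

abbreviation (input) W_grid :: "nat \<Rightarrow> 'w \<Rightarrow> real \<Rightarrow> real" where
  "W_grid k \<omega> \<equiv> grid_step k (\<lambda>b. W ((real b / real k) ^ 3) \<omega>)"

lemma W_path_measurable: "W_path \<in> N \<rightarrow>\<^sub>M borel_of skorohod_topology"
  by (rule continuous_path_measurable[OF BM_cube_measurable BM_cube_continuous])

text \<open>The counterpart of \<open>block_sums_law\<close> for the limit: increments between the
  times \<open>(i / k) ^ 3\<close> are independent centred Gaussians, so on both sides the same
  \<open>h\<close> is integrated over a product measure.\<close>

lemma BM_increments_law:
  fixes h :: "(nat \<Rightarrow> real) \<Rightarrow> real"
  assumes k: "k \<ge> 1" and h: "h \<in> borel_measurable (PiM {..<k} (\<lambda>_. borel))"
  shows "(\<integral>\<omega>. h (\<lambda>i\<in>{..<k}. W ((real (Suc i) / real k) ^ 3) \<omega> - W ((real i / real k) ^ 3) \<omega>) \<partial>N) =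
    (\<integral>x. h x \<partial>PiM {..<k} (\<lambda>i. distr std_normal_distribution borel (\<lambda>x. sqrt (incr_var k i) * x)))"
proof -
  interpret prob_space N by (rule prob_space_BM)
  define \<tau> where "\<tau> i = (real i / real k) ^ 3" for i
  define D where "D i \<omega> = W (\<tau> (Suc i)) \<omega> - W (\<tau> i) \<omega>" for i \<omega>
  have \<tau>: "0 \<le> \<tau> i" "\<tau> i < \<tau> (Suc i)" "\<tau> (Suc i) - \<tau> i = incr_var k i" for i
    using incr_var_pos[OF k, of i] by (auto simp: \<tau>_def incr_var_def)
  have "indep_vars (\<lambda>_. borel) D {..<k}"
    unfolding D_def using BM \<tau> by (auto simp: standard_brownian_motion_def less_imp_le)
  have [measurable]: "D i \<in> borel_measurable N" for i
    unfolding D_def using BM \<tau>(1) by (intro borel_measurable_diff) (auto simp: standard_brownian_motion_def)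
  have law: "distr N borel (D i) = distr std_normal_distribution borel (\<lambda>x. sqrt (incr_var k i) * x)" for i
  proof -
    let ?s = "sqrt (incr_var k i)"
    have s: "?s > 0" using incr_var_pos[OF k] by simp
    have "distributed N lborel (D i) (\<lambda>u. ennreal (normal_density 0 (sqrt (\<tau> (Suc i) - \<tau> i)) u))"
      using BM \<tau>(1,2)[of i] unfolding D_def standard_brownian_motion_def by blast
    then have "distributed N lborel (D i) (normal_density 0 ?s)" by (simp only: \<tau>(3))
    then have "distributed N lborel (\<lambda>x. (D i x - 0) / ?s) std_normal_density"
      using normal_standard_normal_convert[OF s, of "D i" 0] by blast
    then have "distr N lborel (\<lambda>x. D i x / ?s) = std_normal_distribution"
      by (simp add: distributed_distr_eq_density)
    then have "std_normal_distribution = distr N borel (\<lambda>x. D i x / ?s)"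
      by (simp cong: distr_cong)
    then have "distr std_normal_distribution borel (\<lambda>x. ?s * x) = distr (distr N borel (\<lambda>x. D i x / ?s)) borel (\<lambda>x. ?s * x)"
      by simp
    also have "\<dots> = distr N borel (D i)" using s by (subst distr_distr) (auto simp: comp_def)
    finally show ?thesis ..
  qed
  have "distr N (PiM {..<k} (\<lambda>_. borel)) (\<lambda>\<omega>. \<lambda>i\<in>{..<k}. D i \<omega>) = PiM {..<k} (\<lambda>i. distr N borel (D i))"
    using \<open>indep_vars (\<lambda>_. borel) D {..<k}\<close> by (subst (asm) indep_vars_iff_distr_eq_PiM') (use k in \<open>auto simp: lessThan_empty_iff\<close>)
  then have "PiM {..<k} (\<lambda>i. distr std_normal_distribution borel (\<lambda>x. sqrt (incr_var k i) * x)) =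
     distr N (PiM {..<k} (\<lambda>_. borel)) (\<lambda>\<omega>. \<lambda>i\<in>{..<k}. D i \<omega>)" by (simp only: law)
  also have "integral\<^sup>L \<dots> h = (\<integral>\<omega>. h (\<lambda>i\<in>{..<k}. D i \<omega>) \<partial>N)"
    by (rule integral_distr[OF _ h]) measurable
  finally show ?thesis unfolding D_def \<tau>_def by (rule sym)
qed

context
  fixes F :: "(real \<Rightarrow> real) \<Rightarrow> real" and B L :: real
  assumes B: "\<And>x. x \<in> skorohod_space \<Longrightarrow> \<bar>F x\<bar> \<le> B" and L: "L \<ge> 0"
    and Lip: "\<And>x y. x \<in> skorohod_space \<Longrightarrow> y \<in> skorohod_space \<Longrightarrow> \<bar>F x - F y\<bar> \<le> L * skorohod_dist x y"
begin

lemma F_continuous: "continuous_map skorohod_topology euclideanreal F"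
  using skorohod.continuous_map_Lipschitz[of F L] Lip by simp

text \<open>A grid path is rebuilt from its increments by cumulative sums, a continuous operation on
  \<open>k\<close> real variables. Product laws on both sides reduce the claim to weak convergence
  of each block sum; on the Brownian side the sums telescope, using \<open>W 0 = 0\<close>.\<close>

lemma grid_partial_sum_limit:
  assumes k: "k \<ge> 1" and K: "K \<ge> 1"
  shows "(\<lambda>n. EE (feller_pmf \<theta> n) (\<lambda>\<xi>. F (grid_step k (\<lambda>b. partial_sum \<theta> K \<xi> (gridpt n k b) / sdev \<theta> n))))
    \<longlonglongrightarrow> (\<integral>\<omega>. F (W_grid k \<omega>) \<partial>N)"
proof -
  define h where "h x = F (grid_step k (\<lambda>b. \<Sum>i<b. x i))" for x :: "nat \<Rightarrow> real"
  have hm: "h \<in> borel_measurable (PiM {..<k} (\<lambda>_. borel))"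
    unfolding h_def
    by (rule grid_step_measurable[OF F_continuous k])
       (auto intro!: borel_measurable_sum measurable_component_singleton)
  have hr: "h (\<lambda>i\<in>{..<k}. x i) = h x" for x
  proof -
    have "grid_step k (\<lambda>b. \<Sum>i<b. (\<lambda>i\<in>{..<k}. x i) i) = grid_step k (\<lambda>b. \<Sum>i<b. x i)"
      unfolding grid_step_def
    proof (rule restrict_ext)
      fix t :: real assume "t \<in> {0..1}"
      then show "(\<Sum>i<nat \<lfloor>t * real k\<rfloor>. (\<lambda>i\<in>{..<k}. x i) i) = (\<Sum>i<nat \<lfloor>t * real k\<rfloor>. x i)"
        using grid_index_le[of t k] by (intro sum.cong) auto
    qed
    then show ?thesis by (simp add: h_def)
  qed
  have hB: "\<bar>h x\<bar> \<le> B" for x unfolding h_def by (intro B grid_step_in_space k)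
  have hcont: "(\<lambda>n. h (X n)) \<longlonglongrightarrow> h a" if X: "\<And>i. i \<in> {..<k} \<Longrightarrow> (\<lambda>n. X n i) \<longlonglongrightarrow> a i" for X a
  proof -
    let ?d = "\<lambda>n. \<Sum>i<k. \<bar>X n i - a i\<bar>"
    have "(\<lambda>n. L * ?d n) \<longlonglongrightarrow> L * (\<Sum>i<k. \<bar>a i - a i\<bar>)" by (intro tendsto_intros X) auto
    then have lim: "(\<lambda>n. L * ?d n) \<longlonglongrightarrow> 0" by simp
    have bound: "norm (h (X n) - h a) \<le> L * ?d n" for n
    proof -
      have "\<bar>(\<Sum>i<b. X n i) - (\<Sum>i<b. a i)\<bar> \<le> ?d n" if "b \<le> k" for b
      proof -
        have "\<bar>(\<Sum>i<b. X n i) - (\<Sum>i<b. a i)\<bar> \<le> (\<Sum>i<b. \<bar>X n i - a i\<bar>)"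
          by (simp add: sum_subtractf[symmetric])
        also have "\<dots> \<le> ?d n" using that by (intro sum_mono2) auto
        finally show ?thesis .
      qed
      then have "skorohod_dist (grid_step k (\<lambda>b. \<Sum>i<b. X n i)) (grid_step k (\<lambda>b. \<Sum>i<b. a i)) \<le> ?d n"
        by (intro grid_step_dist k) (auto intro: sum_nonneg)
      then have "L * skorohod_dist (grid_step k (\<lambda>b. \<Sum>i<b. X n i)) (grid_step k (\<lambda>b. \<Sum>i<b. a i)) \<le> L * ?d n"
        using L by (intro mult_left_mono)
      then show ?thesis unfolding h_def real_norm_def
        by (rule order_trans[OF Lip[OF grid_step_in_space[OF k] grid_step_in_space[OF k]]])
    qed
    have "(\<lambda>n. h (X n) - h a) \<longlonglongrightarrow> 0"
      by (rule Lim_null_comparison[OF _ lim]) (use bound in auto)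
    then show ?thesis by (rule LIM_zero_cancel)
  qed
  let ?\<mu> = "\<lambda>n i. distr (measure_pmf (feller_pmf \<theta> n)) borel (block_sum K n k i)"
  let ?\<nu> = "\<lambda>i. distr std_normal_distribution borel (\<lambda>x. sqrt (incr_var k i) * x)"
  have "(\<lambda>n. \<integral>x. h x \<partial>PiM {..<k} (?\<mu> n)) \<longlonglongrightarrow> (\<integral>x. h x \<partial>PiM {..<k} ?\<nu>)"
  proof (rule joint_weak_convergence)
    show "real_distribution (?\<mu> n i)" for n i
      by (rule prob_space.real_distribution_distr[OF measure_pmf.prob_space_axioms]) simp
    show "real_distribution (?\<nu> i)" for i
      using real_distribution.axioms(1)[OF real_dist_normal_dist]
      by (intro prob_space.real_distribution_distr) auto
    show "weak_conv_m (\<lambda>n. ?\<mu> n i) (?\<nu> i)" if "i \<in> {..<k}" for i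
      using that by (intro block_sum_weak_conv) auto
  qed (use k hm hB hcont in \<open>auto simp: lessThan_empty_iff\<close>)
  moreover have "\<forall>\<^sub>F n in sequentially. (\<integral>x. h x \<partial>PiM {..<k} (?\<mu> n)) =
     EE (feller_pmf \<theta> n) (\<lambda>\<xi>. F (grid_step k (\<lambda>b. partial_sum \<theta> K \<xi> (gridpt n k b) / sdev \<theta> n)))"
    using eventually_ge_at_top[of 1]
  proof eventually_elim
    case (elim n)
    have "h (\<lambda>i\<in>{..<k}. block_sum K n k i \<xi>) = F (grid_step k (\<lambda>b. partial_sum \<theta> K \<xi> (gridpt n k b) / sdev \<theta> n))" for \<xi>
      unfolding hr partial_sum_eq_block_sums[OF elim K] by (simp add: h_def)
    then show ?case using block_sums_law[OF elim k hm, of K] by simp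
  qed
  ultimately have "(\<lambda>n. EE (feller_pmf \<theta> n) (\<lambda>\<xi>. F (grid_step k (\<lambda>b. partial_sum \<theta> K \<xi> (gridpt n k b) / sdev \<theta> n))))
    \<longlonglongrightarrow> (\<integral>x. h x \<partial>PiM {..<k} ?\<nu>)"
    by (rule Lim_transform_eventually)
  also have "(\<integral>x. h x \<partial>PiM {..<k} ?\<nu>) =
      (\<integral>\<omega>. h (\<lambda>i\<in>{..<k}. W ((real (Suc i) / real k) ^ 3) \<omega> - W ((real i / real k) ^ 3) \<omega>) \<partial>N)"
    by (rule BM_increments_law[OF k hm, symmetric])
  also have "\<dots> = (\<integral>\<omega>. F (W_grid k \<omega>) \<partial>N)"
  proof (rule Bochner_Integration.integral_cong[OF refl])
    fix \<omega> assume "\<omega> \<in> space N"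
    then have "W 0 \<omega> = 0" using BM by (simp add: standard_brownian_motion_def)
    then have "(\<Sum>i<b. W ((real (Suc i) / real k) ^ 3) \<omega> - W ((real i / real k) ^ 3) \<omega>) = W ((real b / real k) ^ 3) \<omega>" for b
      by (subst sum_lessThan_telescope) simp
    then show "h (\<lambda>i\<in>{..<k}. W ((real (Suc i) / real k) ^ 3) \<omega> - W ((real i / real k) ^ 3) \<omega>) = F (W_grid k \<omega>)"
      unfolding hr by (simp only: h_def)
  qed
  finally show ?thesis .
qed

lemma W_grid_limit: "(\<lambda>k. \<integral>\<omega>. F (W_grid (Suc k) \<omega>) \<partial>N) \<longlonglongrightarrow> (\<integral>\<omega>. F (W_path \<omega>) \<partial>N)"
proof -
  interpret prob_space N by (rule prob_space_BM)
  show ?thesis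
  proof (rule integral_dominated_convergence[where w = "\<lambda>_. B"])
    show "(\<lambda>\<omega>. F (W_path \<omega>)) \<in> borel_measurable N"
      by (rule measurable_compose[OF W_path_measurable continuous_map_borel_of[OF F_continuous]])
    show "(\<lambda>\<omega>. F (W_grid (Suc k) \<omega>)) \<in> borel_measurable N" for k
      by (intro grid_step_measurable[OF F_continuous] BM_cube_measurable) (auto simp: divide_simps)
    show "AE \<omega> in N. (\<lambda>k. F (W_grid (Suc k) \<omega>)) \<longlonglongrightarrow> F (W_path \<omega>)"
      by (rule AE_I2) (rule continuous_path_grid_limit[OF F_continuous BM_cube_continuous])
  qed (auto intro!: AE_I2 B grid_step_in_space)
qed

lemma depends_on_partial_sum: "depends_on {K<..n} (\<lambda>\<xi>. F (grid_step k (\<lambda>b. partial_sum \<theta> K \<xi> (gridpt n k b) / sdev \<theta> n)))"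
  if n: "n \<ge> 1" and k: "k \<ge> 1"
  unfolding depends_on_def
proof (intro allI impI)
  fix \<xi> \<xi>' :: "nat \<Rightarrow> bool" assume eq: "\<forall>i\<in>{K<..n}. \<xi> i = \<xi>' i"
  have "partial_sum \<theta> K \<xi> (gridpt n k b) = partial_sum \<theta> K \<xi>' (gridpt n k b)" if "b \<le> k" for b
    unfolding partial_sum_def using eq gridpt_le[OF n k that] by (intro sum.cong) auto
  then have "grid_step k (\<lambda>b. partial_sum \<theta> K \<xi> (gridpt n k b) / sdev \<theta> n) = grid_step k (\<lambda>b. partial_sum \<theta> K \<xi>' (gridpt n k b) / sdev \<theta> n)"
    unfolding grid_step_def by (intro restrict_ext) (simp add: grid_index_le)
  then show "F (grid_step k (\<lambda>b. partial_sum \<theta> K \<xi> (gridpt n k b) / sdev \<theta> n)) = F (grid_step k (\<lambda>b. partial_sum \<theta> K \<xi>' (gridpt n k b) / sdev \<theta> n))"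
    by simp
qed

text \<open>The partial sums may drop their first \<open>K\<close> terms, which makes them independent of \<open>Z\<close>.\<close>

lemma mixing:
  assumes K: "K \<ge> 1" and Z: "depends_on {1..K} Z" "\<And>\<xi>. \<bar>Z \<xi>\<bar> \<le> zm"
    and parts: "parts = prod_parts \<or> parts = lcm_parts"
  shows "(\<lambda>n. EE (feller_pmf \<theta> n) (\<lambda>\<xi>. Z \<xi> * F (normalized_log_process \<theta> parts n (feller_partition n n \<xi>))))
    \<longlonglongrightarrow> EE (feller_pmf \<theta> K) Z * (\<integral>\<omega>. F (W_path \<omega>) \<partial>N)"
proof (rule LIMSEQ_I)
  fix r :: real assume r: "r > 0"
  let ?X = "\<lambda>n \<xi>. F (normalized_log_process \<theta> parts n (feller_partition n n \<xi>))"
  let ?G = "\<lambda>n k \<xi>. F (grid_step k (\<lambda>b. partial_sum \<theta> K \<xi> (gridpt n k b) / sdev \<theta> n))"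
  let ?Y = "\<integral>\<omega>. F (W_path \<omega>) \<partial>N"
  \<comment> \<open>Made strictly positive because it occurs in denominators below.\<close>
  define zz where "zz = \<bar>zm\<bar> + 1"
  have zz: "zz > 0" "\<And>\<xi>. \<bar>Z \<xi>\<bar> \<le> zz"
  proof -
    show "zz > 0" by (simp add: zz_def)
    show "\<bar>Z \<xi>\<bar> \<le> zz" for \<xi> unfolding zz_def using Z(2)[of \<xi>] by linarith
  qed
  have B0: "B \<ge> 0" using B[OF grid_step_in_space[of 1 "\<lambda>_. 0"]] by simp
  \<comment> \<open>The path error \<open>2 * e\<close> is to cost at most \<open>r / 8\<close>;
    \<open>L + 1\<close> avoids division by zero. The order of choices is \<open>e\<close>, then
    \<open>k\<close> depending on \<open>e\<close>, then \<open>n\<close>.\<close>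
  define e where "e = r / (16 * zz * (L + 1))"
  have e: "e > 0" unfolding e_def using r zz L by (intro divide_pos_pos) auto
  have eL: "zz * (L * (2 * e)) \<le> r / 8"
  proof -
    have "zz * (L * (2 * (r / (16 * zz * M)))) = (r / 8) * (L / M)" if "M > 0" for M
      using zz(1) that by (simp add: field_simps)
    from this[of "L + 1"] L have "zz * (L * (2 * e)) = (r / 8) * (L / (L + 1))" by (simp add: e_def)
    also have "\<dots> \<le> (r / 8) * 1" using r L by (intro mult_left_mono) auto
    finally show ?thesis by simp
  qed
  have "(\<lambda>k. zz * (2 * B * (10 / (real (Suc k) * e ^ 4)))) \<longlonglongrightarrow> zz * (2 * B * 0)"
  proof (intro tendsto_intros)
    have "(\<lambda>k. 10 / e ^ 4 * inverse (real (Suc k))) \<longlonglongrightarrow> 10 / e ^ 4 * 0"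
      by (intro tendsto_intros LIMSEQ_inverse_real_of_nat)
    then show "(\<lambda>k. 10 / (real (Suc k) * e ^ 4)) \<longlonglongrightarrow> 0" by (simp add: field_simps del: of_nat_Suc)
  qed
  then have "\<forall>\<^sub>F k in sequentially. zz * (2 * B * (10 / (real (Suc k) * e ^ 4))) < r / 8"
    using r by (intro order_tendstoD(2)[of _ 0]) auto
  moreover have "\<forall>\<^sub>F k in sequentially. dist (\<integral>\<omega>. F (W_grid (Suc k) \<omega>) \<partial>N) ?Y < r / (8 * zz)"
    by (rule tendstoD[OF W_grid_limit]) (use r zz in auto)
  ultimately have "\<forall>\<^sub>F k in sequentially. zz * (2 * B * (10 / (real (Suc k) * e ^ 4))) < r / 8 \<and>
     dist (\<integral>\<omega>. F (W_grid (Suc k) \<omega>) \<partial>N) ?Y < r / (8 * zz)" by (rule eventually_conj)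
  then obtain k0 where k0: "zz * (2 * B * (10 / (real (Suc k0) * e ^ 4))) < r / 8"
    "dist (\<integral>\<omega>. F (W_grid (Suc k0) \<omega>) \<partial>N) ?Y < r / (8 * zz)"
    using eventually_sequentially by auto
  define k where "k = Suc k0"
  have k: "k \<ge> 1" by (simp add: k_def)
  have kB: "zz * (2 * B * (10 / (real k * e ^ 4))) < r / 8" using k0 by (simp only: k_def)
  have kY: "zz * \<bar>(\<integral>\<omega>. F (W_grid k \<omega>) \<partial>N) - ?Y\<bar> < r / 8"
    using k0(2) zz by (simp add: k_def dist_real_def field_simps)
  have ev1: "\<forall>\<^sub>F n in sequentially. EE (feller_pmf \<theta> n) (\<lambda>\<xi>. of_bool (osc \<theta> n k e \<xi>)) \<le> 10 / (real k * e ^ 4)"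
    by (rule eventually_prob_osc_le[OF \<theta> k e])
  have "(\<lambda>n. zz * (2 * B * EE (feller_pmf \<theta> n) (\<lambda>\<xi>. of_bool (\<not> good n \<xi>)))) \<longlonglongrightarrow> zz * (2 * B * 0)"
    by (intro tendsto_intros prob_bad_tendsto_0[OF \<theta>])
  then have ev2: "\<forall>\<^sub>F n in sequentially. zz * (2 * B * EE (feller_pmf \<theta> n) (\<lambda>\<xi>. of_bool (\<not> good n \<xi>))) < r / 8"
    using r by (intro order_tendstoD(2)[of _ 0]) auto
  have "(\<lambda>n. zz * (L * (total_error \<theta> K (ln (real n)) / sdev \<theta> n))) \<longlonglongrightarrow> zz * (L * 0)"
    by (intro tendsto_intros total_error_tendsto_0[OF \<theta>])
  then have ev3: "\<forall>\<^sub>F n in sequentially. zz * (L * (total_error \<theta> K (ln (real n)) / sdev \<theta> n)) < r / 8"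
    using r by (intro order_tendstoD(2)[of _ 0]) auto
  have ev4: "\<forall>\<^sub>F n in sequentially. dist (EE (feller_pmf \<theta> n) (?G n k)) (\<integral>\<omega>. F (W_grid k \<omega>) \<partial>N) < r / (8 * zz)"
    by (rule tendstoD[OF grid_partial_sum_limit[OF k K]]) (use r zz in auto)
  have "((\<lambda>n. ln ((ln (real n))\<^sup>2) / ln (real n)) \<longlongrightarrow> 0) sequentially" by real_asymp
  \<comment> \<open>For fixed \<open>k\<close> this says that the factor \<open>(ln n)^2\<close>
    fits into one grid step.\<close>
  then have ev5: "\<forall>\<^sub>F n in sequentially. ln ((ln (real n))\<^sup>2) / ln (real n) < 1 / real k"
    using k by (intro order_tendstoD(2)[of _ 0]) auto
  have ev6: "\<forall>\<^sub>F n in sequentially. ln (real n) \<ge> 1"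
    using filterlim_ln_real_at_top by (simp add: filterlim_at_top)
  from ev1 ev2 ev3 ev4 ev5 ev6 eventually_ge_at_top[of 2] eventually_ge_at_top[of K]
  have "\<forall>\<^sub>F n in sequentially. norm (EE (feller_pmf \<theta> n) (\<lambda>\<xi>. Z \<xi> * ?X n \<xi>) - EE (feller_pmf \<theta> K) Z * ?Y) < r"
  proof eventually_elim
    case (elim n)
    let ?E = "EE (feller_pmf \<theta> n)"
    note fs = finite_feller_pmf[OF \<theta>, of n]
    let ?err = "total_error \<theta> K (ln (real n)) / sdev \<theta> n"
    have kl: "ln ((ln (real n))\<^sup>2) * real k \<le> ln (real n)" using elim(5,6) k by (simp add: field_simps)
    have inX: "normalized_log_process \<theta> parts n \<alpha> \<in> skorohod_space" for \<alpha>
      using parts skorohod_space_normalized_log_process[OF elim(7)] by auto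
    have inG: "grid_step k s \<in> skorohod_space" for s by (rule grid_step_in_space[OF k])
    have err: "0 \<le> ?err"
    proof -
      have "0 \<le> ln ((ln (real n))\<^sup>2)" using elim(6) by (simp add: one_le_power)
      then show ?thesis unfolding total_error_def prod_error_def
        using elim(6) \<theta> rate_const_nonneg[OF \<theta>] sdev_nonneg[OF \<theta>]
        by (intro divide_nonneg_nonneg add_nonneg_nonneg mult_nonneg_nonneg sum_nonneg) auto
    qed
    have point: "\<bar>Z \<xi> * ?X n \<xi> - Z \<xi> * ?G n k \<xi>\<bar> \<le>
      zz * (L * (2 * e)) + zz * (L * ?err) + zz * (2 * B * of_bool (\<not> good n \<xi>)) + zz * (2 * B * of_bool (osc \<theta> n k e \<xi>))" for \<xi>
    proof -
      \<comment> \<open>Lipschitz bound on good sequences without oscillation, the trivial bound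
        \<open>2 * B\<close> on the others; the sum of all terms covers both cases.\<close>
      have "\<bar>?X n \<xi> - ?G n k \<xi>\<bar> \<le> L * (2 * e) + L * ?err + 2 * B * of_bool (\<not> good n \<xi>) + 2 * B * of_bool (osc \<theta> n k e \<xi>)"
      proof (cases "good n \<xi> \<and> \<not> osc \<theta> n k e \<xi>")
        case True
        have "\<bar>?X n \<xi> - ?G n k \<xi>\<bar> \<le> L * skorohod_dist (normalized_log_process \<theta> parts n (feller_partition n n \<xi>))
           (grid_step k (\<lambda>b. partial_sum \<theta> K \<xi> (gridpt n k b) / sdev \<theta> n))" by (rule Lip[OF inX inG])
        also have "\<dots> \<le> L * (2 * e + ?err)"
          using True elim kl parts by (intro mult_left_mono L normalized_log_process_close[OF \<theta> _ k e]) auto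
        finally show ?thesis using True by (simp add: distrib_left)
      next
        case False
        have "\<bar>?X n \<xi> - ?G n k \<xi>\<bar> \<le> 2 * B" 
          using B[OF inX[of "feller_partition n n \<xi>"]] B[OF inG[of "\<lambda>b. partial_sum \<theta> K \<xi> (gridpt n k b) / sdev \<theta> n"]]
          by linarith
        moreover have "0 \<le> L * (2 * e)" "0 \<le> L * ?err" using L e err by (auto intro: mult_nonneg_nonneg simp del: times_divide_eq_right)
        moreover have "2 * B \<le> 2 * B * of_bool (\<not> good n \<xi>) + 2 * B * of_bool (osc \<theta> n k e \<xi>)"
          using False B0 by (auto simp: of_bool_def)
        ultimately show ?thesis by linarith
      qed
      then have "\<bar>Z \<xi>\<bar> * \<bar>?X n \<xi> - ?G n k \<xi>\<bar> \<le> zz * (L * (2 * e) + L * ?err + 2 * B * of_bool (\<not> good n \<xi>) + 2 * B * of_bool (osc \<theta> n k e \<xi>))"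
        using zz by (intro mult_mono) auto
      then show ?thesis by (simp add: distrib_left abs_mult[symmetric] right_diff_distrib)
    qed
    have "\<bar>?E (\<lambda>\<xi>. Z \<xi> * ?X n \<xi>) - ?E (\<lambda>\<xi>. Z \<xi> * ?G n k \<xi>)\<bar> = \<bar>?E (\<lambda>\<xi>. Z \<xi> * ?X n \<xi> - Z \<xi> * ?G n k \<xi>)\<bar>"
      by (simp only: EE_diff[OF fs])
    also have "\<dots> \<le> ?E (\<lambda>\<xi>. \<bar>Z \<xi> * ?X n \<xi> - Z \<xi> * ?G n k \<xi>\<bar>)" by (rule integral_abs_bound)
    also have "\<dots> \<le> ?E (\<lambda>\<xi>. zz * (L * (2 * e)) + zz * (L * ?err) + zz * (2 * B * of_bool (\<not> good n \<xi>)) + zz * (2 * B * of_bool (osc \<theta> n k e \<xi>)))"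
      by (intro EE_mono[OF fs] point)
    also have "\<dots> = zz * (L * (2 * e)) + zz * (L * ?err) + zz * (2 * B * ?E (\<lambda>\<xi>. of_bool (\<not> good n \<xi>))) + zz * (2 * B * ?E (\<lambda>\<xi>. of_bool (osc \<theta> n k e \<xi>)))"
      by (simp only: EE_add[OF fs] integral_mult_right_zero) simp
    also have "\<dots> \<le> r / 8 + r / 8 + r / 8 + r / 8"
    proof -
      have "zz * (2 * B * ?E (\<lambda>\<xi>. of_bool (osc \<theta> n k e \<xi>))) \<le> zz * (2 * B * (10 / (real k * e ^ 4)))"
        using elim(1) zz B0 by (intro mult_left_mono) auto
      then show ?thesis using eL elim(2,3) kB by linarith
    qed
    finally have A: "\<bar>?E (\<lambda>\<xi>. Z \<xi> * ?X n \<xi>) - ?E (\<lambda>\<xi>. Z \<xi> * ?G n k \<xi>)\<bar> \<le> r / 2" by simp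
    \<comment> \<open>The grid path reads only coordinates above \<open>K\<close>, so it factors off
      from \<open>Z\<close>.\<close>
    have "?E (\<lambda>\<xi>. Z \<xi> * ?G n k \<xi>) = ?E Z * ?E (?G n k)"
      by (rule feller_pmf_mult[OF \<theta> Z(1) depends_on_partial_sum]) (use elim k in auto)
    also have "?E Z = EE (feller_pmf \<theta> K) Z" by (rule feller_pmf_marginal[OF \<theta> elim(8) Z(1)])
    finally have G: "?E (\<lambda>\<xi>. Z \<xi> * ?G n k \<xi>) = EE (feller_pmf \<theta> K) Z * ?E (?G n k)" .
    have "\<bar>EE (feller_pmf \<theta> K) Z\<bar> \<le> EE (feller_pmf \<theta> K) (\<lambda>\<xi>. \<bar>Z \<xi>\<bar>)" by (rule integral_abs_bound)
    also have "\<dots> \<le> EE (feller_pmf \<theta> K) (\<lambda>_. zz)" by (intro EE_mono finite_feller_pmf[OF \<theta>] zz(2))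
    finally have EZ: "\<bar>EE (feller_pmf \<theta> K) Z\<bar> \<le> zz" by simp
    have "\<bar>?E (?G n k) - ?Y\<bar> \<le> \<bar>?E (?G n k) - (\<integral>\<omega>. F (W_grid k \<omega>) \<partial>N)\<bar> + \<bar>(\<integral>\<omega>. F (W_grid k \<omega>) \<partial>N) - ?Y\<bar>"
      by linarith
    then have "zz * \<bar>?E (?G n k) - ?Y\<bar> \<le> zz * \<bar>?E (?G n k) - (\<integral>\<omega>. F (W_grid k \<omega>) \<partial>N)\<bar> + zz * \<bar>(\<integral>\<omega>. F (W_grid k \<omega>) \<partial>N) - ?Y\<bar>"
      unfolding distrib_left[symmetric] using zz by (intro mult_left_mono) auto
    moreover have "zz * \<bar>?E (?G n k) - (\<integral>\<omega>. F (W_grid k \<omega>) \<partial>N)\<bar> < r / 8"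
      using elim(4) zz by (simp add: dist_real_def field_simps)
    moreover have "\<bar>EE (feller_pmf \<theta> K) Z * ?E (?G n k) - EE (feller_pmf \<theta> K) Z * ?Y\<bar> \<le> zz * \<bar>?E (?G n k) - ?Y\<bar>"
      unfolding right_diff_distrib[symmetric] abs_mult using EZ by (intro mult_right_mono) auto
    ultimately have "\<bar>EE (feller_pmf \<theta> K) Z * ?E (?G n k) - EE (feller_pmf \<theta> K) Z * ?Y\<bar> < r / 4"
      using kY by linarith
    then show ?case using A r unfolding G real_norm_def by linarith
  qed
  then show "\<exists>no. \<forall>n\<ge>no. norm (EE (feller_pmf \<theta> n) (\<lambda>\<xi>. Z \<xi> * ?X n \<xi>) - EE (feller_pmf \<theta> K) Z * ?Y) < r"
    by (simp add: eventually_sequentially)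
qed

end

end

end

section \<open>Perturbed Ewens measures\<close>

text \<open>Only the finitely many sequences that are \<open>False\<close> outside
  \<open>{1..K}\<close> matter; summing over them gives a convenient bound.\<close>

lemma depends_on_bounded:
  fixes Z :: "(nat \<Rightarrow> bool) \<Rightarrow> real"
  assumes Z: "depends_on {1..K} Z"
  obtains z where "\<And>\<xi>. \<bar>Z \<xi>\<bar> \<le> z"
proof -
  let ?S = "{\<xi> :: nat \<Rightarrow> bool. \<forall>i. (i \<in> {1..K} \<longrightarrow> \<xi> i \<in> UNIV) \<and> (i \<notin> {1..K} \<longrightarrow> \<xi> i = False)}"
  have fin: "finite ?S" by (rule finite_set_of_finite_funs) auto
  have "\<bar>Z \<xi>\<bar> \<le> (\<Sum>\<xi>\<in>?S. \<bar>Z \<xi>\<bar>)" for \<xi>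
  proof -
    define \<xi>' where "\<xi>' i \<longleftrightarrow> i \<in> {1..K} \<and> \<xi> i" for i
    have "Z \<xi> = Z \<xi>'" by (rule depends_onD[OF Z]) (auto simp: \<xi>'_def)
    moreover have "\<xi>' \<in> ?S" by (auto simp: \<xi>'_def)
    then have "\<bar>Z \<xi>'\<bar> \<le> (\<Sum>\<xi>\<in>?S. \<bar>Z \<xi>\<bar>)" using fin by (intro member_le_sum) auto
    ultimately show ?thesis by simp
  qed
  then show ?thesis using that by blast
qed

text \<open>The density along the coupling at \<open>n\<close> is replaced by the one at a fixed
  \<open>K\<close>, for which \<open>mixing\<close> applies. Both are close in mean to the common
  limit, so the replacement costs at most \<open>B * (\<delta> n + \<delta> K)\<close>.\<close>

lemma weighted_process_limit:
  fixes \<theta> B L :: real and F :: "(real \<Rightarrow> real) \<Rightarrow> real" and N :: "'w measure" and \<eta> :: "(nat \<Rightarrow> nat) \<Rightarrow> real"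
  assumes \<theta>: "\<theta> > 0" and BM: "standard_brownian_motion N W"
    and B: "\<And>x. x \<in> skorohod_space \<Longrightarrow> \<bar>F x\<bar> \<le> B" and L: "L \<ge> 0"
    and Lip: "\<And>x y. x \<in> skorohod_space \<Longrightarrow> y \<in> skorohod_space \<Longrightarrow> \<bar>F x - F y\<bar> \<le> L * skorohod_dist x y"
    and parts: "parts = prod_parts \<or> parts = lcm_parts"
    and \<eta>: "tendsto_L1 (feller_measure \<theta>) (\<lambda>n \<xi>. \<eta> (feller_partition n n \<xi>)) \<eta>_inf"
  shows "(\<lambda>n. EE (feller_pmf \<theta> n) (\<lambda>\<xi>. \<eta> (feller_partition n n \<xi>) *
      F (normalized_log_process \<theta> parts n (feller_partition n n \<xi>))))
    \<longlonglongrightarrow> (\<integral>\<xi>. \<eta>_inf \<xi> \<partial>feller_measure \<theta>) * (\<integral>\<omega>. F (\<lambda>t\<in>{0..1}. W (t ^ 3) \<omega>) \<partial>N)"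
    and "(\<lambda>n. EE (feller_pmf \<theta> n) (\<lambda>\<xi>. \<eta> (feller_partition n n \<xi>))) \<longlonglongrightarrow> (\<integral>\<xi>. \<eta>_inf \<xi> \<partial>feller_measure \<theta>)"
proof -
  let ?M = "feller_measure \<theta>"
  let ?Z = "\<lambda>n \<xi>. \<eta> (feller_partition n n \<xi>)"
  let ?X = "\<lambda>n \<xi>. F (normalized_log_process \<theta> parts n (feller_partition n n \<xi>))"
  let ?I = "\<integral>\<xi>. \<eta>_inf \<xi> \<partial>?M" and ?Y = "\<integral>\<omega>. F (\<lambda>t\<in>{0..1}. W (t ^ 3) \<omega>) \<partial>N"
  define \<delta> where "\<delta> n = (\<integral>\<xi>. \<bar>?Z n \<xi> - \<eta>_inf \<xi>\<bar> \<partial>?M)" for n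
  have int: "\<forall>\<^sub>F n in sequentially. integrable ?M (?Z n)" and inf: "integrable ?M \<eta>_inf" and \<delta>0: "\<delta> \<longlonglongrightarrow> 0"
    using \<eta> by (auto simp: tendsto_L1_def \<delta>_def[abs_def])
  have dep: "depends_on {1..n} (?Z n)" for n by (rule depends_on_feller_partition)
  have EZ: "EE (feller_pmf \<theta> n) (?Z n) = integral\<^sup>L ?M (?Z n)" for n
    by (rule feller_measure_expectation[OF \<theta> dep, symmetric])
  have mean_close: "\<bar>EE (feller_pmf \<theta> n) (?Z n) - ?I\<bar> \<le> \<delta> n" if "integrable ?M (?Z n)" for n
  proof -
    have "EE (feller_pmf \<theta> n) (?Z n) - ?I = (\<integral>\<xi>. ?Z n \<xi> - \<eta>_inf \<xi> \<partial>?M)"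
      unfolding EZ using that inf by simp
    then show ?thesis unfolding \<delta>_def by (simp only: integral_abs_bound)
  qed
  show lim: "(\<lambda>n. EE (feller_pmf \<theta> n) (?Z n)) \<longlonglongrightarrow> ?I"
  proof (rule LIM_zero_cancel, rule Lim_null_comparison[OF _ \<delta>0])
    show "\<forall>\<^sub>F n in sequentially. norm (EE (feller_pmf \<theta> n) (?Z n) - ?I) \<le> \<delta> n"
      using int by eventually_elim (use mean_close in auto)
  qed
  have B0: "B \<ge> 0" using B[OF grid_step_in_space[of 1 "\<lambda>_. 0"]] by simp
  show "(\<lambda>n. EE (feller_pmf \<theta> n) (\<lambda>\<xi>. ?Z n \<xi> * ?X n \<xi>)) \<longlonglongrightarrow> ?I * ?Y"
  proof (rule LIMSEQ_I)
    fix r :: real assume r: "r > 0"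
    \<comment> \<open>Budget: the replacement costs at most \<open>r / 4\<close>, the change of the
      mean \<open>r / 8\<close>, and \<open>mixing\<close> contributes less than
      \<open>r / 4\<close>.\<close>
    define s where "s = r / (8 * (B + \<bar>?Y\<bar> + 1))"
    have s: "s > 0" unfolding s_def using r B0 by (intro divide_pos_pos) auto
    have sB: "B * s \<le> r / 8" "s * \<bar>?Y\<bar> \<le> r / 8"
    proof -
      have "(B + \<bar>?Y\<bar> + 1) * s = r / 8" using B0 by (simp add: s_def field_simps)
      moreover have "B * s \<le> (B + \<bar>?Y\<bar> + 1) * s" "\<bar>?Y\<bar> * s \<le> (B + \<bar>?Y\<bar> + 1) * s"
        using s B0 by (auto intro!: mult_right_mono)
      ultimately show "B * s \<le> r / 8" "s * \<bar>?Y\<bar> \<le> r / 8" by (auto simp: mult.commute)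
    qed
    have \<delta>s: "\<forall>\<^sub>F n in sequentially. \<delta> n < s" using \<delta>0 s by (rule order_tendstoD(2))
    then have "\<forall>\<^sub>F K in sequentially. \<delta> K < s \<and> integrable ?M (?Z K) \<and> K \<ge> 1"
      using int eventually_ge_at_top[of 1] by (intro eventually_conj)
    then obtain K where K: "\<delta> K < s" "integrable ?M (?Z K)" "K \<ge> 1"
      by (auto simp: eventually_sequentially)
    obtain z where z: "\<And>\<xi>. \<bar>?Z K \<xi>\<bar> \<le> z" using depends_on_bounded[OF dep] by blast
    have mix: "(\<lambda>n. EE (feller_pmf \<theta> n) (\<lambda>\<xi>. ?Z K \<xi> * ?X n \<xi>)) \<longlonglongrightarrow> EE (feller_pmf \<theta> K) (?Z K) * ?Y"
      by (rule mixing[OF \<theta> BM B L Lip K(3) dep z parts])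
    from tendstoD[OF mix, of "r / 4"] r
    have "\<forall>\<^sub>F n in sequentially. dist (EE (feller_pmf \<theta> n) (\<lambda>\<xi>. ?Z K \<xi> * ?X n \<xi>)) (EE (feller_pmf \<theta> K) (?Z K) * ?Y) < r / 4"
      by simp
    with \<delta>s int eventually_ge_at_top[of K] eventually_ge_at_top[of 2]
    have "\<forall>\<^sub>F n in sequentially. norm (EE (feller_pmf \<theta> n) (\<lambda>\<xi>. ?Z n \<xi> * ?X n \<xi>) - ?I * ?Y) < r"
    proof eventually_elim
      case (elim n)
      let ?E = "EE (feller_pmf \<theta> n)"
      note fs = finite_feller_pmf[OF \<theta>, of n]
      have inX: "normalized_log_process \<theta> parts n \<alpha> \<in> skorohod_space" for \<alpha>
        using parts skorohod_space_normalized_log_process[OF elim(4)] by auto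
      have depd: "depends_on {1..n} (\<lambda>\<xi>. \<bar>?Z n \<xi> - ?Z K \<xi>\<bar>)"
        unfolding depends_on_def
      proof (intro allI impI)
        fix \<xi> \<xi>' :: "nat \<Rightarrow> bool" assume eq: "\<forall>i\<in>{1..n}. \<xi> i = \<xi>' i"
        have "?Z n \<xi> = ?Z n \<xi>'" by (rule depends_onD[OF dep]) (use eq in blast)
        moreover have "?Z K \<xi> = ?Z K \<xi>'" by (rule depends_onD[OF dep]) (use eq elim(3) in simp)
        ultimately show "\<bar>?Z n \<xi> - ?Z K \<xi>\<bar> = \<bar>?Z n \<xi>' - ?Z K \<xi>'\<bar>" by simp
      qed
      have "\<bar>?E (\<lambda>\<xi>. ?Z n \<xi> * ?X n \<xi>) - ?E (\<lambda>\<xi>. ?Z K \<xi> * ?X n \<xi>)\<bar> = \<bar>?E (\<lambda>\<xi>. (?Z n \<xi> - ?Z K \<xi>) * ?X n \<xi>)\<bar>"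
        by (simp only: EE_diff[OF fs] left_diff_distrib)
      also have "\<dots> \<le> ?E (\<lambda>\<xi>. \<bar>(?Z n \<xi> - ?Z K \<xi>) * ?X n \<xi>\<bar>)" by (rule integral_abs_bound)
      also have "\<dots> \<le> ?E (\<lambda>\<xi>. \<bar>?Z n \<xi> - ?Z K \<xi>\<bar> * B)"
        unfolding abs_mult by (intro EE_mono[OF fs] mult_left_mono B inX) auto
      also have "\<dots> = (\<integral>\<xi>. \<bar>?Z n \<xi> - ?Z K \<xi>\<bar> \<partial>?M) * B"
        by (simp add: feller_measure_expectation[OF \<theta> depd])
      also have "(\<integral>\<xi>. \<bar>?Z n \<xi> - ?Z K \<xi>\<bar> \<partial>?M) \<le> (\<integral>\<xi>. \<bar>?Z n \<xi> - \<eta>_inf \<xi>\<bar> + \<bar>?Z K \<xi> - \<eta>_inf \<xi>\<bar> \<partial>?M)"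
        using elim(2) K(2) inf by (intro integral_mono) auto
      also have "\<dots> = \<delta> n + \<delta> K"
        unfolding \<delta>_def using elim(2) K(2) inf by (intro Bochner_Integration.integral_add) auto
      also have "(\<delta> n + \<delta> K) * B \<le> (s + s) * B"
        using elim(1) K(1) B0 by (intro mult_right_mono) auto
      also have "\<dots> \<le> r / 4" using sB(1) by (simp add: algebra_simps)
      finally have 1: "\<bar>?E (\<lambda>\<xi>. ?Z n \<xi> * ?X n \<xi>) - ?E (\<lambda>\<xi>. ?Z K \<xi> * ?X n \<xi>)\<bar> \<le> r / 4"
        using B0 by (simp add: mult_right_mono)
      have "\<bar>EE (feller_pmf \<theta> K) (?Z K) * ?Y - ?I * ?Y\<bar> = \<bar>EE (feller_pmf \<theta> K) (?Z K) - ?I\<bar> * \<bar>?Y\<bar>"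
        by (simp add: left_diff_distrib[symmetric] abs_mult)
      also have "\<dots> \<le> s * \<bar>?Y\<bar>" using mean_close[OF K(2)] K(1) by (intro mult_right_mono) auto
      finally have 2: "\<bar>EE (feller_pmf \<theta> K) (?Z K) * ?Y - ?I * ?Y\<bar> \<le> r / 8" using sB(2) by linarith
      show ?case using 1 2 elim(5) r unfolding dist_real_def real_norm_def by linarith
    qed
    then show "\<exists>no. \<forall>n\<ge>no. norm (EE (feller_pmf \<theta> n) (\<lambda>\<xi>. ?Z n \<xi> * ?X n \<xi>) - ?I * ?Y) < r"
      by (simp add: eventually_sequentially)
  qed
qed

text \<open>A perturbed expectation is a quotient of a weighted and an unweighted mean over the
  coupling; in the limit the mean of \<open>\<eta>_inf\<close> cancels, which is where its
  positivity enters.\<close>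

lemma asymptotically_ewens_log_process:
  assumes \<theta>: "\<theta> > 0" and P: "asymptotically_ewens \<theta> P" and BM: "standard_brownian_motion N W"
    and parts: "parts = prod_parts \<or> parts = lcm_parts"
  shows "converges_in_distribution skorohod_topology
           P (normalized_log_process \<theta> parts) N (\<lambda>\<omega>. \<lambda>t\<in>{0..1}. W (t ^ 3) \<omega>)"
proof -
  obtain \<eta> \<eta>_inf where nonneg: "\<And>k \<alpha>. \<alpha> \<in> partitions k \<Longrightarrow> 0 \<le> \<eta> \<alpha>"
    and Z: "\<And>n. n \<ge> 1 \<Longrightarrow> 0 < ewens_Z \<theta> \<eta> n" "\<And>n. n \<ge> 1 \<Longrightarrow> P n = perturbed_ewens \<theta> \<eta> n"
    and \<eta>: "tendsto_L1 (feller_measure \<theta>) (\<lambda>n \<xi>. \<eta> (feller_partition n n \<xi>)) \<eta>_inf"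
    and pos: "0 < (\<integral>\<xi>. \<eta>_inf \<xi> \<partial>feller_measure \<theta>)"
    using P unfolding asymptotically_ewens_def by blast
  have top: "topspace skorohod_topology = skorohod_space" using skorohod.topspace_mtopology by simp
  show ?thesis
  proof (rule skorohod.converges_in_distribution_LipschitzI)
    show "\<forall>\<^sub>F n in sequentially. prob_space (P n) \<and> normalized_log_process \<theta> parts n \<in> P n \<rightarrow>\<^sub>M borel_of skorohod_topology"
      using eventually_ge_at_top[of 2]
    proof eventually_elim
      case (elim n)
      have "normalized_log_process \<theta> parts n \<alpha> \<in> skorohod_space" for \<alpha>
        using parts skorohod_space_normalized_log_process[OF elim] by auto
      \<comment> \<open>The law at \<open>n\<close> lives on partitions with all subsets measurable,
        so only membership of the values in the Skorohod space has to be shown.\<close>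
      then have "normalized_log_process \<theta> parts n \<in> P n \<rightarrow>\<^sub>M borel_of skorohod_topology"
        using elim Z(2)[of n] by (auto simp: perturbed_ewens_def borel_of_def space_measure_of_conv top)
      moreover have "prob_space (P n)"
        using elim Z[of n] prob_space_perturbed_ewens[OF \<theta> nonneg, of n] by simp
      ultimately show ?case by simp
    qed
    show "prob_space N" by (rule prob_space_BM[OF \<theta> BM])
    show "(\<lambda>\<omega>. \<lambda>t\<in>{0..1}. W (t ^ 3) \<omega>) \<in> N \<rightarrow>\<^sub>M borel_of skorohod_topology"
      by (rule W_path_measurable[OF \<theta> BM])
  next
    fix F :: "(real \<Rightarrow> real) \<Rightarrow> real" and B L :: real
    assume F: "\<And>x. x \<in> skorohod_space \<Longrightarrow> \<bar>F x\<bar> \<le> B" "L \<ge> 0"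
      "\<And>x y. x \<in> skorohod_space \<Longrightarrow> y \<in> skorohod_space \<Longrightarrow> \<bar>F x - F y\<bar> \<le> L * skorohod_dist x y"
    note lim = weighted_process_limit[OF \<theta> BM F parts \<eta>]
    let ?Y = "\<integral>\<omega>. F (\<lambda>t\<in>{0..1}. W (t ^ 3) \<omega>) \<partial>N"
    have "(\<lambda>n. EE (feller_pmf \<theta> n) (\<lambda>\<xi>. \<eta> (feller_partition n n \<xi>) * F (normalized_log_process \<theta> parts n (feller_partition n n \<xi>))) /
       EE (feller_pmf \<theta> n) (\<lambda>\<xi>. \<eta> (feller_partition n n \<xi>))) \<longlonglongrightarrow>
       (\<integral>\<xi>. \<eta>_inf \<xi> \<partial>feller_measure \<theta>) * ?Y / (\<integral>\<xi>. \<eta>_inf \<xi> \<partial>feller_measure \<theta>)"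
      using pos by (intro tendsto_divide lim) auto
    then have "(\<lambda>n. EE (feller_pmf \<theta> n) (\<lambda>\<xi>. \<eta> (feller_partition n n \<xi>) * F (normalized_log_process \<theta> parts n (feller_partition n n \<xi>))) /
       EE (feller_pmf \<theta> n) (\<lambda>\<xi>. \<eta> (feller_partition n n \<xi>))) \<longlonglongrightarrow> ?Y"
      using pos by simp
    then show "(\<lambda>n. \<integral>\<alpha>. F (normalized_log_process \<theta> parts n \<alpha>) \<partial>P n) \<longlonglongrightarrow> ?Y"
    proof (rule Lim_transform_eventually)
      show "\<forall>\<^sub>F n in sequentially. EE (feller_pmf \<theta> n) (\<lambda>\<xi>. \<eta> (feller_partition n n \<xi>) * F (normalized_log_process \<theta> parts n (feller_partition n n \<xi>))) /
         EE (feller_pmf \<theta> n) (\<lambda>\<xi>. \<eta> (feller_partition n n \<xi>)) = (\<integral>\<alpha>. F (normalized_log_process \<theta> parts n \<alpha>) \<partial>P n)"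
        using eventually_ge_at_top[of 1]
        by eventually_elim (simp add: Z perturbed_ewens_expectation[OF \<theta> nonneg])
    qed
  qed
qed

theorem corollary1p4:
  fixes \<theta> :: real and P :: "nat \<Rightarrow> (nat \<Rightarrow> nat) measure"
    and N :: "'w measure" and W :: "real \<Rightarrow> 'w \<Rightarrow> real"
  assumes "\<theta> > 0"
    and "asymptotically_ewens \<theta> P"
    and "standard_brownian_motion N W"
  shows "converges_in_distribution skorohod_topology
           P (normalized_log_process \<theta> lcm_parts) N (\<lambda>\<omega>. \<lambda>t\<in>{0..1}. W (t ^ 3) \<omega>) \<and>
         converges_in_distribution skorohod_topology
           P (normalized_log_process \<theta> prod_parts) N (\<lambda>\<omega>. \<lambda>t\<in>{0..1}. W (t ^ 3) \<omega>)"
  using asymptotically_ewens_log_process[OF assms] by blast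

end
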